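(* Let $\alpha\in(\tfrac12,1)$, $s=s_n=n^{1-\alpha}$, let $\lambda=\lambda_n\in[1,n]$ be a sequence such that $\theta:=\lim_{n\to\infty}\frac{\lambda}{2n}$ exists, let $A=A_n>0$ be a sequence, and let $$C_{\mathrm{sparse}}(\alpha)=\begin{cases}16(1-\theta)\left(\alpha-\frac12\right), & \frac12<\alpha<\frac34,\\[2pt] 16(1-\theta)\left(1-\sqrt{1-\alpha}\right)^2, & \alpha\ge\frac34.\end{cases}$$ Consider testing $H_0:\boldsymbol\beta=\mathbf 0$ against $H_1:\boldsymbol\beta\in\Xi(s_n,A_n)$ on the basis of $\mathbf Y\sim\mathbb P_{\boldsymbol\beta,\lambda}$. (i) If $\lambda\ll\log n$, then all tests are asymptotically powerless irrespective of $A$; i.e. for every sequence $A_n$, every sequence of tests is asymptotically powerless against $\Xi(s_n,A_n)$. (ii) Assume $\lambda\gg\log n$, and let $C^*>0$ be a fixed constant. (a) If $C^*>C_{\mathrm{sparse}}(\alpha)$ and $\tanh(A)\ge\sqrt{\frac{C^*\log n}{\lambda}}$ for all $n$, then the Higher Criticism Test is asymptotically powerful; that is, there is a sequence of thresholds $h_n$ such that the tests rejecting if and only if $HC>h_n$ are asymptotically powerful against $\Xi(s_n,A_n)$. (b) If $C^*<C_{\mathrm{sparse}}(\alpha)$ and $\tanh(A)\le\sqrt{\frac{C^*\log n}{\lambda}}$ for all $n$, then all tests are asymptotically powerless, i.e. every sequence of tests is asymptotically powerless against $\Xi(s_n,A_n)$.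
   Context: Notation: $a_n\ll b_n$ (equivalently $b_n\gg a_n$) means $a_n/b_n\to0$. Model. For $\boldsymbol\beta\in\mathbb R^n$ and $\lambda\in[1,n]$ (known, allowed to depend on $n$), $\mathbb P_{\boldsymbol\beta,\lambda}$ is the law of the symmetric adjacency matrix $\mathbf Y=(Y_{ij})_{1\le i,j\le n}$ with $Y_{ii}=0$, $Y_{ij}=Y_{ji}$, and $(Y_{ij})_{i<j}$ independent Bernoulli variables with success probabilities $p_{ij}=\frac{\lambda}{n}\frac{e^{\beta_i+\beta_j}}{1+e^{\beta_i+\beta_j}}$. The degree of vertex $i$ is $d_i=\sum_{j\ne i}Y_{ij}$. Parameter space. $\Xi(s,A)=\{\boldsymbol\beta\in[0,\infty)^n: |S(\boldsymbol\beta)|=s,\ \beta_i\ge A \text{ for } i\in S(\boldsymbol\beta)\}$, where $S(\boldsymbol\beta)=\{i:\beta_i\ne0\}$. Here $s_n=n^{1-\alpha}$ is understood as an integer. Tests. A test $T_n$ is a measurable $\{0,1\}$-valued function of $\mathbf Y$ (value $1$ means rejecting $H_0$); it may depend on $n,\lambda,s_n,A_n$. Its risk is $\mathrm{Risk}_n(T_n,\Xi(s_n,A_n))=\mathbb P_{\mathbf 0,\lambda}(T_n=1)+\sup_{\boldsymbol\beta\in\Xi(s_n,A_n)}\mathbb P_{\boldsymbol\beta,\lambda}(T_n=0)$. A sequence $T_n$ is asymptotically powerful if $\limsup_{n\to\infty}\mathrm{Risk}_n(T_n,\Xi(s_n,A_n))=0$, and asymptotically powerless if $\liminf_{n\to\infty}\mathrm{Risk}_n(T_n,\Xi(s_n,A_n))\ge1$.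 Higher Criticism statistic. Let $D_i=\dfrac{d_i-\frac{\lambda}{2n}(n-1)}{\sqrt{(n-1)\frac{\lambda}{2n}\left(1-\frac{\lambda}{2n}\right)}}$, and for $t>0$ let $HC(t)=\sum_{i=1}^n\left(\mathbf 1\{D_i>t\}-\mathbb P_{\mathbf 0,\lambda}(D_i>t)\right)$ and $GHC(t)=HC(t)/\sqrt{\mathrm{Var}_{\mathbf 0,\lambda}(HC(t))}$, where $\mathrm{Var}_{\mathbf 0,\lambda}$ is the variance under $\mathbb P_{\mathbf 0,\lambda}$. Then $HC=\sup\{GHC(t): t\in\{\sqrt{2r\log n}: r\in(0,5)\}\cap\mathbb N\}$. *)

theory Defs
  imports "HOL-Probability.Probability"
begin

definition edge_prob :: "nat \<Rightarrow> real \<Rightarrow> (nat \<Rightarrow> real) \<Rightarrow> nat \<Rightarrow> nat \<Rightarrow> real" where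
  "edge_prob n lam \<beta> i j =
     lam / real n * (exp (\<beta> i + \<beta> j) / (1 + exp (\<beta> i + \<beta> j)))"

(* Vertices are 1, ..., n.  A matrix is a function on all pairs of naturals; the entries outside
   {1..n} x {1..n} are almost surely 0 under the law below. *)
definition beta_law :: "nat \<Rightarrow> real \<Rightarrow> (nat \<Rightarrow> real) \<Rightarrow> (nat \<Rightarrow> nat \<Rightarrow> nat) pmf" where
  "beta_law n lam \<beta> =
     map_pmf (\<lambda>X i j. if i < j then of_bool (X (i, j)) else if j < i then of_bool (X (j, i)) else 0)
       (Pi_pmf {(i, j). 1 \<le> i \<and> i < j \<and> j \<le> n} False
          (\<lambda>(i, j). bernoulli_pmf (edge_prob n lam \<beta> i j)))"

abbreviation null_law :: "nat \<Rightarrow> real \<Rightarrow> (nat \<Rightarrow> nat \<Rightarrow> nat) pmf" where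
  "null_law n lam \<equiv> beta_law n lam (\<lambda>_. 0)"

definition deg :: "nat \<Rightarrow> (nat \<Rightarrow> nat \<Rightarrow> nat) \<Rightarrow> nat \<Rightarrow> nat" where
  "deg n Y i = (\<Sum>j\<in>{1..n} - {i}. Y i j)"

definition supp :: "nat \<Rightarrow> (nat \<Rightarrow> real) \<Rightarrow> nat set" where
  "supp n \<beta> = {i\<in>{1..n}. \<beta> i \<noteq> 0}"

definition Xi :: "nat \<Rightarrow> nat \<Rightarrow> real \<Rightarrow> (nat \<Rightarrow> real) set" where
  "Xi n s A =
     {\<beta> \<in> {1..n} \<rightarrow>\<^sub>E {0..}. card (supp n \<beta>) = s \<and> (\<forall>i\<in>supp n \<beta>. A \<le> \<beta> i)}"

(* A test returns True when it rejects the null hypothesis.  Measurability is automatic, because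
   the laws are discrete.  The supremum below is over a subset of [0, 1], which is nonempty
   whenever s <= n. *)
definition risk :: "nat \<Rightarrow> real \<Rightarrow> nat \<Rightarrow> real \<Rightarrow> ((nat \<Rightarrow> nat \<Rightarrow> nat) \<Rightarrow> bool) \<Rightarrow> real" where
  "risk n lam s A T =
     measure_pmf.prob (null_law n lam) {Y. T Y}
     + (SUP \<beta>\<in>Xi n s A. measure_pmf.prob (beta_law n lam \<beta>) {Y. \<not> T Y})"

definition asymp_powerful ::
  "(nat \<Rightarrow> real) \<Rightarrow> (nat \<Rightarrow> nat) \<Rightarrow> (nat \<Rightarrow> real) \<Rightarrow> (nat \<Rightarrow> (nat \<Rightarrow> nat \<Rightarrow> nat) \<Rightarrow> bool) \<Rightarrow> bool" where
  "asymp_powerful lam s A T \<longleftrightarrow>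
     limsup (\<lambda>n. ereal (risk n (lam n) (s n) (A n) (T n))) = 0"

definition asymp_powerless ::
  "(nat \<Rightarrow> real) \<Rightarrow> (nat \<Rightarrow> nat) \<Rightarrow> (nat \<Rightarrow> real) \<Rightarrow> (nat \<Rightarrow> (nat \<Rightarrow> nat \<Rightarrow> nat) \<Rightarrow> bool) \<Rightarrow> bool" where
  "asymp_powerless lam s A T \<longleftrightarrow>
     liminf (\<lambda>n. ereal (risk n (lam n) (s n) (A n) (T n))) \<ge> 1"

definition std_deg :: "nat \<Rightarrow> real \<Rightarrow> (nat \<Rightarrow> nat \<Rightarrow> nat) \<Rightarrow> nat \<Rightarrow> real" where
  "std_deg n lam Y i =
     (real (deg n Y i) - lam / (2 * real n) * (real n - 1))
     / sqrt ((real n - 1) * (lam / (2 * real n)) * (1 - lam / (2 * real n)))"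

definition HC_at :: "nat \<Rightarrow> real \<Rightarrow> real \<Rightarrow> (nat \<Rightarrow> nat \<Rightarrow> nat) \<Rightarrow> real" where
  "HC_at n lam t Y =
     (\<Sum>i = 1..n. of_bool (std_deg n lam Y i > t)
        - measure_pmf.prob (null_law n lam) {Y'. std_deg n lam Y' i > t})"

definition GHC :: "nat \<Rightarrow> real \<Rightarrow> real \<Rightarrow> (nat \<Rightarrow> nat \<Rightarrow> nat) \<Rightarrow> real" where
  "GHC n lam t Y =
     HC_at n lam t Y / sqrt (measure_pmf.variance (null_law n lam) (HC_at n lam t))"

(* For n >= 2 the grid is the finite nonempty set of integers t with 0 < t < sqrt (10 ln n). *)
definition HC_grid :: "nat \<Rightarrow> real set" where
  "HC_grid n = {sqrt (2 * r * ln (real n)) | r. 0 < r \<and> r < 5} \<inter> \<nat>"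

definition HC :: "nat \<Rightarrow> real \<Rightarrow> (nat \<Rightarrow> nat \<Rightarrow> nat) \<Rightarrow> real" where
  "HC n lam Y = (SUP t\<in>HC_grid n. GHC n lam t Y)"

(* Only used for alpha in (1/2, 1). *)
definition C_sparse :: "real \<Rightarrow> real \<Rightarrow> real" where
  "C_sparse \<theta> \<alpha> =
     (if \<alpha> < 3/4 then 16 * (1 - \<theta>) * (\<alpha> - 1/2)
      else 16 * (1 - \<theta>) * (1 - sqrt (1 - \<alpha>))\<^sup>2)"

end

theory Submission
  imports Defs
begin

text \<open>
  Writing \<open>p0 = lam / (2 n)\<close>, an edge with one endpoint in the support has probability
  \<open>p0 (1 + tanh (A / 2))\<close>, so at \<open>tanh A = sqrt (C log n / lam)\<close> the degrees in the support behave like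
  Gaussians shifted by \<open>sqrt (2 \<rho> log n)\<close> standard deviations, \<open>\<rho> = C / (16 (1 - \<theta>))\<close>, and the
  boundary is the one of the sparse Gaussian mixture.

  Lower bounds: the likelihood ratio of a prior spread over the supports has second moment close to 1.
  When the overlap of two supports is \<open>K\<close>, the exponent is dominated by the \<open>K n\<close> edges meeting the
  overlap. Above \<open>\<alpha> = 3/4\<close> one first truncates to the event that no support vertex has more than
  about \<open>sqrt (2 log n)\<close> standard deviations of excess edges to the complement of the support; the
  edge sets used for different support vertices are disjoint, so the truncation costs nothing in dependence.

  Upper bound: the Higher Criticism statistic is increasing in every edge. By stochastic domination the
  vertices outside the support can be compared with the null law, where Chebyshev's inequality applies,
  while the vertices in the support are bounded below by independent counts of edges leaving
  the support. A moderate deviation estimate (exponential tilting) for these counts suffices.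
\<close>

section \<open>Products of Bernoulli laws\<close>

text \<open>All tail estimates are needed only up to factors n^\<epsilon>: the strict inequality
  between C and the critical constant leaves polynomial room, so Chernoff, tilting and Chebyshev
  bounds suffice and logarithmic losses are harmless. Put q = sqrt \<rho> and measure levels in
  units of sqrt (2 log n) standard deviations. For y > q a support vertex exceeds level y with
  probability about n^-(y-q)^2, a null vertex with n^-y^2. Detection needs the count
  n^(1-\<alpha>-(y-q)^2) to beat the null fluctuation n^((1-y^2)/2); the best y is 2q, capped at 1,
  and the cap creates the second branch of the constant. In the second moment two likelihood ratios
  multiply, which doubles the shift to 2q. If 2q > 1, the value n^(2q^2) comes from atypically large
  degrees, and truncating at level 1 lowers it to n^(1-2(1-q)^2). Comparison with the overlap scale
  s^2/n = n^(1-2\<alpha>) yields the same two branches. The standing obstacle is that any two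
  degrees share an edge; in the null variance it is met by an exact formula for the
  covariance.\<close>

definition bprod :: "'e set \<Rightarrow> ('e \<Rightarrow> real) \<Rightarrow> ('e \<Rightarrow> bool) pmf" where
  "bprod E p = Pi_pmf E False (\<lambda>e. bernoulli_pmf (p e))"

definition depends_on :: "(('e \<Rightarrow> bool) \<Rightarrow> 'c) \<Rightarrow> 'e set \<Rightarrow> bool" where
  "depends_on f A \<longleftrightarrow> (\<forall>x y. (\<forall>e\<in>A. x e = y e) \<longrightarrow> f x = f y)"

lemma finite_set_bprod: "finite E \<Longrightarrow> finite (set_pmf (bprod E p))"
  unfolding bprod_def
  by (rule finite_subset[OF set_Pi_pmf_subset'[of E]]) (auto intro!: finite_PiE_dflt)

lemma integrable_bprod [simp]:
  fixes f :: "_ \<Rightarrow> real"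
  shows "finite E \<Longrightarrow> integrable (measure_pmf (bprod E p)) f"
  by (rule integrable_measure_pmf_finite[OF finite_set_bprod])

section \<open>Independence of disjoint coordinate sets\<close>

lemma expectation_pair_mult:
  fixes f g :: "_ \<Rightarrow> real"
  assumes "finite (set_pmf P)" "finite (set_pmf Q)"
  shows "measure_pmf.expectation (pair_pmf P Q) (\<lambda>z. f (fst z) * g (snd z))
    = measure_pmf.expectation P f * measure_pmf.expectation Q g"
proof -
  have "measure_pmf.expectation (pair_pmf P Q) (\<lambda>z. f (fst z) * g (snd z))
      = (\<Sum>z\<in>set_pmf P \<times> set_pmf Q. f (fst z) * g (snd z) * pmf (pair_pmf P Q) z)"
    using assms by (intro integral_measure_pmf_real) auto
  also have "\<dots> = (\<Sum>x\<in>set_pmf P. \<Sum>y\<in>set_pmf Q. (f x * pmf P x) * (g y * pmf Q y))"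
    by (subst sum.cartesian_product) (auto simp: pmf_pair intro!: sum.cong)
  also have "\<dots> = (\<Sum>x\<in>set_pmf P. f x * pmf P x) * (\<Sum>y\<in>set_pmf Q. g y * pmf Q y)"
    by (simp add: sum_product)
  also have "(\<Sum>x\<in>set_pmf P. f x * pmf P x) = measure_pmf.expectation P f"
    using assms by (intro integral_measure_pmf_real[symmetric]) auto
  also have "(\<Sum>y\<in>set_pmf Q. g y * pmf Q y) = measure_pmf.expectation Q g"
    using assms by (intro integral_measure_pmf_real[symmetric]) auto
  finally show ?thesis .
qed

text \<open>Cutting E into \<open>E \<inter> A\<close> and \<open>E - A\<close> presents the law as
  the image of two independent halves; f sees only the first and g only the second.\<close>

lemma expectation_mult_depends_on:
  fixes f g :: "_ \<Rightarrow> real"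
  assumes E: "finite E" and f: "depends_on f A" and g: "depends_on g B" and AB: "A \<inter> B = {}"
  shows "measure_pmf.expectation (bprod E p) (\<lambda>x. f x * g x)
    = measure_pmf.expectation (bprod E p) f * measure_pmf.expectation (bprod E p) g"
proof -
  let ?P = "bprod (E \<inter> A) p" and ?Q = "bprod (E - A) p"
  define h where "h = (\<lambda>(x, y) e. if e \<in> E \<inter> A then x e else (y e :: bool))"
  have fin: "finite (set_pmf ?P)" "finite (set_pmf ?Q)"
    using E by (simp_all add: finite_set_bprod)
  have "bprod (E \<inter> A \<union> (E - A)) p = map_pmf h (pair_pmf ?P ?Q)"
    unfolding bprod_def h_def using E by (intro Pi_pmf_union) auto
  then have *: "bprod E p = map_pmf h (pair_pmf ?P ?Q)"
    by (simp add: Un_Diff_Int Int_Diff_Un)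
  \<comment> \<open>Outside its index set each half takes the default \<open>False\<close>. This
    makes f agree on the glued configuration and on the first half even at coordinates of A outside
    E.\<close>
  have x_out: "x e = False" if "x \<in> set_pmf ?P" "e \<notin> E \<inter> A" for x e
    using set_Pi_pmf_subset[of "E \<inter> A" False "\<lambda>e. bernoulli_pmf (p e)"] that E
    unfolding bprod_def by auto
  have y_out: "y e = False" if "y \<in> set_pmf ?Q" "e \<notin> E - A" for y e
    using set_Pi_pmf_subset[of "E - A" False "\<lambda>e. bernoulli_pmf (p e)"] that E
    unfolding bprod_def by auto
  have fh: "f (h z) = f (fst z)" and gh: "g (h z) = g (snd z)"
    if "z \<in> set_pmf (pair_pmf ?P ?Q)" for z
  proof -
    have z: "fst z \<in> set_pmf ?P" "snd z \<in> set_pmf ?Q"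
      using that by (simp_all add: mem_Times_iff)
    show "f (h z) = f (fst z)"
      using f x_out[OF z(1)] y_out[OF z(2)] unfolding depends_on_def h_def
      by (elim allE[of _ "case z of (x, y) \<Rightarrow> \<lambda>e. if e \<in> E \<inter> A then x e else y e"] allE[of _ "fst z"] mp) (auto simp: case_prod_beta)
    show "g (h z) = g (snd z)"
      using g AB unfolding depends_on_def h_def
      by (elim allE[of _ "case z of (x, y) \<Rightarrow> \<lambda>e. if e \<in> E \<inter> A then x e else y e"] allE[of _ "snd z"] mp) (auto simp: case_prod_beta)
  qed
  have "measure_pmf.expectation (bprod E p) (\<lambda>x. f x * g x)
      = measure_pmf.expectation (pair_pmf ?P ?Q) (\<lambda>z. f (h z) * g (h z))"
    unfolding * by simp
  also have "\<dots> = measure_pmf.expectation (pair_pmf ?P ?Q) (\<lambda>z. f (fst z) * g (snd z))"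
    by (intro Bochner_Integration.integral_cong_AE) (auto simp: AE_measure_pmf_iff fh gh simp del: set_pair_pmf)
  also have "\<dots> = measure_pmf.expectation ?P f * measure_pmf.expectation ?Q g"
    by (rule expectation_pair_mult[OF fin])
  also have "measure_pmf.expectation ?P f = measure_pmf.expectation (pair_pmf ?P ?Q) (\<lambda>z. f (fst z))"
    by simp
  also have "\<dots> = measure_pmf.expectation (pair_pmf ?P ?Q) (\<lambda>z. f (h z))"
    by (intro Bochner_Integration.integral_cong_AE) (auto simp: AE_measure_pmf_iff fh simp del: set_pair_pmf)
  also have "\<dots> = measure_pmf.expectation (bprod E p) f"
    unfolding * by simp
  also have "measure_pmf.expectation ?Q g = measure_pmf.expectation (pair_pmf ?P ?Q) (\<lambda>z. g (snd z))"
    by simp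
  also have "\<dots> = measure_pmf.expectation (pair_pmf ?P ?Q) (\<lambda>z. g (h z))"
    by (intro Bochner_Integration.integral_cong_AE) (auto simp: AE_measure_pmf_iff gh simp del: set_pair_pmf)
  also have "\<dots> = measure_pmf.expectation (bprod E p) g"
    unfolding * by simp
  finally show ?thesis .
qed

lemma expectation_bprod_coord:
  fixes f :: "bool \<Rightarrow> real"
  assumes "finite E" "e \<in> E" "0 \<le> p e" "p e \<le> 1"
  shows "measure_pmf.expectation (bprod E p) (\<lambda>x. f (x e)) = p e * f True + (1 - p e) * f False"
proof -
  have "measure_pmf.expectation (bprod E p) (\<lambda>x. f (x e))
      = measure_pmf.expectation (map_pmf (\<lambda>x. x e) (bprod E p)) f"
    by simp
  also have "map_pmf (\<lambda>x. x e) (bprod E p) = bernoulli_pmf (p e)"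
    unfolding bprod_def using assms by (subst Pi_pmf_component) auto
  finally show ?thesis
    using assms by simp
qed

lemma expectation_bprod_prod:
  fixes f :: "'e \<Rightarrow> bool \<Rightarrow> real"
  assumes E: "finite E" and M: "M \<subseteq> E" and p: "\<And>e. e \<in> M \<Longrightarrow> 0 \<le> p e \<and> p e \<le> 1"
  shows "measure_pmf.expectation (bprod E p) (\<lambda>x. \<Prod>e\<in>M. f e (x e))
    = (\<Prod>e\<in>M. p e * f e True + (1 - p e) * f e False)"
proof -
  have "finite M" using E M finite_subset by blast
  then show ?thesis using M p
  proof (induction M rule: finite_induct)
    case (insert e M)
    have "measure_pmf.expectation (bprod E p) (\<lambda>x. f e (x e) * (\<Prod>e\<in>M. f e (x e)))
      = measure_pmf.expectation (bprod E p) (\<lambda>x. f e (x e)) *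
        measure_pmf.expectation (bprod E p) (\<lambda>x. \<Prod>e\<in>M. f e (x e))"
      using insert by (intro expectation_mult_depends_on[of E _ "{e}" _ M] E)
        (auto simp: depends_on_def intro!: prod.cong)
    with insert show ?case
      by (simp add: expectation_bprod_coord[OF E, of e p "f e"])
  qed simp
qed

lemma pmf_bprod:
  assumes "finite E" "\<And>e. e \<in> E \<Longrightarrow> 0 \<le> p e \<and> p e \<le> 1" "\<And>e. e \<notin> E \<Longrightarrow> \<not> x e"
  shows "pmf (bprod E p) x = (\<Prod>e\<in>E. if x e then p e else 1 - p e)"
proof -
  have "pmf (bprod E p) x = (\<Prod>e\<in>E. pmf (bernoulli_pmf (p e)) (x e))"
    unfolding bprod_def using assms by (intro pmf_Pi') auto
  also have "\<dots> = (\<Prod>e\<in>E. if x e then p e else 1 - p e)"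
    using assms(2) by (intro prod.cong) (auto split: if_splits)
  finally show ?thesis .
qed

section \<open>Change of measure and stochastic order\<close>

definition lratio :: "'e set \<Rightarrow> ('e \<Rightarrow> real) \<Rightarrow> ('e \<Rightarrow> real) \<Rightarrow> ('e \<Rightarrow> bool) \<Rightarrow> real" where
  "lratio E p q x = (\<Prod>e\<in>E. if x e then q e / p e else (1 - q e) / (1 - p e))"

text \<open>With p strictly between 0 and 1 every configuration on E has positive mass, so the
  density exists even where q reaches 0 or 1.\<close>

lemma expectation_change_measure:
  fixes f :: "_ \<Rightarrow> real"
  assumes E: "finite E" and p: "\<And>e. e \<in> E \<Longrightarrow> 0 < p e \<and> p e < 1"
    and q: "\<And>e. e \<in> E \<Longrightarrow> 0 \<le> q e \<and> q e \<le> 1"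
  shows "measure_pmf.expectation (bprod E q) f
    = measure_pmf.expectation (bprod E p) (\<lambda>x. lratio E p q x * f x)"
proof -
  define \<Omega> where "\<Omega> = PiE_dflt E False (\<lambda>_. UNIV :: bool set)"
  have fin: "finite \<Omega>" unfolding \<Omega>_def using E by auto
  have sup: "set_pmf (bprod E r) \<subseteq> \<Omega>" for r
    unfolding \<Omega>_def bprod_def using set_Pi_pmf_subset[OF E, of False "\<lambda>e. bernoulli_pmf (r e)"]
    by (auto simp: PiE_dflt_def)
  have "measure_pmf.expectation (bprod E q) f = (\<Sum>x\<in>\<Omega>. f x * pmf (bprod E q) x)"
    using sup[of q] by (intro integral_measure_pmf_real fin) auto
  also have "\<dots> = (\<Sum>x\<in>\<Omega>. lratio E p q x * f x * pmf (bprod E p) x)"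
  proof (intro sum.cong refl)
    fix x assume "x \<in> \<Omega>"
    then have x: "\<And>e. e \<notin> E \<Longrightarrow> \<not> x e" by (auto simp: \<Omega>_def PiE_dflt_def)
    have "pmf (bprod E q) x = (\<Prod>e\<in>E. if x e then q e else 1 - q e)"
      by (rule pmf_bprod[OF E q x])
    also have "\<dots> = lratio E p q x * (\<Prod>e\<in>E. if x e then p e else 1 - p e)"
      unfolding lratio_def prod.distrib[symmetric]
    proof (intro prod.cong refl)
      fix e assume "e \<in> E" then show "(if x e then q e else 1 - q e) =
         (if x e then q e / p e else (1 - q e) / (1 - p e)) * (if x e then p e else 1 - p e)"
        using p[of e] by auto
    qed
    also have "(\<Prod>e\<in>E. if x e then p e else 1 - p e) = pmf (bprod E p) x"
      using p by (intro pmf_bprod[OF E _ x, symmetric]) (auto intro: less_imp_le)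
    finally show "f x * pmf (bprod E q) x = lratio E p q x * f x * pmf (bprod E p) x"
      by simp
  qed
  also have "\<dots> = measure_pmf.expectation (bprod E p) (\<lambda>x. lratio E p q x * f x)"
    using sup[of p] by (intro integral_measure_pmf_real[symmetric] fin) auto
  finally show ?thesis .
qed

lemma prob_eq_expectation: "measure_pmf.prob P B = measure_pmf.expectation P (\<lambda>x. of_bool (x \<in> B))"
proof -
  have "(\<lambda>x. of_bool (x \<in> B) :: real) = indicator B" by (auto simp: indicator_def)
  then show ?thesis by simp
qed

text \<open>Monotone coupling: keep every success of the first variable and turn its failures into
  successes with probability r.\<close>

lemma bernoulli_coupling:
  assumes "0 \<le> p" "p \<le> q" "q \<le> 1"
  obtains C :: "(bool \<times> bool) pmf" where "map_pmf fst C = bernoulli_pmf p"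
    "map_pmf snd C = bernoulli_pmf q" "\<And>z. z \<in> set_pmf C \<Longrightarrow> fst z \<longrightarrow> snd z"
proof (cases "p = 1")
  case True
  then show ?thesis using assms
    by (intro that[of "map_pmf (\<lambda>x. (x, x)) (bernoulli_pmf q)"]) (auto simp: pmf.map_comp o_def)
next
  case False
  \<comment> \<open>Solves p + (1 - p) r = q; the case p = 1 is split off because of the
    denominator.\<close>
  define r where "r = (q - p) / (1 - p)"
  have r: "0 \<le> r" "r \<le> 1" using assms False by (auto simp: r_def field_simps)
  define C where "C = bind_pmf (bernoulli_pmf p) (\<lambda>a. map_pmf (\<lambda>b. (a, a \<or> b)) (bernoulli_pmf r))"
  have 1: "map_pmf fst C = bernoulli_pmf p"
    unfolding C_def by (simp only: map_bind_pmf pmf.map_comp o_def fst_conv map_pmf_const bind_return_pmf')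
  have "map_pmf snd C = bernoulli_pmf q"
  proof (rule pmf_eqI)
    fix b
    have "map_pmf snd C = bind_pmf (bernoulli_pmf p) (\<lambda>a. map_pmf (\<lambda>b. a \<or> b) (bernoulli_pmf r))"
      unfolding C_def by (simp only: map_bind_pmf pmf.map_comp o_def snd_conv)
    moreover have "(\<or>) True = (\<lambda>_. True)" "(\<or>) False = (\<lambda>b. b)"
      by auto
    ultimately have "pmf (map_pmf snd C) b = p * pmf (return_pmf True) b + (1 - p) * pmf (bernoulli_pmf r) b"
      using assms by (simp add: pmf_bind mult.commute map_pmf_const)
    also have "\<dots> = pmf (bernoulli_pmf q) b"
      using assms r False by (cases b) (auto simp: r_def field_simps)
    finally show "pmf (map_pmf snd C) b = pmf (bernoulli_pmf q) b" .
  qed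
  with 1 show ?thesis
    by (rule that) (auto simp: C_def)
qed

text \<open>B is closed downwards. Coupling all coordinates puts the p-sample pointwise below the
  q-sample, so the latter lies in B only if the former does.\<close>

lemma prob_bprod_antimono:
  assumes E: "finite E" and pq: "\<And>e. e \<in> E \<Longrightarrow> 0 \<le> p e \<and> p e \<le> q e \<and> q e \<le> 1"
    and B: "\<And>x y. y \<in> B \<Longrightarrow> (\<And>e. x e \<longrightarrow> y e) \<Longrightarrow> x \<in> B"
  shows "measure_pmf.prob (bprod E q) B \<le> measure_pmf.prob (bprod E p) B"
proof -
  have "\<exists>C. map_pmf fst C = bernoulli_pmf (p e) \<and> map_pmf snd C = bernoulli_pmf (q e) \<and>
      (\<forall>z\<in>set_pmf C. fst z \<longrightarrow> snd z)" if "e \<in> E" for e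
    using pq[OF that] by (meson bernoulli_coupling)
  then obtain C where C: "\<And>e. e \<in> E \<Longrightarrow> map_pmf fst (C e) = bernoulli_pmf (p e)"
    "\<And>e. e \<in> E \<Longrightarrow> map_pmf snd (C e) = bernoulli_pmf (q e)"
    "\<And>e z. e \<in> E \<Longrightarrow> z \<in> set_pmf (C e) \<Longrightarrow> fst z \<longrightarrow> snd z"
    by metis
  define J where "J = Pi_pmf E (False, False) C"
  have "bprod E p = Pi_pmf E False (\<lambda>e. map_pmf fst (C e))"
    unfolding bprod_def using C by (intro Pi_pmf_cong) auto
  then have p: "bprod E p = map_pmf (\<lambda>h. fst \<circ> h) J"
    unfolding J_def using E by (subst (asm) Pi_pmf_map[of _ _ "(False, False)"]) auto
  have "bprod E q = Pi_pmf E False (\<lambda>e. map_pmf snd (C e))"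
    unfolding bprod_def using C by (intro Pi_pmf_cong) auto
  then have q: "bprod E q = map_pmf (\<lambda>h. snd \<circ> h) J"
    unfolding J_def using E by (subst (asm) Pi_pmf_map[of _ _ "(False, False)"]) auto
  have mono: "fst (h e) \<longrightarrow> snd (h e)" if "h \<in> set_pmf J" for h e
  proof (cases "e \<in> E")
    case True
    then show ?thesis using that C(3)[OF True, of "h e"] E
      unfolding J_def by (auto simp: set_Pi_pmf PiE_dflt_def)
  next
    case False
    then show ?thesis using that E
      unfolding J_def by (auto simp: set_Pi_pmf PiE_dflt_def)
  qed
  have "measure_pmf.prob J {h. snd \<circ> h \<in> B} \<le> measure_pmf.prob J {h. fst \<circ> h \<in> B}"
  proof (rule measure_pmf.finite_measure_mono_AE)
    show "AE h in J. h \<in> {h. snd \<circ> h \<in> B} \<longrightarrow> h \<in> {h. fst \<circ> h \<in> B}"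
      using mono B by (auto simp: AE_measure_pmf_iff)
  qed auto
  then show ?thesis
    unfolding p q by (simp add: vimage_def)
qed

text \<open>Centring before the Taylor expansion keeps the exact variance p (1 - p); with p alone
  the factor 1 - \<theta> of the critical constant would be lost. In the applications u has either
  sign and tends to 0, so the factor \<open>exp \<bar>u\<bar>\<close> is harmless.\<close>

lemma bernoulli_mgf_le:
  fixes p u :: real
  assumes "0 \<le> p" "p \<le> 1"
  shows "1 - p + p * exp u \<le> exp (p * u + p * (1 - p) * u\<^sup>2 / 2 * exp \<bar>u\<bar>)"
proof -
  have exp_le: "exp x \<le> 1 + x + x\<^sup>2 / 2 * exp \<bar>u\<bar>" if "\<bar>x\<bar> \<le> \<bar>u\<bar>" for x
  proof -
    obtain t where t: "\<bar>t\<bar> \<le> \<bar>x\<bar>" "exp x = (\<Sum>m<2. x ^ m / fact m) + exp t / fact 2 * x ^ 2"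
      using Maclaurin_exp_le[of x 2] by blast
    have "exp t * x\<^sup>2 \<le> exp \<bar>u\<bar> * x\<^sup>2"
      using t that by (intro mult_right_mono) auto
    then show ?thesis
      using t(2) by (simp add: numeral_2_eq_2 field_simps)
  qed
  have "1 - p + p * exp u = exp (p * u) * ((1 - p) * exp (- p * u) + p * exp ((1 - p) * u))"
    by (simp add: algebra_simps flip: exp_add)
  also have "\<dots> \<le> exp (p * u) * ((1 - p) * (1 + (- p * u) + (- p * u)\<^sup>2 / 2 * exp \<bar>u\<bar>)
      + p * (1 + (1 - p) * u + ((1 - p) * u)\<^sup>2 / 2 * exp \<bar>u\<bar>))"
    using assms by (intro mult_left_mono add_mono exp_le) (auto simp: abs_mult mult_left_le_one_le)
  also have "\<dots> = exp (p * u) * (1 + p * (1 - p) * u\<^sup>2 / 2 * exp \<bar>u\<bar>)"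
    by (simp add: field_simps power2_eq_square)
  also have "\<dots> \<le> exp (p * u) * exp (p * (1 - p) * u\<^sup>2 / 2 * exp \<bar>u\<bar>)"
    by (intro mult_left_mono) auto
  finally show ?thesis by (simp add: exp_add)
qed

lemma prob_bprod_chernoff:
  fixes p :: "'e \<Rightarrow> real"
  assumes E: "finite E" and M: "M \<subseteq> E" and p: "\<And>e. e \<in> M \<Longrightarrow> 0 \<le> p e \<and> p e \<le> 1" and u: "0 \<le> u"
  shows "measure_pmf.prob (bprod E p) {x. \<tau> < (\<Sum>e\<in>M. of_bool (x e))}
    \<le> exp (- u * \<tau>) * (\<Prod>e\<in>M. 1 - p e + p e * exp u)"
proof -
  have fM: "finite M" using E M finite_subset by blast
  have "measure_pmf.prob (bprod E p) {x. \<tau> < (\<Sum>e\<in>M. of_bool (x e))}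
      \<le> measure_pmf.expectation (bprod E p) (\<lambda>x. exp (- u * \<tau>) * (\<Prod>e\<in>M. exp (u * of_bool (x e))))"
    unfolding prob_eq_expectation
  proof (intro integral_mono integrable_bprod E)
    fix x :: "'e \<Rightarrow> bool"
    have "exp (- u * \<tau>) * (\<Prod>e\<in>M. exp (u * of_bool (x e))) = exp (u * ((\<Sum>e\<in>M. of_bool (x e)) - \<tau>))"
      using fM by (simp add: exp_sum[symmetric] sum_distrib_left[symmetric] algebra_simps flip: exp_add)
    then show "of_bool (x \<in> {x. \<tau> < (\<Sum>e\<in>M. of_bool (x e))})
        \<le> exp (- u * \<tau>) * (\<Prod>e\<in>M. exp (u * of_bool (x e)))"
      using u by (auto simp: of_bool_def)
  qed
  also have "\<dots> = exp (- u * \<tau>) * measure_pmf.expectation (bprod E p) (\<lambda>x. \<Prod>e\<in>M. exp (u * of_bool (x e)))"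
    by simp
  also have "measure_pmf.expectation (bprod E p) (\<lambda>x. \<Prod>e\<in>M. exp (u * of_bool (x e)))
      = (\<Prod>e\<in>M. 1 - p e + p e * exp u)"
    by (subst expectation_bprod_prod[OF E M p, where f = "\<lambda>_ b. exp (u * of_bool b)"])
      (auto simp: algebra_simps)
  finally show ?thesis .
qed

text \<open>The worst-case error dominates the average over I, and discarding the complement of
  \<open>\<Gamma> i\<close> only lowers the error of each mixture component. The truncated mixture
  ratio has mean at least 1 - \<eta> and second moment at most D, hence squared distance at most D -
  1 + 2 \<eta> from the constant 1.\<close>

lemma lecam_truncated:
  fixes P :: "'a pmf" and Q :: "'i \<Rightarrow> 'a pmf" and L :: "'i \<Rightarrow> 'a \<Rightarrow> real"
  assumes P: "finite (set_pmf P)" and I: "finite I" "I \<noteq> {}"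
    and L: "\<And>i f. i \<in> I \<Longrightarrow> measure_pmf.expectation (Q i) f = measure_pmf.expectation P (\<lambda>x. L i x * f x)"
    and \<eta>: "\<And>i. i \<in> I \<Longrightarrow> measure_pmf.prob (Q i) (- \<Gamma> i) \<le> \<eta>"
    and D: "(\<Sum>i\<in>I. \<Sum>j\<in>I. measure_pmf.expectation P
        (\<lambda>x. (L i x * of_bool (x \<in> \<Gamma> i)) * (L j x * of_bool (x \<in> \<Gamma> j)))) \<le> D * real (card I) ^ 2"
    and R: "\<And>i. i \<in> I \<Longrightarrow> measure_pmf.prob (Q i) {x. \<not> T x} \<le> R"
  shows "1 - sqrt (D - 1 + 2 * \<eta>) \<le> measure_pmf.prob P {x. T x} + R"
proof -
  let ?E = "measure_pmf.expectation P"
  have int [simp]: "integrable (measure_pmf P) f" for f :: "'a \<Rightarrow> real"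
    by (rule integrable_measure_pmf_finite[OF P])
  define m where "m = real (card I)"
  have m: "m > 0" using I by (simp add: m_def card_gt_0_iff)
  define Lt where "Lt x = (\<Sum>i\<in>I. L i x * of_bool (x \<in> \<Gamma> i)) / m" for x
  have E_Lt: "?E (\<lambda>x. Lt x * f x) = (\<Sum>i\<in>I. measure_pmf.expectation (Q i) (\<lambda>x. of_bool (x \<in> \<Gamma> i) * f x)) / m" for f
  proof -
    have "(\<lambda>x. Lt x * f x) = (\<lambda>x. (\<Sum>i\<in>I. L i x * (of_bool (x \<in> \<Gamma> i) * f x)) / m)"
      by (auto simp: Lt_def sum_distrib_right mult.assoc sum_divide_distrib)
    then have "?E (\<lambda>x. Lt x * f x) = (\<Sum>i\<in>I. ?E (\<lambda>x. L i x * (of_bool (x \<in> \<Gamma> i) * f x))) / m"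
      by (simp add: Bochner_Integration.integral_sum)
    then show ?thesis by (simp add: L)
  qed
  have E_Lt_one: "1 - \<eta> \<le> ?E Lt"
  proof -
    have "1 - \<eta> \<le> measure_pmf.expectation (Q i) (\<lambda>x. of_bool (x \<in> \<Gamma> i))" if "i \<in> I" for i
      using \<eta>[OF that] measure_pmf.prob_compl[of "\<Gamma> i" "Q i"]
      by (simp add: prob_eq_expectation[symmetric] Compl_eq_Diff_UNIV)
    then have "(\<Sum>i\<in>I. 1 - \<eta>) \<le> (\<Sum>i\<in>I. measure_pmf.expectation (Q i) (\<lambda>x. of_bool (x \<in> \<Gamma> i)))"
      by (intro sum_mono)
    then have "1 - \<eta> \<le> (\<Sum>i\<in>I. measure_pmf.expectation (Q i) (\<lambda>x. of_bool (x \<in> \<Gamma> i))) / m"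
      using m by (simp add: m_def field_simps)
    then show ?thesis using E_Lt[of "\<lambda>_. 1"] by simp
  qed
  have sq: "?E (\<lambda>x. (Lt x)\<^sup>2) \<le> D"
  proof -
    have "(\<lambda>x. (Lt x)\<^sup>2) = (\<lambda>x. (\<Sum>i\<in>I. \<Sum>j\<in>I. (L i x * of_bool (x \<in> \<Gamma> i)) * (L j x * of_bool (x \<in> \<Gamma> j))) / m\<^sup>2)"
      by (auto simp: Lt_def power_divide power2_eq_square sum_product)
    then have "?E (\<lambda>x. (Lt x)\<^sup>2) = (\<Sum>i\<in>I. \<Sum>j\<in>I. ?E (\<lambda>x. (L i x * of_bool (x \<in> \<Gamma> i)) * (L j x * of_bool (x \<in> \<Gamma> j)))) / m\<^sup>2"
      by (simp add: Bochner_Integration.integral_sum)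
    also have "\<dots> \<le> D" using D m by (simp add: m_def field_simps)
    finally show ?thesis .
  qed
  \<comment> \<open>Restriction to the acceptance region: E Z is at most R minus the null acceptance
    probability, while Cauchy-Schwarz bounds E Z from below by the distance of \<open>Lt\<close>
    from 1.\<close>
  define Z where "Z x = (Lt x - 1) * of_bool (\<not> T x)" for x
  have "(?E Z)\<^sup>2 \<le> ?E (\<lambda>x. (Z x)\<^sup>2)"
    using measure_pmf.variance_eq[of P Z] measure_pmf.variance_positive[of P Z] by simp
  also have "\<dots> \<le> ?E (\<lambda>x. (Lt x - 1)\<^sup>2)"
    by (intro integral_mono) (auto simp: Z_def of_bool_def)
  also have "(\<lambda>x. (Lt x - 1)\<^sup>2) = (\<lambda>x. (Lt x)\<^sup>2 - 2 * Lt x + 1)"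
    by (auto simp: power2_eq_square algebra_simps)
  also have "?E \<dots> = ?E (\<lambda>x. (Lt x)\<^sup>2) - 2 * ?E Lt + 1"
    by simp
  also have "\<dots> \<le> D - 1 + 2 * \<eta>"
    using sq E_Lt_one by simp
  finally have Z: "- sqrt (D - 1 + 2 * \<eta>) \<le> ?E Z"
    by (metis abs_le_D2 minus_le_iff real_sqrt_abs real_sqrt_le_mono)
  have "?E (\<lambda>x. Lt x * of_bool (\<not> T x)) \<le> R"
  proof -
    have "measure_pmf.expectation (Q i) (\<lambda>x. of_bool (x \<in> \<Gamma> i) * of_bool (\<not> T x)) \<le> R" if "i \<in> I" for i
    proof -
      have "measure_pmf.expectation (Q i) (\<lambda>x. of_bool (x \<in> \<Gamma> i) * of_bool (\<not> T x))
         = measure_pmf.prob (Q i) {x. x \<in> \<Gamma> i \<and> \<not> T x}"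
        by (simp add: prob_eq_expectation of_bool_conj)
      also have "\<dots> \<le> measure_pmf.prob (Q i) {x. \<not> T x}"
        by (intro measure_pmf.finite_measure_mono) auto
      finally show ?thesis using R[OF that] by simp
    qed
    then have "(\<Sum>i\<in>I. measure_pmf.expectation (Q i) (\<lambda>x. of_bool (x \<in> \<Gamma> i) * of_bool (\<not> T x))) \<le> (\<Sum>i\<in>I. R)"
      by (intro sum_mono)
    then show ?thesis unfolding E_Lt using m by (simp add: m_def field_simps)
  qed
  moreover have "?E Z = ?E (\<lambda>x. Lt x * of_bool (\<not> T x)) - ?E (\<lambda>x. of_bool (\<not> T x))"
    unfolding Z_def by (simp add: algebra_simps)
  moreover have "?E (\<lambda>x. of_bool (\<not> T x)) = 1 - measure_pmf.prob P {x. T x}"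
    using measure_pmf.prob_compl[of "{x. T x}" P]
    by (simp add: prob_eq_expectation[symmetric] prob_eq_expectation[of P "UNIV - {x. T x}"])
  ultimately show ?thesis using Z by linarith
qed

text \<open>The derivative of the relative entropy in its first argument y is the log odds ratio, at
  most (y - p) / (p (1 - y)). Integrating it produces the factor 1/2 that the sharp exponent
  requires; applying ln x \<le> x - 1 directly to the entropy would lose it.\<close>

lemma bernoulli_KL_le:
  fixes p q :: real
  assumes "0 < p" "p \<le> q" "q < 1"
  shows "q * ln (q / p) + (1 - q) * ln ((1 - q) / (1 - p)) \<le> (q - p)\<^sup>2 / (2 * p * (1 - q))"
proof -
  \<comment> \<open>The denominator is frozen at the endpoint q and only the numerator moves with y,
    so monotonicity of g between p and q is the claim.\<close>
  define g where "g y = (y - p)\<^sup>2 / (2 * p * (1 - q)) - (y * (ln y - ln p) + (1 - y) * (ln (1 - y) - ln (1 - p)))" for y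
  have "g p \<le> g q"
  proof (rule DERIV_nonneg_imp_nondecreasing[OF assms(2)])
    fix y assume y: "p \<le> y" "y \<le> q"
    let ?d = "(y - p) / (p * (1 - q)) - (ln y - ln p - (ln (1 - y) - ln (1 - p)))"
    define k where "k = 2 * p * (1 - q)"
    have k: "k \<noteq> 0" using assms by (simp add: k_def)
    have "((\<lambda>y. (y - p)\<^sup>2 / k) has_real_derivative 2 * (y - p) / k) (at y)"
      using k by (auto intro!: derivative_eq_intros)
    moreover have "((\<lambda>y. y * (ln y - ln p)) has_real_derivative (ln y - ln p + 1)) (at y)"
      using assms y by (auto intro!: derivative_eq_intros)
    moreover have "((\<lambda>y. (1 - y) * (ln (1 - y) - ln (1 - p))) has_real_derivative (- (ln (1 - y) - ln (1 - p)) - 1)) (at y)"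
      using assms y by (auto intro!: derivative_eq_intros)
    ultimately have "(g has_real_derivative 2 * (y - p) / k - ((ln y - ln p + 1) + (- (ln (1 - y) - ln (1 - p)) - 1))) (at y)"
      unfolding g_def k_def[symmetric] by (intro DERIV_diff DERIV_add)
    moreover have "2 * (y - p) / k - ((ln y - ln p + 1) + (- (ln (1 - y) - ln (1 - p)) - 1)) = ?d"
      using assms by (simp add: k_def field_simps)
    ultimately have "(g has_real_derivative ?d) (at y)"
      by (simp only:)
    moreover have "0 \<le> ?d"
    proof -
      have "ln y - ln p - (ln (1 - y) - ln (1 - p)) = ln (y * (1 - p) / (p * (1 - y)))"
        using assms y by (simp add: ln_div ln_mult)
      also have "\<dots> \<le> y * (1 - p) / (p * (1 - y)) - 1"
        using assms y by (intro ln_le_minus_one) auto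
      also have "\<dots> = (y - p) / (p * (1 - y))"
        using assms y by (simp add: field_simps)
      also have "\<dots> \<le> (y - p) / (p * (1 - q))"
        using assms y by (intro divide_left_mono mult_left_mono) auto
      finally show ?thesis by simp
    qed
    ultimately show "\<exists>d. (g has_real_derivative d) (at y) \<and> 0 \<le> d" by blast
  qed
  then show ?thesis
    using assms by (simp add: g_def ln_div)
qed

lemma depends_on_comp: "depends_on f A \<Longrightarrow> depends_on (\<lambda>x. g (f x)) A"
  unfolding depends_on_def by metis

lemma depends_on_sum: "depends_on (\<lambda>x. \<Sum>e\<in>M. of_bool (x e) :: real) M"
  unfolding depends_on_def by (auto intro!: sum.cong)

lemma expectation_bprod_restrict:
  fixes f :: "_ \<Rightarrow> real"
  assumes "finite E" "M \<subseteq> E" "depends_on f M"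
  shows "measure_pmf.expectation (bprod E p) f = measure_pmf.expectation (bprod M p) f"
proof -
  have "bprod M p = map_pmf (\<lambda>x e. if e \<in> M then x e else False) (bprod E p)"
    unfolding bprod_def using assms by (intro Pi_pmf_subset)
  moreover have "f (\<lambda>e. if e \<in> M then x e else False) = f x" for x
    using assms(3) unfolding depends_on_def by (elim allE[of _ "\<lambda>e. if e \<in> M then x e else False"] allE[of _ x] mp) auto
  ultimately show ?thesis by simp
qed

lemma expectation_centered_mult:
  fixes p :: real
  assumes E: "finite E" and p: "0 \<le> p" "p \<le> 1" and ef: "e \<in> E" "f \<in> E"
  shows "measure_pmf.expectation (bprod E (\<lambda>_. p)) (\<lambda>x. (of_bool (x e) - p) * (of_bool (x f) - p))
    = (if e = f then p * (1 - p) else 0)"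
proof (cases "e = f")
  case True
  then show ?thesis
    using expectation_bprod_coord[OF E ef(1), of "\<lambda>_. p" "\<lambda>b. (of_bool b - p) * (of_bool b - p)"] p
    by (simp add: algebra_simps)
next
  case False
  let ?E = "measure_pmf.expectation (bprod E (\<lambda>_. p))"
  have "?E (\<lambda>x. (of_bool (x e) - p) * (of_bool (x f) - p))
      = ?E (\<lambda>x. (of_bool (x e) - p)) * ?E (\<lambda>x. (of_bool (x f) - p))"
    using False by (intro expectation_mult_depends_on[of _ _ "{e}" _ "{f}"] E) (auto simp: depends_on_def)
  also have "?E (\<lambda>x. (of_bool (x e) - p)) = 0"
    using expectation_bprod_coord[OF E ef(1), of "\<lambda>_. p" "\<lambda>b. of_bool b - p"] p
    by (simp add: algebra_simps)
  finally show ?thesis using False by simp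
qed

lemma expectation_centered_square:
  fixes p :: real
  assumes E: "finite E" and M: "M \<subseteq> E" and p: "0 \<le> p" "p \<le> 1"
  shows "measure_pmf.expectation (bprod E (\<lambda>_. p)) (\<lambda>x. (\<Sum>e\<in>M. of_bool (x e) - p)\<^sup>2)
    = card M * p * (1 - p)"
proof -
  have fM: "finite M" using E M finite_subset by blast
  let ?E = "measure_pmf.expectation (bprod E (\<lambda>_. p))"
  have "?E (\<lambda>x. (\<Sum>e\<in>M. of_bool (x e) - p)\<^sup>2)
      = ?E (\<lambda>x. \<Sum>e\<in>M. \<Sum>f\<in>M. (of_bool (x e) - p) * (of_bool (x f) - p))"
    by (simp add: power2_eq_square sum_product)
  also have "\<dots> = (\<Sum>e\<in>M. \<Sum>f\<in>M. ?E (\<lambda>x. (of_bool (x e) - p) * (of_bool (x f) - p)))"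
    using E by (simp add: Bochner_Integration.integral_sum)
  also have "\<dots> = (\<Sum>e\<in>M. \<Sum>f\<in>M. if e = f then p * (1 - p) else 0)"
    using M by (intro sum.cong refl expectation_centered_mult E p) auto
  also have "\<dots> = card M * p * (1 - p)"
    using fM by simp
  finally show ?thesis .
qed

text \<open>Tilting: under success probability \<open>q\<close> the sum concentrates near its mean, and
  the likelihood ratio there is the exponential of minus the relative entropy.\<close>
lemma prob_bprod_lower:
  fixes p q w :: real
  assumes E: "finite E" and M: "M \<subseteq> E" and p: "0 < p" "p \<le> q" "q < 1" and w: "0 < w"
    and var: "2 * (card M * q * (1 - q)) \<le> w\<^sup>2"
  shows "exp (- (card M * (q - p)\<^sup>2 / (2 * p * (1 - q)) + w * (q - p) / (p * (1 - q)))) / 2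
    \<le> measure_pmf.prob (bprod E (\<lambda>_. p)) {x. card M * q - w < (\<Sum>e\<in>M. of_bool (x e))}"
proof -
  have fM: "finite M" using E M finite_subset by blast
  define N where "N = real (card M)"
  let ?X = "\<lambda>x. \<Sum>e\<in>M. of_bool (x e) :: real"
  let ?B = "{x. \<bar>?X x - N * q\<bar> < w}"
  define c where "c = exp (- (N * (q - p)\<^sup>2 / (2 * p * (1 - q)) + w * (q - p) / (p * (1 - q))))"
  have X_alt: "?X x - N * q = (\<Sum>e\<in>M. of_bool (x e) - q)" for x
    by (simp add: sum_subtractf N_def)
  have "w\<^sup>2 * measure_pmf.prob (bprod M (\<lambda>_. q)) (- ?B)
      = measure_pmf.expectation (bprod M (\<lambda>_. q)) (\<lambda>x. w\<^sup>2 * of_bool (x \<in> - ?B))"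
    unfolding prob_eq_expectation by simp
  also have "\<dots> \<le> measure_pmf.expectation (bprod M (\<lambda>_. q)) (\<lambda>x. (\<Sum>e\<in>M. of_bool (x e) - q)\<^sup>2)"
  proof (intro integral_mono integrable_bprod fM)
    fix x show "w\<^sup>2 * of_bool (x \<in> - ?B) \<le> (\<Sum>e\<in>M. of_bool (x e) - q)\<^sup>2"
      unfolding X_alt[symmetric] using w by (auto simp: abs_le_square_iff[symmetric] not_less)
  qed
  also have "\<dots> = card M * q * (1 - q)"
    using p by (intro expectation_centered_square fM) auto
  also have "\<dots> \<le> w\<^sup>2 / 2" using var by simp
  finally have "measure_pmf.prob (bprod M (\<lambda>_. q)) (- ?B) \<le> 1 / 2"
    using w by (simp add: field_simps)
  \<comment> \<open>Chebyshev under the tilted law: \<open>var\<close> says that the window w is at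
    least sqrt 2 standard deviations wide.\<close>
  then have half: "1 / 2 \<le> measure_pmf.prob (bprod M (\<lambda>_. q)) ?B"
    using measure_pmf.prob_compl[of ?B "bprod M (\<lambda>_. q)"] by (simp add: Compl_eq_Diff_UNIV)
  have lr: "c \<le> lratio M (\<lambda>_. q) (\<lambda>_. p) x" if "x \<in> ?B" for x
  proof -
    \<comment> \<open>Log odds ratio. The log likelihood ratio is affine in the sum with slope -l,
      so on the window it falls below minus N times the relative entropy by at most w l.\<close>
    define l where "l = ln (q / p) - ln ((1 - q) / (1 - p))"
    have l: "l \<le> (q - p) / (p * (1 - q))" "0 \<le> l"
    proof -
      have "l = ln (q * (1 - p) / (p * (1 - q)))"
        using p by (simp add: l_def ln_div ln_mult)
      moreover have "ln (q * (1 - p) / (p * (1 - q))) \<le> q * (1 - p) / (p * (1 - q)) - 1"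
        using p by (intro ln_le_minus_one) auto
      moreover have "q * (1 - p) / (p * (1 - q)) - 1 = (q - p) / (p * (1 - q))"
        using p by (simp add: field_simps)
      moreover have "0 \<le> ln (q * (1 - p) / (p * (1 - q)))"
        using p by (intro ln_ge_zero) (simp add: field_simps)
      ultimately show "l \<le> (q - p) / (p * (1 - q))" "0 \<le> l" by auto
    qed
    have "lratio M (\<lambda>_. q) (\<lambda>_. p) x = (\<Prod>e\<in>M. exp (- (of_bool (x e) * ln (q / p) + (1 - of_bool (x e)) * ln ((1 - q) / (1 - p)))))"
      unfolding lratio_def
    proof (intro prod.cong refl)
      fix e
      have "exp (- ln (q / p)) = p / q" "exp (- ln ((1 - q) / (1 - p))) = (1 - p) / (1 - q)"
        using p by (simp_all add: exp_minus)
      then show "(if x e then p / q else (1 - p) / (1 - q)) =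
        exp (- (of_bool (x e) * ln (q / p) + (1 - of_bool (x e)) * ln ((1 - q) / (1 - p))))"
        by auto
    qed
    also have "\<dots> = exp (\<Sum>e\<in>M. - (of_bool (x e) * ln (q / p) + (1 - of_bool (x e)) * ln ((1 - q) / (1 - p))))"
      using fM by (simp add: exp_sum)
    also have "(\<Sum>e\<in>M. - (of_bool (x e) * ln (q / p) + (1 - of_bool (x e)) * ln ((1 - q) / (1 - p))))
        = - (?X x * ln (q / p) + (N - ?X x) * ln ((1 - q) / (1 - p)))"
      by (simp add: N_def sum_negf sum.distrib sum_distrib_right left_diff_distrib sum_subtractf)
    also have "\<dots> = - ((?X x - N * q) * l) - N * (q * ln (q / p) + (1 - q) * ln ((1 - q) / (1 - p)))"
      by (simp add: l_def algebra_simps)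
    finally have eq: "lratio M (\<lambda>_. q) (\<lambda>_. p) x = exp (- ((?X x - N * q) * l)
        - N * (q * ln (q / p) + (1 - q) * ln ((1 - q) / (1 - p))))" .
    have "N * (q * ln (q / p) + (1 - q) * ln ((1 - q) / (1 - p))) \<le> N * ((q - p)\<^sup>2 / (2 * p * (1 - q)))"
      using p by (intro mult_left_mono bernoulli_KL_le) (auto simp: N_def)
    moreover have "(?X x - N * q) * l \<le> w * ((q - p) / (p * (1 - q)))"
      using that l w by (intro mult_mono) auto
    ultimately show ?thesis unfolding eq c_def by simp
  qed
  have "c / 2 \<le> c * measure_pmf.prob (bprod M (\<lambda>_. q)) ?B"
    using half by (simp add: c_def)
  also have "\<dots> = measure_pmf.expectation (bprod M (\<lambda>_. q)) (\<lambda>x. c * of_bool (x \<in> ?B))"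
    unfolding prob_eq_expectation by simp
  also have "\<dots> \<le> measure_pmf.expectation (bprod M (\<lambda>_. q)) (\<lambda>x. lratio M (\<lambda>_. q) (\<lambda>_. p) x * of_bool (x \<in> ?B))"
    using lr by (intro integral_mono integrable_bprod fM) (auto simp: of_bool_def)
  also have "\<dots> = measure_pmf.expectation (bprod M (\<lambda>_. p)) (\<lambda>x. of_bool (x \<in> ?B))"
    using p by (intro expectation_change_measure[symmetric] fM) auto
  also have "\<dots> = measure_pmf.expectation (bprod E (\<lambda>_. p)) (\<lambda>x. of_bool (x \<in> ?B))"
  proof (intro expectation_bprod_restrict[symmetric] E M)
    show "depends_on (\<lambda>x. of_bool (x \<in> ?B) :: real) M"
      using depends_on_comp[OF depends_on_sum, where g = "\<lambda>X. of_bool (\<bar>X - N * q\<bar> < w) :: real"] by simp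
  qed
  also have "\<dots> = measure_pmf.prob (bprod E (\<lambda>_. p)) ?B"
    unfolding prob_eq_expectation by simp
  also have "\<dots> \<le> measure_pmf.prob (bprod E (\<lambda>_. p)) {x. card M * q - w < ?X x}"
    by (intro measure_pmf.finite_measure_mono) (auto simp: N_def)
  finally show ?thesis unfolding c_def N_def .
qed

section \<open>Moderate deviations\<close>

lemma filterlim_ln_real_nat: "filterlim (\<lambda>n. ln (real n)) at_top sequentially"
  by (rule filterlim_compose[OF ln_at_top filterlim_real_sequentially])

text \<open>Stated for the Chernoff expression instead of a probability and with c of either sign:
  positive c serves upper tails, negative c the lower-tail factor of the truncated second
  moment.\<close>

lemma chernoff_asymptotic:
  fixes lam p \<tau> :: "nat \<Rightarrow> real" and N :: "nat \<Rightarrow> nat" and c v \<epsilon> :: real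
  assumes lam: "\<forall>n\<ge>1. 1 \<le> lam n" and x: "(\<lambda>n. ln (real n) / lam n) \<longlonglongrightarrow> 0"
    and p: "\<forall>\<^sub>F n in sequentially. 0 \<le> p n \<and> p n \<le> 1" and v: "0 < v"
    and var: "(\<lambda>n. real (N n) * p n * (1 - p n) / lam n) \<longlonglongrightarrow> v"
    and mean: "(\<lambda>n. (\<tau> n - real (N n) * p n) / sqrt (lam n * ln (real n))) \<longlonglongrightarrow> c"
    and \<epsilon>: "0 < \<epsilon>"
  shows "\<forall>\<^sub>F n in sequentially.
    exp (- (c / v * sqrt (ln (real n) / lam n)) * \<tau> n)
      * (1 - p n + p n * exp (c / v * sqrt (ln (real n) / lam n))) ^ N n
    \<le> real n powr (- c\<^sup>2 / (2 * v) + \<epsilon>)"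
proof -
  define k where "k = c / v"
  define u where "u n = k * sqrt (ln (real n) / lam n)" for n
  \<comment> \<open>The exponent of the bound divided by ln n. Its limit - k c + v k^2 / 2 is
    minimal at k = c / v, which explains the slope of u; the last factor tends to 1 because
    \<lambda> outgrows log n.\<close>
  define G where "G n = - k * ((\<tau> n - real (N n) * p n) / sqrt (lam n * ln (real n)))
      + real (N n) * p n * (1 - p n) / lam n * k\<^sup>2 / 2 * exp \<bar>u n\<bar>" for n
  have "u \<longlonglongrightarrow> k * sqrt 0"
    unfolding u_def by (intro tendsto_intros x)
  then have "G \<longlonglongrightarrow> - k * c + v * k\<^sup>2 / 2 * exp \<bar>k * sqrt 0\<bar>"
    unfolding G_def by (intro tendsto_intros var mean) auto
  also have "- k * c + v * k\<^sup>2 / 2 * exp \<bar>k * sqrt 0\<bar> = - c\<^sup>2 / (2 * v)"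
    using v by (simp add: k_def power2_eq_square field_simps)
  finally have "G \<longlonglongrightarrow> - c\<^sup>2 / (2 * v)" .
  then have "\<forall>\<^sub>F n in sequentially. G n < - c\<^sup>2 / (2 * v) + \<epsilon>"
    by (rule order_tendstoD) (use \<epsilon> in simp)
  then show ?thesis
    using p eventually_ge_at_top[of 2]
  proof eventually_elim
    case (elim n)
    define a where "a = sqrt (lam n)"
    define b where "b = sqrt (ln (real n))"
    have l1: "1 \<le> lam n" using lam elim by auto
    have a: "a > 0" "lam n = a\<^sup>2" using l1 by (auto simp: a_def)
    have b: "b > 0" "ln (real n) = b\<^sup>2" using elim by (auto simp: b_def)
    have u: "u n = k * b / a" and ab: "sqrt (lam n * ln (real n)) = a * b"
      using a b by (auto simp: u_def real_sqrt_divide real_sqrt_mult)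
    have "exp (- u n * \<tau> n) * (1 - p n + p n * exp (u n)) ^ N n
        \<le> exp (- u n * \<tau> n) * exp (p n * u n + p n * (1 - p n) * (u n)\<^sup>2 / 2 * exp \<bar>u n\<bar>) ^ N n"
      using elim by (intro mult_left_mono power_mono bernoulli_mgf_le) auto
    also have "\<dots> = exp (- u n * \<tau> n + N n * (p n * u n + p n * (1 - p n) * (u n)\<^sup>2 / 2 * exp \<bar>u n\<bar>))"
      by (simp only: exp_add exp_of_nat_mult)
    also have "- u n * \<tau> n + N n * (p n * u n + p n * (1 - p n) * (u n)\<^sup>2 / 2 * exp \<bar>u n\<bar>) = G n * ln (real n)"
    proof -
      have "\<bar>u n\<bar> = \<bar>k * b / a\<bar>" by (simp add: u)
      then show ?thesis
        unfolding G_def ab unfolding a(2) b(2) unfolding u using a(1) b(1)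
        by (simp add: field_simps power2_eq_square)
    qed
    also have "\<dots> \<le> (- c\<^sup>2 / (2 * v) + \<epsilon>) * ln (real n)"
      using elim by (intro mult_right_mono) auto
    finally show ?case
      using elim by (simp add: u_def k_def powr_def)
  qed
qed

text \<open>The window costs a bounded number of standard deviations, of order sqrt \<lambda>, which
  vanishes on the scale sqrt (\<lambda> log n). The sets E and M are quantified inside the
  eventuality so that one n serves all support vertices at once.\<close>

lemma prob_bprod_lower_asymptotic:
  fixes lam p \<tau> :: "nat \<Rightarrow> real" and N :: "nat \<Rightarrow> nat" and c v \<epsilon> :: real
  assumes lam: "\<forall>n\<ge>1. 1 \<le> lam n" and x: "(\<lambda>n. ln (real n) / lam n) \<longlonglongrightarrow> 0"
    and p: "\<forall>\<^sub>F n in sequentially. 0 < p n \<and> p n < 1" and v: "0 < v"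
    and var: "(\<lambda>n. real (N n) * p n * (1 - p n) / lam n) \<longlonglongrightarrow> v"
    and mean: "(\<lambda>n. (\<tau> n - real (N n) * p n) / sqrt (lam n * ln (real n))) \<longlonglongrightarrow> c"
    and c: "0 < c" and \<epsilon>: "0 < \<epsilon>"
  shows "\<forall>\<^sub>F n in sequentially. \<forall>(E :: 'e set) M. finite E \<longrightarrow> M \<subseteq> E \<longrightarrow> card M = N n \<longrightarrow>
    real n powr (- c\<^sup>2 / (2 * v) - \<epsilon>)
      \<le> measure_pmf.prob (bprod E (\<lambda>_. p n)) {x. \<tau> n < (\<Sum>e\<in>M. of_bool (x e))}"
proof -
  \<comment> \<open>Gives w^2 = 4 v \<lambda>, twice the eventual bound 2 v \<lambda> on the
    variance under the tilted law.\<close>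
  define K where "K = 2 * sqrt v"
  have K: "K > 0" "K\<^sup>2 = 4 * v" using v by (auto simp: K_def power_mult_distrib)
  define w where "w n = K * sqrt (lam n)" for n
  define \<Delta> where "\<Delta> n = \<tau> n - real (N n) * p n + w n" for n
  \<comment> \<open>This is N p (1 - q) for the success probability q = p + \<Delta> / N, written so
    as not to divide by N.\<close>
  define W where "W n = real (N n) * p n * (1 - p n) - p n * \<Delta> n" for n
  define A where "A n = \<Delta> n / sqrt (lam n * ln (real n))" for n
  have inv_ln: "(\<lambda>n. 1 / sqrt (ln (real n))) \<longlonglongrightarrow> 0"
    by (intro tendsto_divide_0[OF tendsto_const] filterlim_at_top_imp_at_infinity
        filterlim_compose[OF sqrt_at_top filterlim_ln_real_nat])
  have A_eq: "\<forall>\<^sub>F n in sequentially. A n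
      = (\<tau> n - real (N n) * p n) / sqrt (lam n * ln (real n)) + K * (1 / sqrt (ln (real n)))"
    using eventually_ge_at_top[of 2]
  proof eventually_elim
    case (elim n)
    then have "sqrt (lam n) > 0" using lam by (auto simp: less_le_trans[OF zero_less_one])
    then show ?case
      by (simp add: A_def \<Delta>_def w_def add_divide_distrib real_sqrt_mult)
  qed
  have "(\<lambda>n. (\<tau> n - real (N n) * p n) / sqrt (lam n * ln (real n)) + K * (1 / sqrt (ln (real n)))) \<longlonglongrightarrow> c + K * 0"
    by (intro tendsto_intros mean inv_ln)
  with A_eq have A: "A \<longlonglongrightarrow> c" by (simp add: tendsto_cong)
  have pD: "(\<lambda>n. A n * sqrt (ln (real n) / lam n)) \<longlonglongrightarrow> c * sqrt 0"
    by (intro tendsto_intros A x)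
  have D_eq: "\<forall>\<^sub>F n in sequentially. A n * sqrt (ln (real n) / lam n) = \<Delta> n / lam n"
    using eventually_ge_at_top[of 2]
  proof eventually_elim
    case (elim n)
    have l1: "1 \<le> lam n" using lam elim by auto
    define a where "a = sqrt (lam n)"
    define b where "b = sqrt (ln (real n))"
    have ab: "a > 0" "lam n = a\<^sup>2" "b > 0" "ln (real n) = b\<^sup>2" using l1 elim by (auto simp: a_def b_def)
    then show ?case
      by (simp add: A_def ab(2,4) real_sqrt_divide real_sqrt_mult power2_eq_square)
  qed
  have D0: "(\<lambda>n. \<Delta> n / lam n) \<longlonglongrightarrow> 0"
    using pD tendsto_cong[OF D_eq] by simp
  have pD0: "(\<lambda>n. p n * (\<Delta> n / lam n)) \<longlonglongrightarrow> 0"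
  proof (rule Lim_null_comparison)
    show "\<forall>\<^sub>F n in sequentially. norm (p n * (\<Delta> n / lam n)) \<le> \<bar>\<Delta> n / lam n\<bar>"
      using p by eventually_elim (simp only: real_norm_def abs_mult, rule mult_left_le_one_le, auto)
    show "(\<lambda>n. \<bar>\<Delta> n / lam n\<bar>) \<longlonglongrightarrow> 0"
      using D0 tendsto_rabs_zero by blast
  qed
  have "(\<lambda>n. real (N n) * p n * (1 - p n) / lam n - p n * (\<Delta> n / lam n)) \<longlonglongrightarrow> v - 0"
    by (intro tendsto_intros var pD0)
  then have B: "(\<lambda>n. W n / lam n) \<longlonglongrightarrow> v"
    by (simp add: W_def diff_divide_distrib)
  have "(\<lambda>n. (A n)\<^sup>2 / (2 * (W n / lam n)) + K * A n / (W n / lam n) * (1 / sqrt (ln (real n)))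
      + ln 2 * (1 / sqrt (ln (real n)))\<^sup>2) \<longlonglongrightarrow> c\<^sup>2 / (2 * v) + K * c / v * 0 + ln 2 * 0\<^sup>2"
    using v by (intro tendsto_intros A B inv_ln) auto
  then have "\<forall>\<^sub>F n in sequentially. (A n)\<^sup>2 / (2 * (W n / lam n)) + K * A n / (W n / lam n) * (1 / sqrt (ln (real n)))
      + ln 2 * (1 / sqrt (ln (real n)))\<^sup>2 < c\<^sup>2 / (2 * v) + \<epsilon>"
    by (rule order_tendstoD) (use \<epsilon> in simp)
  moreover have "\<forall>\<^sub>F n in sequentially. 0 < A n"
    using A c by (rule order_tendstoD)
  moreover have "\<forall>\<^sub>F n in sequentially. 0 < W n / lam n"
    using B v by (rule order_tendstoD)
  moreover have "\<forall>\<^sub>F n in sequentially. W n / lam n + \<Delta> n / lam n < 2 * v"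
    using tendsto_add[OF B D0] by (rule order_tendstoD) (use v in simp)
  ultimately show ?thesis
    using p eventually_ge_at_top[of 2]
  proof eventually_elim
    case (elim n)
    have l1: "1 \<le> lam n" using lam elim by auto
    define a where "a = sqrt (lam n)"
    define b where "b = sqrt (ln (real n))"
    have ab: "a > 0" "lam n = a\<^sup>2" "b > 0" "ln (real n) = b\<^sup>2"
      using l1 elim by (auto simp: a_def b_def)
    have sab: "sqrt (lam n * ln (real n)) = a * b" by (simp add: a_def b_def real_sqrt_mult)
    have \<Delta>: "\<Delta> n = A n * (a * b)"
      using ab unfolding A_def sab by simp
    have \<Delta>_pos: "\<Delta> n > 0" using elim ab by (simp add: \<Delta>)
    have W: "W n > 0" using elim l1 by (simp add: zero_less_divide_iff)
    have N: "N n > 0"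
    proof (rule ccontr)
      assume "\<not> N n > 0"
      then have "W n = - (p n * \<Delta> n)" by (simp add: W_def)
      then show False using W \<Delta>_pos elim by (simp add: mult_less_0_iff)
    qed
    \<comment> \<open>Chosen so that N q - w = \<tau>: the window below the tilted mean just reaches
      the threshold.\<close>
    define q where "q = p n + \<Delta> n / N n"
    have W_q: "W n = real (N n) * p n * (1 - q)"
      using N by (simp add: W_def q_def field_simps)
    have q: "p n \<le> q" "q < 1"
    proof -
      show "p n \<le> q" using \<Delta>_pos N by (simp add: q_def)
      have "0 < real (N n) * p n" using elim N by simp
      then show "q < 1" using W zero_less_mult_pos[of "real (N n) * p n" "1 - q"] unfolding W_q by simp
    qed
    have qp: "q - p n = \<Delta> n / N n" by (simp add: q_def)
    have w: "w n > 0" "(w n)\<^sup>2 = 4 * v * lam n" using K ab(1) l1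
      by (auto simp: w_def a_def[symmetric] power_mult_distrib) (simp add: a_def)
    have var': "2 * (real (N n) * q * (1 - q)) \<le> (w n)\<^sup>2"
    proof -
      have "real (N n) * q * (1 - q) = W n + \<Delta> n * (1 - q)"
        using N unfolding W_q by (simp add: q_def field_simps)
      also have "\<dots> \<le> W n + \<Delta> n"
        using \<Delta>_pos q elim by (simp add: mult_left_le)
      also have "\<dots> \<le> 2 * v * lam n"
        using elim l1 by (simp add: field_simps)
      finally show ?thesis using w(2) by linarith
    qed
    define Q where "Q = real (N n) * (q - p n)\<^sup>2 / (2 * p n * (1 - q)) + w n * (q - p n) / (p n * (1 - q))"
    have Q: "Q = (\<Delta> n)\<^sup>2 / (2 * W n) + w n * \<Delta> n / W n"
    proof -
      have "p n > 0" "1 - q > 0" using elim q by auto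
      then show ?thesis
        using N unfolding Q_def qp W_q by (simp add: field_simps power2_eq_square)
    qed
    have "Q + ln 2 = ((A n)\<^sup>2 / (2 * (W n / lam n)) + K * A n / (W n / lam n) * (1 / sqrt (ln (real n)))
      + ln 2 * (1 / sqrt (ln (real n)))\<^sup>2) * ln (real n)"
      unfolding Q \<Delta> w_def b_def[symmetric] a_def[symmetric] unfolding ab(2,4) using ab(1,3) W
      by (simp add: field_simps power2_eq_square)
    also have "\<dots> \<le> (c\<^sup>2 / (2 * v) + \<epsilon>) * ln (real n)"
      using elim by (intro mult_right_mono) auto
    finally have Qb: "Q + ln 2 \<le> (c\<^sup>2 / (2 * v) + \<epsilon>) * ln (real n)" .
    have "real n powr (- c\<^sup>2 / (2 * v) - \<epsilon>) = exp (- ((c\<^sup>2 / (2 * v) + \<epsilon>) * ln (real n)))"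
      using elim by (simp add: powr_def algebra_simps)
    also have "\<dots> \<le> exp (- (Q + ln 2))" using Qb by simp
    also have "\<dots> = exp (- Q) / 2" by (simp add: exp_diff)
    finally have fin: "real n powr (- c\<^sup>2 / (2 * v) - \<epsilon>) \<le> exp (- Q) / 2" .
    have mean_q: "real (N n) * q - w n = \<tau> n"
      using N by (simp add: q_def \<Delta>_def field_simps)
    show ?case
    proof (intro allI impI)
      fix E M :: "'e set" assume *: "finite E" "M \<subseteq> E" "card M = N n"
      have "exp (- Q) / 2 \<le> measure_pmf.prob (bprod E (\<lambda>_. p n)) {x. \<tau> n < (\<Sum>e\<in>M. of_bool (x e))}"
        using prob_bprod_lower[OF *(1,2), of "p n" q "w n"] elim q w var' *(3)
        by (simp add: Q_def mean_q)
      with fin show "real n powr (- c\<^sup>2 / (2 * v) - \<epsilon>)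
        \<le> measure_pmf.prob (bprod E (\<lambda>_. p n)) {x. \<tau> n < (\<Sum>e\<in>M. of_bool (x e))}"
        by linarith
    qed
  qed
qed

section \<open>The second moment of the truncated likelihood ratio\<close>

definition edges :: "nat \<Rightarrow> (nat \<times> nat) set" where
  "edges n = {(i, j). 1 \<le> i \<and> i < j \<and> j \<le> n}"

definition edge :: "nat \<Rightarrow> nat \<Rightarrow> nat \<times> nat" where
  "edge i j = (min i j, max i j)"

definition adj :: "(nat \<times> nat \<Rightarrow> bool) \<Rightarrow> nat \<Rightarrow> nat \<Rightarrow> nat" where
  "adj x i j = (if i < j then of_bool (x (i, j)) else if j < i then of_bool (x (j, i)) else 0)"

definition eprob :: "nat \<Rightarrow> real \<Rightarrow> (nat \<Rightarrow> real) \<Rightarrow> nat \<times> nat \<Rightarrow> real" where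
  "eprob n lam \<beta> e = edge_prob n lam \<beta> (fst e) (snd e)"

lemma finite_edges [simp]: "finite (edges n)"
  by (rule finite_subset[of _ "{1..n} \<times> {1..n}"]) (auto simp: edges_def)

lemma beta_law_eq: "beta_law n lam \<beta> = map_pmf adj (bprod (edges n) (eprob n lam \<beta>))"
  unfolding beta_law_def bprod_def edges_def eprob_def adj_def case_prod_beta ..

lemma prob_beta_law:
  "measure_pmf.prob (beta_law n lam \<beta>) {Y. Q Y} = measure_pmf.prob (bprod (edges n) (eprob n lam \<beta>)) {x. Q (adj x)}"
  by (simp add: beta_law_eq vimage_def)

lemma edge_in_edges: "i \<in> {1..n} \<Longrightarrow> j \<in> {1..n} \<Longrightarrow> i \<noteq> j \<Longrightarrow> edge i j \<in> edges n"
  by (auto simp: edge_def edges_def min_def max_def)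

lemma inj_on_edge: "i \<notin> J \<Longrightarrow> inj_on (edge i) J"
  by (auto simp: inj_on_def edge_def min_def max_def split: if_splits)

lemma inj_on_edge_times: "I \<inter> J = {} \<Longrightarrow> inj_on (case_prod edge) (I \<times> J)"
  by (force simp: inj_on_def edge_def min_def max_def split: if_splits)

lemma deg_adj: "real (deg n (adj x) i) = (\<Sum>e\<in>edge i ` ({1..n} - {i}). of_bool (x e))"
proof -
  have "real (deg n (adj x) i) = (\<Sum>j\<in>{1..n} - {i}. of_bool (x (edge i j)))"
    unfolding deg_def of_nat_sum by (intro sum.cong) (auto simp: adj_def edge_def min_def max_def)
  also have "\<dots> = (\<Sum>e\<in>edge i ` ({1..n} - {i}). of_bool (x e))"
    by (subst sum.reindex) (auto simp: inj_on_edge)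
  finally show ?thesis .
qed

text \<open>The logistic function is (1 + tanh (x / 2)) / 2, so tanh is the relative change of an
  edge probability from its null value. This is why signal strength is measured by tanh.\<close>

lemma eprob_eq_tanh: "eprob n lam \<beta> (i, j) = lam / (2 * real n) * (1 + tanh ((\<beta> i + \<beta> j) / 2))"
proof -
  define t where "t = exp ((\<beta> i + \<beta> j) / 2)"
  have t: "t > 0" by (simp add: t_def)
  have sq: "exp (\<beta> i + \<beta> j) = t * t" by (simp add: t_def flip: exp_add)
  have "1 + tanh ((\<beta> i + \<beta> j) / 2) = 2 * (t * t / (1 + t * t))"
  proof -
    have "tanh ((\<beta> i + \<beta> j) / 2) = (t - inverse t) / (t + inverse t)"
      by (simp add: tanh_altdef t_def exp_minus)
    also have "\<dots> = (t * t - 1) / (t * t + 1)"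
      using t by (simp add: divide_simps)
    finally have 1: "tanh ((\<beta> i + \<beta> j) / 2) = (t * t - 1) / (t * t + 1)" .
    have "t * t + 1 > 0" using t by (simp add: add_pos_pos)
    then show ?thesis unfolding 1 by (simp add: field_simps)
  qed
  then show ?thesis by (simp add: eprob_def edge_prob_def sq)
qed

text \<open>Lets an edge inside the support be charged as two signal endpoints, each contributing
  tanh (A / 2).\<close>

lemma tanh_double_le:
  fixes x :: real assumes "0 \<le> x" shows "tanh (2 * x) \<le> 2 * tanh x"
proof -
  have "tanh (2 * x) = 2 * tanh x / (1 + (tanh x)\<^sup>2)"
    using tanh_add[of x x] cosh_real_nonzero[of x] by (simp add: power2_eq_square)
  also have "\<dots> \<le> 2 * tanh x / 1"
    using assms by (intro divide_left_mono) (auto intro!: add_pos_nonneg)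
  finally show ?thesis by simp
qed

lemma sum_edges_le:
  fixes g :: "nat \<Rightarrow> nat \<Rightarrow> real"
  assumes g: "\<And>i j. 0 \<le> g i j" and sym: "\<And>i j. g i j = g j i"
  shows "2 * (\<Sum>e\<in>edges n. g (fst e) (snd e)) \<le> (\<Sum>i\<in>{1..n}. \<Sum>j\<in>{1..n}. g i j)"
proof -
  have "(\<Sum>e\<in>edges n. g (fst e) (snd e)) = (\<Sum>e\<in>prod.swap ` edges n. g (fst e) (snd e))"
    by (subst sum.reindex) (auto simp: sym)
  then have "2 * (\<Sum>e\<in>edges n. g (fst e) (snd e))
      = (\<Sum>e\<in>edges n. g (fst e) (snd e)) + (\<Sum>e\<in>prod.swap ` edges n. g (fst e) (snd e))"
    by simp
  also have "\<dots> = (\<Sum>e\<in>edges n \<union> prod.swap ` edges n. g (fst e) (snd e))"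
    by (intro sum.union_disjoint[symmetric] finite_imageI finite_edges) (auto simp: edges_def)
  also have "\<dots> \<le> (\<Sum>e\<in>{1..n} \<times> {1..n}. g (fst e) (snd e))"
    using g by (intro sum_mono2) (auto simp: edges_def)
  also have "\<dots> = (\<Sum>i\<in>{1..n}. \<Sum>j\<in>{1..n}. g i j)"
    by (simp add: sum.cartesian_product case_prod_beta)
  finally show ?thesis .
qed

text \<open>The prior lives on these vectors; the restriction to {1..n} is there because
  \<open>Xi\<close> consists of extensional functions.\<close>

definition flat :: "nat \<Rightarrow> nat set \<Rightarrow> real \<Rightarrow> nat \<Rightarrow> real" where
  "flat n S A = (\<lambda>i\<in>{1..n}. if i \<in> S then A else 0)"

lemma supp_flat: "S \<subseteq> {1..n} \<Longrightarrow> A > 0 \<Longrightarrow> supp n (flat n S A) = S"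
  by (auto simp: supp_def flat_def split: if_splits)

lemma flat_in_Xi:
  assumes "S \<subseteq> {1..n}" "card S = s" "0 < A" "A' \<le> A"
  shows "flat n S A \<in> Xi n s A'"
  using assms supp_flat[OF assms(1,3)] by (auto simp: Xi_def flat_def)

text \<open>The two-point second moment: on a pair \<^term>\<open>(i, j)\<close> with \<^term>\<open>i \<in> S \<inter> S'\<close> and
  \<^term>\<open>j \<notin> S \<union> S'\<close> the product of the likelihood ratios is a tilted Bernoulli law with success probability
  \<open>p2\<close>, so the truncation contributes a lower-tail Chernoff factor for each vertex of \<^term>\<open>S \<inter> S'\<close>.\<close>
lemma truncated_second_moment:
  fixes A lam \<tau> u :: real and n s :: nat and S S' :: "nat set"
  defines "p0 \<equiv> lam / (2 * real n)"
  defines "a \<equiv> tanh (A / 2)"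
  defines "\<kappa> \<equiv> p0 * a\<^sup>2 / (1 - p0)"
  defines "p2 \<equiv> p0 * (1 + a)\<^sup>2 / (1 + \<kappa>)"
  defines "\<Gamma> \<equiv> \<lambda>S. {x. \<forall>i\<in>S. (\<Sum>e\<in>edge i ` ({1..n} - S). of_bool (x e)) \<le> \<tau>}"
  assumes lam: "0 < lam" "lam \<le> n" and A: "0 \<le> A" and u: "0 \<le> u"
    and S: "S \<subseteq> {1..n}" "card S = s" and S': "S' \<subseteq> {1..n}" "card S' = s" 
  shows "measure_pmf.expectation (bprod (edges n) (\<lambda>_. p0))
     (\<lambda>x. (lratio (edges n) (\<lambda>_. p0) (eprob n lam (flat n S A)) x * of_bool (x \<in> \<Gamma> S))
        * (lratio (edges n) (\<lambda>_. p0) (eprob n lam (flat n S' A)) x * of_bool (x \<in> \<Gamma> S')))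
    \<le> exp (\<kappa> * (real s)\<^sup>2)
      * (exp (\<kappa> * n) * (exp (u * \<tau>) * (1 - p2 + p2 * exp (- u)) ^ (n - 2 * s))) ^ card (S \<inter> S')"
proof -
  let ?E = "edges n"
  define K where "K = S \<inter> S'"
  define J where "J = {1..n} - (S \<union> S')"
  \<comment> \<open>Edges with one endpoint in both supports and the other in neither. There the two
    likelihood ratios are tilted in the same way, and K and J being disjoint makes
    \<open>edge\<close> injective on the pairs.\<close>
  define M where "M = case_prod edge ` (K \<times> J)"
  have fin: "finite S" "finite S'" using S S' finite_subset by blast+
  have n: "n > 0" using lam by (cases n) auto
  have p0: "0 < p0" "p0 \<le> 1 / 2" "p0 < 1" using lam n by (auto simp: p0_def field_simps)
  have a: "0 \<le> a" "a < 1" using A tanh_real_lt_1[of "A / 2"] by (auto simp: a_def)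
  have \<kappa>: "0 \<le> \<kappa>" using p0 by (auto simp: \<kappa>_def)
  have KJ: "K \<inter> J = {}" "finite K" "finite J" "K \<subseteq> {1..n}" "J \<subseteq> {1..n}"
    using S S' fin by (auto simp: K_def J_def)
  have M: "M \<subseteq> ?E"
  proof
    fix e assume "e \<in> M"
    then obtain i j where "e = edge i j" "i \<in> K" "j \<in> J" by (auto simp: M_def)
    then show "e \<in> ?E" using KJ edge_in_edges[of i n j] by blast
  qed
  have fM: "finite M" using KJ by (simp add: M_def)
  define ct where "ct S e = tanh ((flat n S A (fst e) + flat n S A (snd e)) / 2)" for S e
  have q: "eprob n lam (flat n S A) e = p0 * (1 + ct S e)" for S e
    using eprob_eq_tanh[of n lam "flat n S A" "fst e" "snd e"] by (simp add: p0_def ct_def)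
  have ct: "0 \<le> ct S e \<and> ct S e \<le> a * (of_bool (fst e \<in> S) + of_bool (snd e \<in> S))" if "e \<in> ?E" for S e
    using that A tanh_double_le[of "A / 2"] by (auto simp: edges_def ct_def flat_def a_def)
  have ctM: "ct S e = a" "ct S' e = a" if "e \<in> M" for e
  proof -
    obtain i j where ij: "e = edge i j" "i \<in> K" "j \<in> J" using \<open>e \<in> M\<close> by (auto simp: M_def)
    have "i \<in> {1..n}" "j \<in> {1..n}" "i \<in> S" "i \<in> S'" "j \<notin> S" "j \<notin> S'"
      using ij KJ(4,5) by (auto simp: K_def J_def)
    moreover have "fst e = i \<and> snd e = j \<or> fst e = j \<and> snd e = i"
      unfolding ij(1) edge_def by (auto simp: min_def max_def)
    ultimately show "ct S e = a" "ct S' e = a"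
      by (auto simp: ct_def flat_def a_def)
  qed
  define w where "w e = (if e \<in> M then exp (- u) else 1)" for e
  \<comment> \<open>Laplace transform at u of a Bernoulli variable with success probability p2: what
    the truncation gains per edge of M.\<close>
  define \<rho> where "\<rho> = 1 - p2 + p2 * exp (- u)"
  have p2: "0 \<le> p2" "p2 \<le> 1"
  proof -
    show "0 \<le> p2" using p0 \<kappa> by (auto simp: p2_def)
    \<comment> \<open>The product of two ratios has total mass 1 + \<kappa>, of which p0 (1 + a)^2
      belongs to a present edge; the square on the right is the mass of an absent one.\<close>
    have "1 + \<kappa> - p0 * (1 + a)\<^sup>2 = (1 - p0 - p0 * a)\<^sup>2 / (1 - p0)"
      using p0 by (simp add: \<kappa>_def field_simps power2_eq_square)
    also have "\<dots> \<ge> 0" using p0 by auto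
    finally show "p2 \<le> 1" using \<kappa> by (simp add: p2_def)
  qed
  have \<rho>: "0 \<le> \<rho>" "\<rho> \<le> 1"
  proof -
    have "p2 * exp (- u) \<ge> 0" "p2 * exp (- u) \<le> p2"
      using p2 u by (auto intro: mult_left_le)
    then show "0 \<le> \<rho>" "\<rho> \<le> 1" using p2 by (auto simp: \<rho>_def)
  qed
  define lr where "lr S e b = (if b then p0 * (1 + ct S e) / p0 else (1 - p0 * (1 + ct S e)) / (1 - p0))" for S e b
  have lr_nonneg: "0 \<le> lr S e b" if "e \<in> ?E" for S e b
  proof -
    have "ct S e < 1" unfolding ct_def by (rule tanh_real_lt_1)
    then have "p0 * (1 + ct S e) \<le> 1 / 2 * 2"
      using p0 ct[OF that, of S] by (intro mult_mono) auto
    then show ?thesis using p0 ct[OF that, of S] by (auto simp: lr_def)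
  qed
  have lratio: "lratio ?E (\<lambda>_. p0) (eprob n lam (flat n S A)) x = (\<Prod>e\<in>?E. lr S e (x e))" for S x
    unfolding lratio_def q lr_def by simp
  \<comment> \<open>Exponential Markov bound: under truncation each vertex of K has at most \<tau>
    edges into J, so the sum over M is at most card K times \<tau>.\<close>
  have trunc: "of_bool (x \<in> \<Gamma> S) * of_bool (x \<in> \<Gamma> S')
      \<le> exp (u * \<tau>) ^ card K * (\<Prod>e\<in>?E. if x e then w e else 1)" for x
  proof -
    have "(\<Prod>e\<in>?E. if x e then w e else 1) = (\<Prod>e\<in>M. if x e then exp (- u) else 1)"
      using M by (intro prod.mono_neutral_cong_right) (auto simp: w_def)
    also have "\<dots> = (\<Prod>e\<in>M. exp (- u * of_bool (x e)))"
      by (intro prod.cong) auto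
    also have "\<dots> = exp (- u * (\<Sum>e\<in>M. of_bool (x e)))"
      by (simp only: exp_sum[OF fM, symmetric] sum_distrib_left[symmetric])
    finally have pe: "exp (u * \<tau>) ^ card K * (\<Prod>e\<in>?E. if x e then w e else 1)
        = exp (u * (card K * \<tau> - (\<Sum>e\<in>M. of_bool (x e))))"
      by (simp add: algebra_simps flip: exp_of_nat_mult exp_add)
    show ?thesis
    proof (cases "x \<in> \<Gamma> S \<and> x \<in> \<Gamma> S'")
      case True
      have "(\<Sum>e\<in>M. of_bool (x e) :: real) = (\<Sum>i\<in>K. \<Sum>j\<in>J. of_bool (x (edge i j)))"
        unfolding M_def by (subst sum.reindex[OF inj_on_edge_times[OF KJ(1)]])
          (auto simp: sum.cartesian_product case_prod_beta)
      also have "\<dots> \<le> (\<Sum>i\<in>K. \<tau>)"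
      proof (intro sum_mono)
        fix i assume i: "i \<in> K"
        then have iS: "i \<in> S" by (simp add: K_def)
        have "(\<Sum>j\<in>J. of_bool (x (edge i j)) :: real) \<le> (\<Sum>j\<in>{1..n} - S. of_bool (x (edge i j)))"
          by (intro sum_mono2) (auto simp: J_def)
        also have "\<dots> = (\<Sum>e\<in>edge i ` ({1..n} - S). of_bool (x e))"
          using iS by (subst sum.reindex) (auto simp: inj_on_edge)
        also have "\<dots> \<le> \<tau>" using True iS by (auto simp: \<Gamma>_def)
        finally show "(\<Sum>j\<in>J. of_bool (x (edge i j)) :: real) \<le> \<tau>" .
      qed
      finally show ?thesis unfolding pe using u True by simp
    next
      case False
      then show ?thesis unfolding pe by auto
    qed
  qed
  have "measure_pmf.expectation (bprod ?E (\<lambda>_. p0))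
     (\<lambda>x. (lratio ?E (\<lambda>_. p0) (eprob n lam (flat n S A)) x * of_bool (x \<in> \<Gamma> S))
        * (lratio ?E (\<lambda>_. p0) (eprob n lam (flat n S' A)) x * of_bool (x \<in> \<Gamma> S')))
     \<le> measure_pmf.expectation (bprod ?E (\<lambda>_. p0)) (\<lambda>x. exp (u * \<tau>) ^ card K *
        (\<Prod>e\<in>?E. lr S e (x e) * lr S' e (x e) * (if x e then w e else 1)))"
  proof (intro integral_mono integrable_bprod finite_edges)
    fix x
    have nn: "0 \<le> (\<Prod>e\<in>?E. lr S e (x e)) * (\<Prod>e\<in>?E. lr S' e (x e))"
      using lr_nonneg by (intro mult_nonneg_nonneg prod_nonneg) auto
    show "(lratio ?E (\<lambda>_. p0) (eprob n lam (flat n S A)) x * of_bool (x \<in> \<Gamma> S))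
        * (lratio ?E (\<lambda>_. p0) (eprob n lam (flat n S' A)) x * of_bool (x \<in> \<Gamma> S'))
      \<le> exp (u * \<tau>) ^ card K * (\<Prod>e\<in>?E. lr S e (x e) * lr S' e (x e) * (if x e then w e else 1))"
      using mult_left_mono[OF trunc[of x] nn]
      unfolding lratio prod.distrib by (simp only: ac_simps)
  qed
  also have "\<dots> = exp (u * \<tau>) ^ card K * measure_pmf.expectation (bprod ?E (\<lambda>_. p0)) (\<lambda>x.
        \<Prod>e\<in>?E. (\<lambda>e b. lr S e b * lr S' e b * (if b then w e else 1)) e (x e))"
    by simp
  also have "measure_pmf.expectation (bprod ?E (\<lambda>_. p0)) (\<lambda>x.
        \<Prod>e\<in>?E. (\<lambda>e b. lr S e b * lr S' e b * (if b then w e else 1)) e (x e))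
      = (\<Prod>e\<in>?E. p0 * (lr S e True * lr S' e True * w e) + (1 - p0) * (lr S e False * lr S' e False))"
    by (subst expectation_bprod_prod) (use p0 in auto)
  \<comment> \<open>Off M the factor of an edge is 1 + p0 c c' / (1 - p0), bounded by 1 + x \<le>
    exp x; on M the weight exp (-u) turns 1 + \<kappa> into (1 + \<kappa>) \<rho>.\<close>
  also have "\<dots> \<le> (\<Prod>e\<in>?E. exp (p0 / (1 - p0) * (ct S e * ct S' e)) * (if e \<in> M then \<rho> else 1))"
  proof (intro prod_mono conjI)
    fix e assume e: "e \<in> ?E"
    show "0 \<le> p0 * (lr S e True * lr S' e True * w e) + (1 - p0) * (lr S e False * lr S' e False)"
      using lr_nonneg[OF e] p0 by (auto simp: w_def)
    define c where "c = ct S e" define c' where "c' = ct S' e"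
    have eq: "p0 * (lr S e True * lr S' e True * w e) + (1 - p0) * (lr S e False * lr S' e False)
      = p0 * ((1 + c) * (1 + c') * w e) + (1 - p0 * (1 + c)) * (1 - p0 * (1 + c')) / (1 - p0)"
      using p0 by (simp add: lr_def c_def[symmetric] c'_def[symmetric])
    show "p0 * (lr S e True * lr S' e True * w e) + (1 - p0) * (lr S e False * lr S' e False)
        \<le> exp (p0 / (1 - p0) * (ct S e * ct S' e)) * (if e \<in> M then \<rho> else 1)"
    proof (cases "e \<in> M")
      case False
      have "p0 * ((1 + c) * (1 + c')) + (1 - p0 * (1 + c)) * (1 - p0 * (1 + c')) / (1 - p0)
        = 1 + p0 / (1 - p0) * (c * c')"
        using p0 by (simp add: field_simps)
      also have "\<dots> \<le> exp (p0 / (1 - p0) * (c * c'))" by (rule exp_ge_add_one_self)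
      finally show ?thesis unfolding eq using False by (simp add: w_def c_def c'_def)
    next
      case True
      have c: "c = a" "c' = a" using ctM[OF True] by (auto simp: c_def c'_def)
      have 1: "p0 * ((1 + a) * (1 + a)) + (1 - p0 * (1 + a)) * (1 - p0 * (1 + a)) / (1 - p0) = 1 + \<kappa>"
        using p0 by (simp add: \<kappa>_def field_simps power2_eq_square)
      have 2: "p0 * ((1 + a) * (1 + a)) = (1 + \<kappa>) * p2"
        using \<kappa> by (simp add: p2_def power2_eq_square)
      have "p0 * ((1 + a) * (1 + a) * exp (- u)) + (1 - p0 * (1 + a)) * (1 - p0 * (1 + a)) / (1 - p0)
        = (1 + \<kappa>) * \<rho>"
      proof -
        have "p0 * ((1 + a) * (1 + a) * exp (- u)) = (1 + \<kappa>) * p2 * exp (- u)"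
          using 2 by (metis mult.assoc)
        moreover have "(1 - p0 * (1 + a)) * (1 - p0 * (1 + a)) / (1 - p0) = 1 + \<kappa> - (1 + \<kappa>) * p2"
          using 1 unfolding 2 by simp
        ultimately show ?thesis by (simp only:) (simp add: \<rho>_def algebra_simps)
      qed
      also have "\<dots> \<le> exp \<kappa> * \<rho>"
        using \<rho> by (intro mult_right_mono) auto
      finally show ?thesis unfolding eq using True ctM[OF True]
        by (simp add: w_def c \<kappa>_def power2_eq_square)
    qed
  qed
  also have "\<dots> = exp (p0 / (1 - p0) * (\<Sum>e\<in>?E. ct S e * ct S' e)) * \<rho> ^ card M"
  proof -
    have "(\<Prod>e\<in>?E. if e \<in> M then \<rho> else 1) = (\<Prod>e\<in>M. \<rho>)"
      using M by (intro prod.mono_neutral_cong_right) auto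
    then show ?thesis by (simp add: prod.distrib exp_sum[symmetric] sum_distrib_left)
  qed
  also have "\<dots> \<le> exp (\<kappa> * (n * card K + (real s)\<^sup>2)) * \<rho> ^ (card K * (n - 2 * s))"
  proof (intro mult_mono)
    have "(\<Sum>e\<in>?E. ct S e * ct S' e) \<le> (\<Sum>e\<in>?E. a\<^sup>2 * ((of_bool (fst e \<in> S) + of_bool (snd e \<in> S)) * (of_bool (fst e \<in> S') + of_bool (snd e \<in> S'))))"
    proof (intro sum_mono)
      fix e assume e: "e \<in> ?E"
      have "ct S e * ct S' e \<le> (a * (of_bool (fst e \<in> S) + of_bool (snd e \<in> S))) * (a * (of_bool (fst e \<in> S') + of_bool (snd e \<in> S')))"
        using ct[OF e, of S] ct[OF e, of S'] a by (intro mult_mono) auto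
      then show "ct S e * ct S' e \<le> a\<^sup>2 * ((of_bool (fst e \<in> S) + of_bool (snd e \<in> S)) * (of_bool (fst e \<in> S') + of_bool (snd e \<in> S')))"
        by (simp only: power2_eq_square ac_simps)
    qed
    also have "\<dots> = a\<^sup>2 * (\<Sum>e\<in>?E. (of_bool (fst e \<in> S) + of_bool (snd e \<in> S)) * (of_bool (fst e \<in> S') + of_bool (snd e \<in> S')))"
      by (simp only: sum_distrib_left)
    also have "\<dots> \<le> a\<^sup>2 * (n * card K + (real s)\<^sup>2)"
    proof (intro mult_left_mono)
      have cS: "(\<Sum>i\<in>{1..n}. of_bool (i \<in> S) :: real) = card S" if "S \<subseteq> {1..n}" for S
        using that by (simp add: Int_absorb1)
      have "2 * (\<Sum>e\<in>?E. (of_bool (fst e \<in> S) + of_bool (snd e \<in> S)) * (of_bool (fst e \<in> S') + of_bool (snd e \<in> S')) :: real)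
        \<le> (\<Sum>i\<in>{1..n}. \<Sum>j\<in>{1..n}. (of_bool (i \<in> S) + of_bool (j \<in> S)) * (of_bool (i \<in> S') + of_bool (j \<in> S')))"
        by (rule sum_edges_le) auto
      \<comment> \<open>Over ordered pairs the terms where one endpoint lies in both supports give n
        card K twice and the mixed terms give s^2 twice; passing to edges halves everything.\<close>
      also have "\<dots> = (\<Sum>i\<in>{1..n}. \<Sum>j\<in>{1..n}. of_bool (i \<in> K)) + (\<Sum>i\<in>{1..n}. \<Sum>j\<in>{1..n}. of_bool (j \<in> K))
         + (\<Sum>i\<in>{1..n}. \<Sum>j\<in>{1..n}. of_bool (i \<in> S) * of_bool (j \<in> S')) + (\<Sum>i\<in>{1..n}. \<Sum>j\<in>{1..n}. of_bool (i \<in> S') * of_bool (j \<in> S))"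
        unfolding sum.distrib[symmetric] by (intro sum.cong refl) (auto simp: K_def of_bool_def)
      also have "(\<Sum>i\<in>{1..n}. \<Sum>j\<in>{1..n}. of_bool (i \<in> K) :: real) = n * card K"
        using cS[OF KJ(4)] by (simp add: sum_distrib_left[symmetric])
      also have "(\<Sum>i\<in>{1..n}. \<Sum>j\<in>{1..n}. of_bool (j \<in> K) :: real) = n * card K"
        using cS[OF KJ(4)] by simp
      also have "(\<Sum>i\<in>{1..n}. \<Sum>j\<in>{1..n}. of_bool (i \<in> S) * of_bool (j \<in> S') :: real) = s * s"
        using cS[OF S(1)] cS[OF S'(1)] S(2) S'(2) by (simp only: sum_product[symmetric] of_nat_mult)
      also have "(\<Sum>i\<in>{1..n}. \<Sum>j\<in>{1..n}. of_bool (i \<in> S') * of_bool (j \<in> S) :: real) = s * s"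
        using cS[OF S(1)] cS[OF S'(1)] S(2) S'(2) by (simp only: sum_product[symmetric] of_nat_mult)
      finally show "(\<Sum>e\<in>?E. (of_bool (fst e \<in> S) + of_bool (snd e \<in> S)) * (of_bool (fst e \<in> S') + of_bool (snd e \<in> S')) :: real)
        \<le> n * card K + (real s)\<^sup>2"
        by (simp add: power2_eq_square)
    qed simp
    finally have "p0 / (1 - p0) * (\<Sum>e\<in>?E. ct S e * ct S' e) \<le> p0 / (1 - p0) * (a\<^sup>2 * (n * card K + (real s)\<^sup>2))"
      using p0 by (intro mult_left_mono) auto
    then show "exp (p0 / (1 - p0) * (\<Sum>e\<in>?E. ct S e * ct S' e)) \<le> exp (\<kappa> * (n * card K + (real s)\<^sup>2))"
      by (simp add: \<kappa>_def mult.assoc)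
    have "card M = card K * card J"
      unfolding M_def by (simp add: card_image[OF inj_on_edge_times[OF KJ(1)]] card_cartesian_product)
    moreover have "n - 2 * s \<le> card J"
      unfolding J_def using S S' fin card_Un_le[of S S']
      by (subst card_Diff_subset) auto
    ultimately have "card K * (n - 2 * s) \<le> card M" by simp
    then show "\<rho> ^ card M \<le> \<rho> ^ (card K * (n - 2 * s))"
      using \<rho> by (intro power_decreasing) auto
  qed (use \<rho> in auto)
  finally have "measure_pmf.expectation (bprod ?E (\<lambda>_. p0))
     (\<lambda>x. (lratio ?E (\<lambda>_. p0) (eprob n lam (flat n S A)) x * of_bool (x \<in> \<Gamma> S))
        * (lratio ?E (\<lambda>_. p0) (eprob n lam (flat n S' A)) x * of_bool (x \<in> \<Gamma> S')))
    \<le> exp (u * \<tau>) ^ card K * (exp (\<kappa> * (n * card K + (real s)\<^sup>2)) * \<rho> ^ (card K * (n - 2 * s)))"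
    by (simp add: mult_left_mono)
  also have "\<dots> = exp (\<kappa> * (real s)\<^sup>2) * (exp (\<kappa> * n) * (exp (u * \<tau>) * \<rho> ^ (n - 2 * s))) ^ card K"
  proof -
    have "exp (\<kappa> * (n * card K + (real s)\<^sup>2)) = exp (\<kappa> * (real s)\<^sup>2 + card K * (\<kappa> * n))"
      by (simp add: algebra_simps)
    then have 1: "exp (\<kappa> * (n * card K + (real s)\<^sup>2)) = exp (\<kappa> * (real s)\<^sup>2) * exp (\<kappa> * n) ^ card K"
      by (simp only: exp_add exp_of_nat_mult)
    have 2: "\<rho> ^ (card K * (n - 2 * s)) = (\<rho> ^ (n - 2 * s)) ^ card K"
      by (simp only: power_mult[symmetric] mult.commute)
    show ?thesis unfolding 1 2 power_mult_distrib by (simp only: ac_simps)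
  qed
  finally show ?thesis unfolding \<rho>_def K_def .
qed

lemma eprob_zero: "eprob n lam (\<lambda>_. 0) = (\<lambda>_. lam / (2 * real n))"
proof
  fix e show "eprob n lam (\<lambda>_. 0) e = lam / (2 * real n)"
    using eprob_eq_tanh[of n lam "\<lambda>_. 0" "fst e" "snd e"] by simp
qed

lemma eprob_bounds:
  assumes "0 \<le> lam" "lam \<le> real n"
  shows "0 \<le> eprob n lam \<beta> e \<and> eprob n lam \<beta> e \<le> 1"
proof -
  define t where "t = tanh ((\<beta> (fst e) + \<beta> (snd e)) / 2)"
  have eq: "eprob n lam \<beta> e = lam / (2 * real n) * (1 + t)"
    using eprob_eq_tanh[of n lam \<beta> "fst e" "snd e"] by (simp add: t_def)
  have t: "- 1 < t" "t < 1" unfolding t_def by (rule tanh_real_gt_neg1 tanh_real_lt_1)+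
  have "0 \<le> lam / (2 * real n)" "lam / (2 * real n) \<le> 1 / 2"
    using assms by (auto simp: divide_simps)
  then have "lam / (2 * real n) * (1 + t) \<le> 1 / 2 * 2"
    using t by (intro mult_mono) auto
  then show ?thesis unfolding eq using t \<open>0 \<le> lam / (2 * real n)\<close>
    by (intro conjI mult_nonneg_nonneg) auto
qed

text \<open>The prior picks one vertex in each of \<open>s\<close> disjoint blocks of length \<open>m\<close>; the overlap of two
  independent draws is then a sum of independent indicators.\<close>
definition block_set :: "nat \<Rightarrow> nat \<Rightarrow> (nat \<Rightarrow> nat) \<Rightarrow> nat set" where
  "block_set s m f = (\<lambda>b. b * m + f b) ` {..<s}"

text \<open>Positions inside a block run from 1 to m, hence the subtraction before dividing.\<close>

lemma block_index:
  fixes b m c :: nat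
  assumes "1 \<le> c" "c \<le> m" shows "(b * m + c - 1) div m = b"
proof -
  obtain d where "c = Suc d" using assms by (cases c) auto
  then show ?thesis using assms by simp
qed

lemma block_set_props:
  assumes f: "f \<in> {..<s} \<rightarrow>\<^sub>E {1..m}" and n: "s * m \<le> n"
  shows "block_set s m f \<subseteq> {1..n}" "card (block_set s m f) = s"
proof -
  have fb: "1 \<le> f b \<and> f b \<le> m" if "b < s" for b using f that by (auto simp: PiE_def Pi_def)
  show "block_set s m f \<subseteq> {1..n}"
  proof
    fix i assume "i \<in> block_set s m f"
    then obtain b where b: "b < s" "i = b * m + f b" by (auto simp: block_set_def)
    have "Suc b * m \<le> s * m" using b by (intro mult_right_mono) auto
    then show "i \<in> {1..n}" using fb[OF b(1)] b n by auto
  qed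
  have "inj_on (\<lambda>b. b * m + f b) {..<s}"
    by (rule inj_on_inverseI[where g = "\<lambda>i. (i - 1) div m"]) (use fb in \<open>auto simp: block_index simp del: One_nat_def\<close>)
  then show "card (block_set s m f) = s" by (simp add: block_set_def card_image)
qed

lemma card_block_set_Int:
  assumes f: "f \<in> {..<s} \<rightarrow>\<^sub>E {1..m}" and g: "g \<in> {..<s} \<rightarrow>\<^sub>E {1..m}"
  shows "card (block_set s m f \<inter> block_set s m g) = card {b\<in>{..<s}. f b = g b}"
proof -
  have fb: "1 \<le> f b \<and> f b \<le> m" "1 \<le> g b \<and> g b \<le> m" if "b < s" for b
    using f g that by (auto simp: PiE_def Pi_def)
  have "block_set s m f \<inter> block_set s m g = (\<lambda>b. b * m + f b) ` {b\<in>{..<s}. f b = g b}"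
  proof (intro equalityI subsetI)
    fix i assume "i \<in> block_set s m f \<inter> block_set s m g"
    then obtain b c where bc: "b < s" "i = b * m + f b" "c < s" "i = c * m + g c"
      by (auto simp: block_set_def)
    have "b = c" using block_index[of "f b" m b] block_index[of "g c" m c] fb bc by metis
    then show "i \<in> (\<lambda>b. b * m + f b) ` {b\<in>{..<s}. f b = g b}"
      using bc by (intro image_eqI[where x = b]) auto
  next
    fix i assume "i \<in> (\<lambda>b. b * m + f b) ` {b\<in>{..<s}. f b = g b}"
    then obtain b where b: "b < s" "f b = g b" "i = b * m + f b" by auto
    have "i \<in> block_set s m f"
      unfolding block_set_def b(3) using b(1) by (intro image_eqI[where x = b]) simp_all
    moreover have "i \<in> block_set s m g"
      unfolding block_set_def b(3) b(2) using b(1) by (intro image_eqI[where x = b]) simp_all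
    ultimately show "i \<in> block_set s m f \<inter> block_set s m g" by blast
  qed
  moreover have "inj_on (\<lambda>b. b * m + f b) {b\<in>{..<s}. f b = g b}"
    by (rule inj_on_inverseI[where g = "\<lambda>i. (i - 1) div m"]) (use fb in \<open>auto simp: block_index simp del: One_nat_def\<close>)
  ultimately show ?thesis by (simp only: card_image)
qed

text \<open>For fixed f the overlap with a uniform g is binomial with s trials of probability 1/m,
  so its generating function is (1 + (x - 1) / m)^s. Independent blocks avoid the hypergeometric
  overlap of uniform subsets.\<close>

lemma sum_power_overlap_le:
  fixes x :: real
  assumes m: "0 < m" and x: "0 \<le> x" and f: "f \<in> {..<s} \<rightarrow>\<^sub>E {1..m}"
  shows "(\<Sum>g\<in>{..<s} \<rightarrow>\<^sub>E {1..m}. x ^ card (block_set s m f \<inter> block_set s m g))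
    \<le> real m ^ s * exp (x * s / m)"
proof -
  have "(\<Sum>g\<in>{..<s} \<rightarrow>\<^sub>E {1..m}. x ^ card (block_set s m f \<inter> block_set s m g))
      = (\<Sum>g\<in>{..<s} \<rightarrow>\<^sub>E {1..m}. \<Prod>b<s. if f b = g b then x else 1)"
  proof (intro sum.cong refl)
    fix g assume g: "g \<in> {..<s} \<rightarrow>\<^sub>E {1..m}"
    have "(\<Prod>b<s. if f b = g b then x else 1) = (\<Prod>b\<in>{b\<in>{..<s}. f b = g b}. x)"
      by (intro prod.mono_neutral_cong_right) auto
    then show "x ^ card (block_set s m f \<inter> block_set s m g) = (\<Prod>b<s. if f b = g b then x else 1)"
      by (simp add: card_block_set_Int[OF f g])
  qed
  also have "\<dots> = (\<Prod>b<s. \<Sum>c\<in>{1..m}. if f b = c then x else 1)"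
    by (subst prod_sum_PiE) auto
  also have "\<dots> = (\<Prod>b<s. real m - 1 + x)"
  proof (intro prod.cong refl)
    fix b assume "b \<in> {..<s}"
    then have fb: "f b \<in> {1..m}" using f by (auto simp: PiE_def Pi_def)
    have "(\<Sum>c\<in>{1..m}. if f b = c then x else 1) = (\<Sum>c\<in>{1..m}. 1 + (if f b = c then x - 1 else 0))"
      by (intro sum.cong) auto
    also have "\<dots> = real m - 1 + x"
      using fb by (simp add: sum.distrib)
    finally show "(\<Sum>c\<in>{1..m}. if f b = c then x else 1) = real m - 1 + x" .
  qed
  also have "\<dots> = (real m - 1 + x) ^ s" by simp
  also have "\<dots> \<le> (real m * exp (x / m)) ^ s"
  proof (intro power_mono)
    have "real m - 1 + x \<le> real m * (1 + x / m)" using m by (simp add: field_simps)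
    also have "\<dots> \<le> real m * exp (x / m)" by (intro mult_left_mono) auto
    finally show "real m - 1 + x \<le> real m * exp (x / m)" .
  qed (use m x in auto)
  also have "\<dots> = real m ^ s * exp (x * s / m)"
    by (simp add: power_mult_distrib mult.commute flip: exp_of_nat_mult)
  finally show ?thesis .
qed

text \<open>Averaging the pairwise bound over two independent draws gives D as a product: exp
  (\<kappa> s^2) from pairs joining the two supports, and the exponential of x s / m from the
  overlap, x being the cost of one common vertex.\<close>

lemma risk_lower_bound:
  fixes A A' lam \<tau> u \<eta> :: real and n s m :: nat
  defines "p0 \<equiv> lam / (2 * real n)"
  defines "a \<equiv> tanh (A / 2)"
  defines "\<kappa> \<equiv> p0 * a\<^sup>2 / (1 - p0)"
  defines "p2 \<equiv> p0 * (1 + a)\<^sup>2 / (1 + \<kappa>)"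
  assumes lam: "0 < lam" "lam \<le> n" and A: "0 < A" "A' \<le> A" and u: "0 \<le> u"
    and m: "0 < m" "s * m \<le> n"
    and \<eta>: "\<And>S. S \<subseteq> {1..n} \<Longrightarrow> card S = s \<Longrightarrow>
      measure_pmf.prob (bprod (edges n) (eprob n lam (flat n S A)))
        (- {x. \<forall>i\<in>S. (\<Sum>e\<in>edge i ` ({1..n} - S). of_bool (x e)) \<le> \<tau>}) \<le> \<eta>"
  shows "1 - sqrt (exp (\<kappa> * (real s)\<^sup>2)
        * exp (exp (\<kappa> * n) * (exp (u * \<tau>) * (1 - p2 + p2 * exp (- u)) ^ (n - 2 * s)) * s / m)
      - 1 + 2 * \<eta>) \<le> risk n lam s A' T"
proof -
  define I where "I = {..<s} \<rightarrow>\<^sub>E {1..m}"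
  have I: "finite I" "I \<noteq> {}" "real (card I) = real m ^ s"
    using m by (auto simp: I_def PiE_eq_empty_iff card_PiE intro!: finite_PiE)
  have n: "n > 0" using lam by (cases n) auto
  have p0: "0 < p0" "p0 < 1" using lam n by (auto simp: p0_def field_simps)
  let ?S = "block_set s m"
  note S = block_set_props[OF _ m(2)]
  define \<Gamma> where "\<Gamma> S = {x. \<forall>i\<in>S. (\<Sum>e\<in>edge i ` ({1..n} - S). of_bool (x e)) \<le> \<tau>}" for S
  define x where "x = exp (\<kappa> * n) * (exp (u * \<tau>) * (1 - p2 + p2 * exp (- u)) ^ (n - 2 * s))"
  let ?Q = "\<lambda>f. bprod (edges n) (eprob n lam (flat n (?S f) A))"
  let ?L = "\<lambda>f. lratio (edges n) (\<lambda>_. p0) (eprob n lam (flat n (?S f) A))"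
  have x: "0 \<le> x"
  proof -
    have \<kappa>: "0 \<le> \<kappa>" using p0 by (auto simp: \<kappa>_def)
    have "1 + \<kappa> - p0 * (1 + a)\<^sup>2 = (1 - p0 - p0 * a)\<^sup>2 / (1 - p0)"
      using p0 by (simp add: \<kappa>_def field_simps power2_eq_square)
    also have "\<dots> \<ge> 0" using p0 by auto
    finally have "p2 \<le> 1" using \<kappa> by (simp add: p2_def)
    moreover have "0 \<le> p2" using p0 \<kappa> by (auto simp: p2_def)
    ultimately have "0 \<le> 1 - p2 + p2 * exp (- u)" by auto
    then show ?thesis by (simp add: x_def)
  qed
  define R where "R = (SUP \<beta>\<in>Xi n s A'. measure_pmf.prob (beta_law n lam \<beta>) {Y. \<not> T Y})"
  have "1 - sqrt (exp (\<kappa> * (real s)\<^sup>2) * exp (x * s / m) - 1 + 2 * \<eta>)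
      \<le> measure_pmf.prob (bprod (edges n) (\<lambda>_. p0)) {x. T (adj x)} + R"
  proof (rule lecam_truncated[where Q = ?Q and L = ?L and \<Gamma> = "\<lambda>f. \<Gamma> (?S f)" and I = I])
    show "finite (set_pmf (bprod (edges n) (\<lambda>_. p0)))" by (rule finite_set_bprod) simp
    show "finite I" "I \<noteq> {}" using I by auto
    show "measure_pmf.expectation (?Q i) h
      = measure_pmf.expectation (bprod (edges n) (\<lambda>_. p0)) (\<lambda>x. ?L i x * h x)" for i h
      using p0 eprob_bounds[of lam n] lam by (intro expectation_change_measure) auto
    show "measure_pmf.prob (?Q i) (- \<Gamma> (?S i)) \<le> \<eta>" if "i \<in> I" for i
      unfolding \<Gamma>_def using that by (intro \<eta> S) (auto simp: I_def)
    show "measure_pmf.prob (?Q i) {x. \<not> T (adj x)} \<le> R" if "i \<in> I" for i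
    proof -
      have "flat n (?S i) A \<in> Xi n s A'"
        using that A by (intro flat_in_Xi S) (auto simp: I_def)
      then have "measure_pmf.prob (beta_law n lam (flat n (?S i) A)) {Y. \<not> T Y} \<le> R"
        unfolding R_def by (rule cSUP_upper) (auto intro!: bdd_aboveI[of _ 1])
      then show ?thesis by (simp add: prob_beta_law)
    qed
    have "(\<Sum>i\<in>I. \<Sum>j\<in>I. measure_pmf.expectation (bprod (edges n) (\<lambda>_. p0))
        (\<lambda>x. ?L i x * of_bool (x \<in> \<Gamma> (?S i)) * (?L j x * of_bool (x \<in> \<Gamma> (?S j)))))
      \<le> (\<Sum>i\<in>I. \<Sum>j\<in>I. exp (\<kappa> * (real s)\<^sup>2) * x ^ card (?S i \<inter> ?S j))"
    proof (intro sum_mono)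
      fix f g assume fg: "f \<in> I" "g \<in> I"
      show "measure_pmf.expectation (bprod (edges n) (\<lambda>_. p0))
        (\<lambda>x. ?L f x * of_bool (x \<in> \<Gamma> (?S f)) * (?L g x * of_bool (x \<in> \<Gamma> (?S g))))
        \<le> exp (\<kappa> * (real s)\<^sup>2) * x ^ card (?S f \<inter> ?S g)"
        unfolding \<Gamma>_def x_def p2_def \<kappa>_def a_def p0_def
        by (rule truncated_second_moment) (use fg lam A u S in \<open>auto simp: I_def\<close>)
    qed
    also have "\<dots> = exp (\<kappa> * (real s)\<^sup>2) * (\<Sum>i\<in>I. \<Sum>j\<in>I. x ^ card (?S i \<inter> ?S j))"
      by (simp add: sum_distrib_left)
    also have "\<dots> \<le> exp (\<kappa> * (real s)\<^sup>2) * (\<Sum>i\<in>I. real m ^ s * exp (x * s / m))"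
      unfolding I_def by (intro mult_left_mono sum_mono sum_power_overlap_le m x) auto
    also have "\<dots> = exp (\<kappa> * (real s)\<^sup>2) * exp (x * s / m) * (real (card I))\<^sup>2"
      by (simp add: I power2_eq_square)
    finally show "(\<Sum>i\<in>I. \<Sum>j\<in>I. measure_pmf.expectation (bprod (edges n) (\<lambda>_. p0))
        (\<lambda>x. ?L i x * of_bool (x \<in> \<Gamma> (?S i)) * (?L j x * of_bool (x \<in> \<Gamma> (?S j)))))
      \<le> exp (\<kappa> * (real s)\<^sup>2) * exp (x * s / m) * (real (card I))\<^sup>2" .
  qed
  then show ?thesis
    unfolding risk_def x_def R_def prob_beta_law eprob_zero p0_def .
qed

lemma eprob_flat_star:
  assumes "S \<subseteq> {1..n}" "i \<in> S" "j \<in> {1..n} - S"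
  shows "eprob n lam (flat n S A) (edge i j) = lam / (2 * real n) * (1 + tanh (A / 2))"
  using assms by (auto simp: eprob_eq_tanh edge_def flat_def min_def max_def)

text \<open>Union bound over the support. Edges leaving S have one endpoint without signal, so their
  success probabilities all coincide and a single Chernoff factor serves every vertex.\<close>

lemma prob_truncation_le:
  fixes A lam \<tau> v :: real
  assumes lam: "0 < lam" "lam \<le> n" and v: "0 \<le> v" and S: "S \<subseteq> {1..n}" "card S = s"
  defines "pA \<equiv> lam / (2 * real n) * (1 + tanh (A / 2))"
  shows "measure_pmf.prob (bprod (edges n) (eprob n lam (flat n S A)))
        (- {x. \<forall>i\<in>S. (\<Sum>e\<in>edge i ` ({1..n} - S). of_bool (x e)) \<le> \<tau>})
    \<le> s * (exp (- v * \<tau>) * (1 - pA + pA * exp v) ^ (n - s))"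
proof -
  let ?P = "bprod (edges n) (eprob n lam (flat n S A))"
  have fin: "finite S" using S finite_subset by blast
  have "measure_pmf.prob ?P (- {x. \<forall>i\<in>S. (\<Sum>e\<in>edge i ` ({1..n} - S). of_bool (x e)) \<le> \<tau>})
      = measure_pmf.prob ?P (\<Union>i\<in>S. {x. \<tau> < (\<Sum>e\<in>edge i ` ({1..n} - S). of_bool (x e))})"
    by (rule arg_cong[where f = "measure_pmf.prob ?P"]) (auto simp: not_le)
  also have "\<dots> \<le> (\<Sum>i\<in>S. measure_pmf.prob ?P {x. \<tau> < (\<Sum>e\<in>edge i ` ({1..n} - S). of_bool (x e))})"
    using fin by (intro measure_pmf.finite_measure_subadditive_finite) auto
  also have "\<dots> \<le> (\<Sum>i\<in>S. exp (- v * \<tau>) * (1 - pA + pA * exp v) ^ (n - s))"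
  proof (intro sum_mono)
    fix i assume i: "i \<in> S"
    let ?M = "edge i ` ({1..n} - S)"
    have M: "?M \<subseteq> edges n"
    proof (intro image_subsetI edge_in_edges)
      show "i \<in> {1..n}" using i S by auto
    qed (use i in auto)
    have "measure_pmf.prob ?P {x. \<tau> < (\<Sum>e\<in>?M. of_bool (x e))}
      \<le> exp (- v * \<tau>) * (\<Prod>e\<in>?M. 1 - eprob n lam (flat n S A) e + eprob n lam (flat n S A) e * exp v)"
      using v eprob_bounds[of lam n] lam by (intro prob_bprod_chernoff M) auto
    also have "(\<Prod>e\<in>?M. 1 - eprob n lam (flat n S A) e + eprob n lam (flat n S A) e * exp v) = (\<Prod>e\<in>?M. 1 - pA + pA * exp v)"
      using i S by (intro prod.cong refl) (auto simp: eprob_flat_star pA_def simp del: atLeastAtMost_iff)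
    also have "\<dots> = (1 - pA + pA * exp v) ^ (n - s)"
      using i S fin by (simp add: card_image inj_on_edge card_Diff_subset)
    finally show "measure_pmf.prob ?P {x. \<tau> < (\<Sum>e\<in>?M. of_bool (x e))} \<le> exp (- v * \<tau>) * (1 - pA + pA * exp v) ^ (n - s)" .
  qed
  finally show ?thesis using S by simp
qed

section \<open>Powerlessness\<close>

lemma tanh_artanh_real:
  fixes x :: real assumes "- 1 < x" "x < 1" shows "tanh (artanh x) = x"
proof -
  have "- 2 * artanh x = ln ((1 - x) / (1 + x))"
    using assms by (simp add: artanh_def ln_div)
  then have "exp (- 2 * artanh x) = (1 - x) / (1 + x)"
    using assms by simp
  then have "tanh (artanh x) = (1 - (1 - x) / (1 + x)) / (1 + (1 - x) / (1 + x))"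
    by (simp only: tanh_real_altdef)
  moreover have "(1 - (1 - x) / (1 + x)) / (1 + (1 - x) / (1 + x)) = x"
    using assms by (simp add: field_simps)
  ultimately show ?thesis by simp
qed

text \<open>The double angle formula solved for a correction factor: it shows that tanh (x / 2) is
  asymptotically tanh x / 2 once tanh (x / 2) is known to vanish.\<close>

lemma tanh_half_identity:
  fixes x :: real shows "tanh (x / 2) = tanh x * (1 + (tanh (x / 2))\<^sup>2) / 2"
proof -
  have "tanh x = 2 * tanh (x / 2) / (1 + (tanh (x / 2))\<^sup>2)"
    using tanh_add[of "x / 2" "x / 2"] cosh_real_nonzero[of "x / 2"] by (simp add: power2_eq_square)
  moreover have "1 + (tanh (x / 2))\<^sup>2 \<noteq> 0"
    by (metis add_pos_nonneg less_numeral_extra(1,3) zero_le_power2)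
  ultimately show ?thesis by (simp add: field_simps)
qed

lemma powr_tendsto_zero:
  fixes c :: real assumes "c < 0" shows "(\<lambda>n. real n powr c) \<longlonglongrightarrow> 0"
  using assms by (intro tendsto_neg_powr filterlim_real_sequentially)

lemma ln_powr_tendsto_zero:
  fixes c :: real assumes "c < 0" shows "(\<lambda>n. ln (real n) * real n powr c) \<longlonglongrightarrow> 0"
  using lim_ln_over_power[of "- c"] assms by (simp add: powr_minus divide_inverse)

lemma tendsto_zero_if_mult_sqrt:
  fixes k :: "nat \<Rightarrow> real"
  assumes k: "\<And>n. 0 \<le> k n" and lim: "(\<lambda>n. k n / real n * sqrt (real n)) \<longlonglongrightarrow> 0"
  shows "(\<lambda>n. k n / real n) \<longlonglongrightarrow> 0"
proof (rule tendsto_sandwich[OF _ _ tendsto_const lim])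
  show "\<forall>\<^sub>F n in sequentially. k n / real n \<le> k n / real n * sqrt (real n)"
    using eventually_ge_at_top[of 1]
  proof eventually_elim
    case (elim n)
    have "k n / real n * 1 \<le> k n / real n * sqrt (real n)"
      using elim k[of n] by (intro mult_left_mono) auto
    then show ?case by simp
  qed
  show "\<forall>\<^sub>F n in sequentially. 0 \<le> k n / real n" using k by simp
qed

lemma kappa_nonneg:
  fixes p a :: real assumes "0 < p \<and> p \<le> 1 / 2" shows "0 \<le> p * a\<^sup>2 / (1 - p)"
  using assms by (intro divide_nonneg_nonneg mult_nonneg_nonneg) auto

section \<open>The sparse regime\<close>

locale sparse_model =
  fixes \<alpha> \<theta> :: real and s :: "nat \<Rightarrow> nat" and lam :: "nat \<Rightarrow> real"
  assumes alpha: "1/2 < \<alpha>" "\<alpha> < 1"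
    and s: "\<forall>n\<ge>1. s n = nat \<lfloor>real n powr (1 - \<alpha>)\<rfloor> \<or> s n = nat \<lceil>real n powr (1 - \<alpha>)\<rceil>"
    and lam: "\<forall>n\<ge>1. 1 \<le> lam n \<and> lam n \<le> real n"
    and theta: "(\<lambda>n. lam n / (2 * real n)) \<longlonglongrightarrow> \<theta>"
begin

abbreviation p0 :: "nat \<Rightarrow> real" where "p0 n \<equiv> lam n / (2 * real n)"

lemma p0: "n \<ge> 1 \<Longrightarrow> 0 < p0 n \<and> p0 n \<le> 1 / 2"
proof -
  assume n: "n \<ge> 1"
  then have "1 \<le> lam n" "lam n \<le> real n" using lam by auto
  then show ?thesis using n by (auto simp: field_simps)
qed

lemma theta_bounds: "0 \<le> \<theta>" "\<theta> \<le> 1 / 2"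
proof -
  show "0 \<le> \<theta>" by (rule tendsto_lowerbound[OF theta]) (auto intro!: eventually_sequentiallyI[of 1] dest!: p0)
  show "\<theta> \<le> 1 / 2" by (rule tendsto_upperbound[OF theta]) (auto intro!: eventually_sequentiallyI[of 1] dest!: p0)
qed

lemma s_bounds:
  assumes "n \<ge> 1"
  shows "1 \<le> s n" "real n powr (1 - \<alpha>) / 2 \<le> real (s n)" "real (s n) \<le> 2 * real n powr (1 - \<alpha>)"
proof -
  define y where "y = real n powr (1 - \<alpha>)"
  have y: "1 \<le> y" using assms alpha by (auto simp: y_def ge_one_powr_ge_zero)
  have "s n = nat \<lfloor>y\<rfloor> \<or> s n = nat \<lceil>y\<rceil>" using s assms by (auto simp: y_def)
  then have "1 \<le> s n \<and> y / 2 \<le> real (s n) \<and> real (s n) \<le> 2 * y"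
  proof -
    have "real_of_int \<lfloor>y\<rfloor> \<le> y" "y < real_of_int \<lfloor>y\<rfloor> + 1" "1 \<le> real_of_int \<lfloor>y\<rfloor>"
      "y \<le> real_of_int \<lceil>y\<rceil>" "real_of_int \<lceil>y\<rceil> < y + 1"
      using y by (auto simp: le_floor_iff) linarith+
    moreover have "real (s n) = real_of_int \<lfloor>y\<rfloor> \<or> real (s n) = real_of_int \<lceil>y\<rceil>"
      using \<open>s n = nat \<lfloor>y\<rfloor> \<or> s n = nat \<lceil>y\<rceil>\<close> y by auto
    ultimately have "1 \<le> real (s n) \<and> y / 2 \<le> real (s n) \<and> real (s n) \<le> 2 * y"
      using y by linarith
    then show ?thesis by simp
  qed
  then show "1 \<le> s n" "real n powr (1 - \<alpha>) / 2 \<le> real (s n)" "real (s n) \<le> 2 * real n powr (1 - \<alpha>)"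
    by (auto simp: y_def)
qed

lemma s_sq_over_n: "n \<ge> 1 \<Longrightarrow> (real (s n))\<^sup>2 / real n \<le> 4 * real n powr (1 - 2 * \<alpha>)"
proof -
  assume n: "n \<ge> 1"
  have "(real (s n))\<^sup>2 \<le> (2 * real n powr (1 - \<alpha>))\<^sup>2"
    using s_bounds[OF n] by (intro power_mono) auto
  also have "\<dots> = 4 * (real n powr (1 - \<alpha> + (1 - \<alpha>)))"
    by (simp only: powr_add power_mult_distrib) (simp add: power2_eq_square)
  finally have "(real (s n))\<^sup>2 / real n \<le> 4 * (real n powr (1 - \<alpha> + (1 - \<alpha>))) / real n"
    by (intro divide_right_mono) auto
  also have "\<dots> = 4 * real n powr (1 - 2 * \<alpha>)"
    using n powr_diff[of "real n" "1 - \<alpha> + (1 - \<alpha>)" 1] by (simp add: algebra_simps)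
  finally show ?thesis .
qed

text \<open>Dropping s vertices lowers a mean degree by s \<lambda> / (2 n), which is o (sqrt
  \<lambda>) because \<lambda> \<le> n and \<alpha> > 1/2. Hence edges inside the support do not
  affect the degrees to the relevant order.\<close>

lemma s_sqrt_limit: "(\<lambda>n. real (s n) / real n * sqrt (real n)) \<longlonglongrightarrow> 0"
proof (rule tendsto_sandwich[OF _ _ tendsto_const])
  show "(\<lambda>n. 2 * real n powr (1 / 2 - \<alpha>)) \<longlonglongrightarrow> 0"
    using powr_tendsto_zero[of "1 / 2 - \<alpha>"] alpha by (intro tendsto_mult_right_zero) auto
  show "\<forall>\<^sub>F n in sequentially. 0 \<le> real (s n) / real n * sqrt (real n)" by simp
  show "\<forall>\<^sub>F n in sequentially. real (s n) / real n * sqrt (real n) \<le> 2 * real n powr (1 / 2 - \<alpha>)"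
    using eventually_ge_at_top[of 1]
  proof eventually_elim
    case (elim n)
    have "real (s n) / real n * sqrt (real n) \<le> 2 * real n powr (1 - \<alpha>) / real n * sqrt (real n)"
      using s_bounds[OF elim] by (intro mult_right_mono divide_right_mono) auto
    also have "\<dots> = 2 * (real n powr (1 - \<alpha>) / real n powr 1 * real n powr (1 / 2))"
      using elim by (simp add: powr_half_sqrt)
    also have "\<dots> = 2 * real n powr (1 / 2 - \<alpha>)"
      using elim by (simp only: powr_diff[symmetric] powr_add[symmetric]) (simp add: algebra_simps)
    finally show ?case .
  qed
qed

lemma s_over_n_limit: "(\<lambda>n. real (s n) / real n) \<longlonglongrightarrow> 0"
  by (rule tendsto_zero_if_mult_sqrt[OF _ s_sqrt_limit]) simp

lemma s_small: "\<forall>\<^sub>F n in sequentially. 2 * s n \<le> n"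
proof -
  have "\<forall>\<^sub>F n in sequentially. real (s n) / real n < 1 / 2"
    using s_over_n_limit by (rule order_tendstoD) simp
  then show ?thesis using eventually_ge_at_top[of 1]
    by eventually_elim (auto simp: field_simps)
qed

text \<open>The alternative bounds the signal only from below, so the prior may use any signal \<open>B n \<ge> A n\<close>.\<close>
lemma powerless_criterion:
  fixes A B \<tau> u \<eta> :: "nat \<Rightarrow> real" and k K :: real
  defines "\<kappa> \<equiv> \<lambda>n. p0 n * (tanh (B n / 2))\<^sup>2 / (1 - p0 n)"
  defines "p2 \<equiv> \<lambda>n. p0 n * (1 + tanh (B n / 2))\<^sup>2 / (1 + \<kappa> n)"
  assumes A: "\<forall>\<^sub>F n in sequentially. 0 < B n \<and> A n \<le> B n" and u: "\<forall>\<^sub>F n in sequentially. 0 \<le> u n"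
    and \<eta>: "\<forall>\<^sub>F n in sequentially. \<forall>S. S \<subseteq> {1..n} \<longrightarrow> card S = s n \<longrightarrow>
      measure_pmf.prob (bprod (edges n) (eprob n (lam n) (flat n S (B n))))
        (- {x. \<forall>i\<in>S. (\<Sum>e\<in>edge i ` ({1..n} - S). of_bool (x e)) \<le> \<tau> n}) \<le> \<eta> n"
    and \<eta>0: "\<eta> \<longlonglongrightarrow> 0"
    and K: "\<forall>\<^sub>F n in sequentially. \<kappa> n * real n \<le> K * ln (real n)"
    and k: "\<forall>\<^sub>F n in sequentially. exp (\<kappa> n * real n) * (exp (u n * \<tau> n)
       * (1 - p2 n + p2 n * exp (- u n)) ^ (n - 2 * s n)) \<le> real n powr k" "k < 2 * \<alpha> - 1"
  shows "asymp_powerless lam s A T"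
proof -
  \<comment> \<open>The summands bound \<kappa> s^2 and x s / m. The 8 comes from s / m \<le> 2 s^2
    / n, where integer division loses at most a factor 2, and s^2 / n \<le> 4 n^(1 - 2
    \<alpha>).\<close>
  define e where "e n = 4 * K * (ln (real n) * real n powr (1 - 2 * \<alpha>)) + 8 * real n powr (k + 1 - 2 * \<alpha>)" for n
  define b where "b n = 1 - sqrt (exp (e n) - 1 + 2 * \<eta> n)" for n
  have "e \<longlonglongrightarrow> 4 * K * 0 + 8 * 0"
    unfolding e_def using alpha k(2) by (intro tendsto_intros ln_powr_tendsto_zero powr_tendsto_zero) auto
  then have "b \<longlonglongrightarrow> 1 - sqrt (exp (4 * K * 0 + 8 * 0) - 1 + 2 * 0)"
    unfolding b_def by (intro tendsto_intros \<eta>0)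
  then have b: "b \<longlonglongrightarrow> 1" by simp
  have "\<forall>\<^sub>F n in sequentially. b n \<le> risk n (lam n) (s n) (A n) (T n)"
    using A u \<eta> K k(1) s_small eventually_ge_at_top[of 1]
  proof eventually_elim
    case (elim n)
    have n1: "n \<ge> 1" by fact
    define m where "m = n div s n"
    define x where "x = exp (\<kappa> n * real n) * (exp (u n * \<tau> n)
       * (1 - p2 n + p2 n * exp (- u n)) ^ (n - 2 * s n))"
    have l: "0 < lam n" "lam n \<le> n" using lam n1 by (auto intro: less_le_trans[OF zero_less_one])
    have s1: "1 \<le> s n" using s_bounds n1 by auto
    have m: "0 < m" "s n * m \<le> n"
      using \<open>2 * s n \<le> n\<close> s1 by (auto simp: m_def div_greater_zero_iff)
    have x: "x \<le> real n powr k" unfolding x_def by fact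
    have "n < s n * m + s n"
      unfolding m_def using s1 by (metis add.commute dividend_less_times_div less_le_trans zero_less_one)
    moreover have "s n * 1 \<le> s n * m" using m by (intro mult_left_mono) auto
    ultimately have "n \<le> 2 * (s n * m)" by linarith
    then have "real n \<le> 2 * (real (s n) * real m)" by (metis of_nat_le_iff of_nat_mult of_nat_numeral)
    then have sm: "real (s n) / real m \<le> 2 * ((real (s n))\<^sup>2 / real n)"
      using m n1 s1 by (simp add: field_simps power2_eq_square)
    have "x * real (s n) / real m \<le> real n powr k * (2 * (4 * real n powr (1 - 2 * \<alpha>)))"
    proof -
      have "x * (real (s n) / real m) \<le> real n powr k * (real (s n) / real m)"
        using x by (intro mult_right_mono) auto
      also have "\<dots> \<le> real n powr k * (2 * (4 * real n powr (1 - 2 * \<alpha>)))"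
        using sm s_sq_over_n[of n] n1 by (intro mult_left_mono) auto
      finally show ?thesis by simp
    qed
    also have "\<dots> = 8 * real n powr (k + 1 - 2 * \<alpha>)"
      by (simp add: powr_add[symmetric] algebra_simps)
    finally have 1: "x * real (s n) / real m \<le> 8 * real n powr (k + 1 - 2 * \<alpha>)" .
    have \<kappa>: "0 \<le> \<kappa> n" unfolding \<kappa>_def by (rule kappa_nonneg[OF p0[OF n1]])
    have "\<kappa> n * (real (s n))\<^sup>2 = (\<kappa> n * real n) * ((real (s n))\<^sup>2 / real n)"
      using n1 by simp
    also have "\<dots> \<le> (\<kappa> n * real n) * (4 * real n powr (1 - 2 * \<alpha>))"
      using \<kappa> s_sq_over_n[of n] n1 by (intro mult_left_mono) auto
    also have "\<dots> \<le> (K * ln (real n)) * (4 * real n powr (1 - 2 * \<alpha>))"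
      using \<open>\<kappa> n * real n \<le> K * ln (real n)\<close> by (intro mult_right_mono) auto
    finally have 2: "\<kappa> n * (real (s n))\<^sup>2 \<le> 4 * K * (ln (real n) * real n powr (1 - 2 * \<alpha>))"
      by simp
    have "exp (\<kappa> n * (real (s n))\<^sup>2) * exp (x * real (s n) / real m) \<le> exp (e n)"
      unfolding exp_add[symmetric] e_def using 1 2 by simp
    then have "b n \<le> 1 - sqrt (exp (\<kappa> n * (real (s n))\<^sup>2) * exp (x * real (s n) / real m) - 1 + 2 * \<eta> n)"
      unfolding b_def by simp
    also have "\<dots> \<le> risk n (lam n) (s n) (A n) (T n)"
      unfolding x_def p2_def \<kappa>_def
    proof (rule risk_lower_bound)
      show "0 < B n" "A n \<le> B n" using \<open>0 < B n \<and> A n \<le> B n\<close> by auto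
      fix S assume "S \<subseteq> {1..n}" "card S = s n"
      then show "measure_pmf.prob (bprod (edges n) (eprob n (lam n) (flat n S (B n))))
        (- {x. \<forall>i\<in>S. (\<Sum>e\<in>edge i ` ({1..n} - S). of_bool (x e)) \<le> \<tau> n}) \<le> \<eta> n"
        using elim(3) by blast
    qed (fact l m \<open>0 \<le> u n\<close>)+
    finally show ?case .
  qed
  then have "Liminf sequentially (\<lambda>n. ereal (b n)) \<le> Liminf sequentially (\<lambda>n. ereal (risk n (lam n) (s n) (A n) (T n)))"
    by (intro Liminf_mono) (auto elim: eventually_mono)
  moreover have "Liminf sequentially (\<lambda>n. ereal (b n)) = 1"
    using b by (intro lim_imp_Liminf) (auto simp: one_ereal_def)
  ultimately show ?thesis unfolding asymp_powerless_def by simp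
qed

text \<open>At level n the truncation event is certain, which recovers the plain second moment
  method.\<close>

lemma no_truncation:
  assumes "S \<subseteq> {1..n}" "card S = s n"
  shows "measure_pmf.prob P (- {x. \<forall>i\<in>S. (\<Sum>e\<in>edge i ` ({1..n} - S). of_bool (x e)) \<le> real n}) \<le> 0"
proof -
  have "(\<Sum>e\<in>edge i ` ({1..n} - S). of_bool (x e)) \<le> real n" for i and x :: "nat \<times> nat \<Rightarrow> bool"
  proof -
    have "(\<Sum>e\<in>edge i ` ({1..n} - S). of_bool (x e)) \<le> (\<Sum>e\<in>edge i ` ({1..n} - S). 1 :: real)"
      by (intro sum_mono) auto
    also have "\<dots> = real (card (edge i ` ({1..n} - S)))" by simp
    also have "\<dots> \<le> real (card {1..n})"
      by (intro of_nat_mono order_trans[OF card_image_le] card_mono) auto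
    finally show ?thesis by simp
  qed
  then show ?thesis by simp
qed

text \<open>With u = 0 the truncation factor is 1, and the cost of a common vertex is the bare exp
  (\<kappa> n).\<close>

lemma powerless_untruncated:
  assumes A: "\<forall>\<^sub>F n in sequentially. 0 < B n \<and> A n \<le> B n"
    and ev: "\<forall>\<^sub>F n in sequentially. p0 n * (tanh (B n / 2))\<^sup>2 / (1 - p0 n) * real n \<le> k * ln (real n)"
    and k: "k < 2 * \<alpha> - 1"
  shows "asymp_powerless lam s A T"
proof (rule powerless_criterion[where B = B and u = "\<lambda>_. 0" and \<tau> = "\<lambda>n. real n" and \<eta> = "\<lambda>_. 0"])
  show "\<forall>\<^sub>F n in sequentially. p0 n * (tanh (B n / 2))\<^sup>2 / (1 - p0 n) * real n \<le> k * ln (real n)" by (rule ev)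
  show "k < 2 * \<alpha> - 1" by (rule k)
  show "\<forall>\<^sub>F n in sequentially. exp (p0 n * (tanh (B n / 2))\<^sup>2 / (1 - p0 n) * real n) * (exp (0 * real n)
       * (1 - p0 n * (1 + tanh (B n / 2))\<^sup>2 / (1 + p0 n * (tanh (B n / 2))\<^sup>2 / (1 - p0 n))
        + p0 n * (1 + tanh (B n / 2))\<^sup>2 / (1 + p0 n * (tanh (B n / 2))\<^sup>2 / (1 - p0 n)) * exp (- 0)) ^ (n - 2 * s n)) \<le> real n powr k"
    using ev eventually_ge_at_top[of 1] by eventually_elim (simp add: powr_def)
qed (use no_truncation A in auto)

text \<open>Since tanh is bounded by 1, the exponent \<kappa> n never exceeds \<lambda>, however
  strong the signal; \<lambda> being o (log n) keeps it below any positive multiple of log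
  n.\<close>

theorem powerless_small_lam:
  assumes small: "(\<lambda>n. lam n / ln (real n)) \<longlonglongrightarrow> 0" and A: "\<forall>n\<ge>1. 0 < A n"
  shows "asymp_powerless lam s A T"
proof (rule powerless_untruncated[where B = A])
  define k where "k = (2 * \<alpha> - 1) / 2"
  have k: "0 < k" "k < 2 * \<alpha> - 1" using alpha by (auto simp: k_def)
  then show "k < 2 * \<alpha> - 1" by simp
  have "\<forall>\<^sub>F n in sequentially. lam n / ln (real n) < k"
    using small k by (intro order_tendstoD)
  then show "\<forall>\<^sub>F n in sequentially. p0 n * (tanh (A n / 2))\<^sup>2 / (1 - p0 n) * real n \<le> k * ln (real n)"
    using eventually_ge_at_top[of 3]
  proof eventually_elim
    case (elim n)
    have n: "n \<ge> 1" using elim by simp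
    note p = p0[OF n]
    have "\<bar>tanh (A n / 2)\<bar> \<le> 1" using tanh_real_lt_1[of "A n / 2"] tanh_real_gt_neg1[of "A n / 2"] by auto
    then have "(tanh (A n / 2))\<^sup>2 \<le> 1" by (simp add: abs_square_le_1)
    then have "p0 n * (tanh (A n / 2))\<^sup>2 / (1 - p0 n) \<le> p0 n * 1 / (1 / 2)"
      using p by (intro frac_le mult_left_mono) auto
    then have "p0 n * (tanh (A n / 2))\<^sup>2 / (1 - p0 n) * real n \<le> p0 n * 1 / (1 / 2) * real n"
      by (intro mult_right_mono) auto
    also have "\<dots> = lam n" using n by simp
    also have "\<dots> \<le> k * ln (real n)"
      using elim by (simp add: field_simps)
    finally show ?case .
  qed
  show "\<forall>\<^sub>F n in sequentially. 0 < A n \<and> A n \<le> A n"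
    using A by (auto intro!: eventually_sequentiallyI[of 1])
qed

end

section \<open>Degree asymptotics when \<lambda> outgrows log n\<close>

locale strong_regime = sparse_model +
  assumes x0: "(\<lambda>n. ln (real n) / lam n) \<longlonglongrightarrow> 0"
begin

lemma xpos: "\<forall>\<^sub>F n in sequentially. 0 < sqrt (ln (real n) / lam n)"
  using eventually_ge_at_top[of 2]
proof eventually_elim
  case (elim n)
  then have "0 < lam n" using lam by (auto intro: less_le_trans[OF zero_less_one])
  with elim show ?case by simp
qed

text \<open>All degree-type sums that occur are sums of about \<open>n\<close> Bernoulli variables with success probability close to
  \<^term>\<open>p0\<close>; \<open>g\<close> is the relative change of the probability, \<open>k\<close> the number of dropped vertices.\<close>
lemma
  fixes k :: "nat \<Rightarrow> nat" and g T :: "nat \<Rightarrow> real" and \<gamma> c :: real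
  assumes kn: "\<forall>\<^sub>F n in sequentially. k n \<le> n" and k: "(\<lambda>n. real (k n) / real n * sqrt (real n)) \<longlonglongrightarrow> 0"
    and \<gamma>: "(\<lambda>n. (g n - 1) / sqrt (ln (real n) / lam n)) \<longlonglongrightarrow> \<gamma>"
    and T: "(\<lambda>n. T n / sqrt (lam n * ln (real n))) \<longlonglongrightarrow> c"
  shows degree_variance_limit:
      "(\<lambda>n. real (n - k n) * (p0 n * g n) * (1 - p0 n * g n) / lam n) \<longlonglongrightarrow> (1 - \<theta>) / 2"
    and degree_mean_limit:
      "(\<lambda>n. (real n * p0 n + T n - real (n - k n) * (p0 n * g n)) / sqrt (lam n * ln (real n))) \<longlonglongrightarrow> c - \<gamma> / 2"
    and degree_prob_bounds: "\<forall>\<^sub>F n in sequentially. 0 < p0 n * g n \<and> p0 n * g n < 1"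
proof -
  have k0: "(\<lambda>n. real (k n) / real n) \<longlonglongrightarrow> 0"
    by (rule tendsto_zero_if_mult_sqrt[OF _ k]) simp
  \<comment> \<open>From ln n \<ge> 1 and \<lambda> \<le> n one gets 1 / sqrt (ln n / \<lambda>)
    \<le> sqrt n, so the hypothesis on k covers the signal scale.\<close>
  have kx: "(\<lambda>n. real (k n) / real n / sqrt (ln (real n) / lam n)) \<longlonglongrightarrow> 0"
  proof (rule tendsto_sandwich[OF _ _ tendsto_const k])
    show "\<forall>\<^sub>F n in sequentially. real (k n) / real n / sqrt (ln (real n) / lam n) \<le> real (k n) / real n * sqrt (real n)"
      using eventually_ge_at_top[of 3]
    proof eventually_elim
      case (elim n)
      have l: "1 \<le> lam n" "lam n \<le> n" using lam elim by auto
      have "exp 1 \<le> (3 :: real)" using exp_le by simp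
      also have "\<dots> \<le> n" using elim by simp
      finally have "1 \<le> ln (real n)" using elim by (simp add: ln_ge_iff)
      then have "1 / real n \<le> ln (real n) / lam n"
        using l elim by (intro frac_le) auto
      then have "sqrt (1 / real n) \<le> sqrt (ln (real n) / lam n)" by simp
      then have "1 / sqrt (ln (real n) / lam n) \<le> 1 / sqrt (1 / real n)"
        using elim l \<open>1 \<le> ln (real n)\<close> by (intro divide_left_mono mult_pos_pos) auto
      also have "\<dots> = sqrt (real n)" by (simp add: real_sqrt_divide)
      finally have "real (k n) / real n * (1 / sqrt (ln (real n) / lam n)) \<le> real (k n) / real n * sqrt (real n)"
        by (intro mult_left_mono) auto
      then show ?case by simp
    qed
    show "\<forall>\<^sub>F n in sequentially. 0 \<le> real (k n) / real n / sqrt (ln (real n) / lam n)"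
      using eventually_ge_at_top[of 1] by eventually_elim (use lam in auto)
  qed
  have sx: "(\<lambda>n. sqrt (ln (real n) / lam n)) \<longlonglongrightarrow> sqrt 0" by (intro tendsto_intros x0)
  have "(\<lambda>n. (g n - 1) / sqrt (ln (real n) / lam n) * sqrt (ln (real n) / lam n) + 1) \<longlonglongrightarrow> \<gamma> * sqrt 0 + 1"
    by (intro tendsto_intros \<gamma> sx)
  moreover have "\<forall>\<^sub>F n in sequentially. (g n - 1) / sqrt (ln (real n) / lam n) * sqrt (ln (real n) / lam n) + 1 = g n"
  proof -
    have *: "(y - 1) / z * z + 1 = y" if "0 < z" for y z :: real using that by simp
    show ?thesis using xpos by (rule eventually_mono) (rule *)
  qed
  ultimately have g: "g \<longlonglongrightarrow> 1" by (simp add: tendsto_cong)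
  have "(\<lambda>n. p0 n * g n) \<longlonglongrightarrow> \<theta> * 1" by (intro tendsto_intros theta g)
  then have "\<forall>\<^sub>F n in sequentially. p0 n * g n < 1"
    by (rule order_tendstoD) (use theta_bounds in simp)
  moreover have "\<forall>\<^sub>F n in sequentially. 0 < g n"
    using g by (rule order_tendstoD) simp
  ultimately show "\<forall>\<^sub>F n in sequentially. 0 < p0 n * g n \<and> p0 n * g n < 1"
    using eventually_ge_at_top[of 1]
  proof eventually_elim
    case (elim n)
    then show ?case using p0[of n] mult_pos_pos[of "p0 n" "g n"] by blast
  qed
  have "(\<lambda>n. 1 / 2 * (1 - real (k n) / real n) * g n * (1 - p0 n * g n)) \<longlonglongrightarrow> 1 / 2 * (1 - 0) * 1 * (1 - \<theta> * 1)"
    by (intro tendsto_intros k0 g theta)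
  moreover have "\<forall>\<^sub>F n in sequentially. 1 / 2 * (1 - real (k n) / real n) * g n * (1 - p0 n * g n)
      = real (n - k n) * (p0 n * g n) * (1 - p0 n * g n) / lam n"
    using kn eventually_ge_at_top[of 1]
  proof eventually_elim
    case (elim n)
    then have "lam n \<noteq> 0" using lam by (auto dest!: spec[of _ n])
    then have "real (n - k n) * p0 n / lam n = 1 / 2 * (1 - real (k n) / real n)"
      using elim by (simp add: of_nat_diff field_simps)
    moreover have "r * P / l * y * Q = r * (P * y) * Q / l" for r P l y Q :: real by simp
    ultimately show ?case by metis
  qed
  ultimately show "(\<lambda>n. real (n - k n) * (p0 n * g n) * (1 - p0 n * g n) / lam n) \<longlonglongrightarrow> (1 - \<theta>) / 2"
    by (simp add: tendsto_cong)
  \<comment> \<open>As n p0 = \<lambda> / 2, a relative change g - 1 moves the mean by \<lambda> (g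
    - 1) / 2, the source of \<gamma> / 2, while the dropped vertices contribute \<lambda> k g / (2
    n), which is negligible.\<close>
  have "(\<lambda>n. T n / sqrt (lam n * ln (real n)) - 1 / 2 * ((g n - 1) / sqrt (ln (real n) / lam n))
      + 1 / 2 * (real (k n) / real n / sqrt (ln (real n) / lam n)) * g n) \<longlonglongrightarrow> c - 1 / 2 * \<gamma> + 1 / 2 * 0 * 1"
    by (intro tendsto_intros T \<gamma> g kx)
  moreover have "\<forall>\<^sub>F n in sequentially. T n / sqrt (lam n * ln (real n)) - 1 / 2 * ((g n - 1) / sqrt (ln (real n) / lam n))
      + 1 / 2 * (real (k n) / real n / sqrt (ln (real n) / lam n)) * g n
    = (real n * p0 n + T n - real (n - k n) * (p0 n * g n)) / sqrt (lam n * ln (real n))"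
    using kn eventually_ge_at_top[of 2]
  proof eventually_elim
    case (elim n)
    have l1: "1 \<le> lam n" using lam elim by auto
    define a where "a = sqrt (lam n)"
    define b where "b = sqrt (ln (real n))"
    have ab: "a > 0" "lam n = a\<^sup>2" "b > 0" using l1 elim by (auto simp: a_def b_def)
    have r: "sqrt (lam n * ln (real n)) = a * b" "sqrt (ln (real n) / lam n) = b / a"
      by (simp_all add: a_def b_def real_sqrt_mult real_sqrt_divide)
    have "real n > 0" using elim by simp
    then show ?case unfolding r using elim(1) ab(1,3)
      by (simp add: of_nat_diff ab(2) power2_eq_square field_simps)
  qed
  ultimately show "(\<lambda>n. (real n * p0 n + T n - real (n - k n) * (p0 n * g n)) / sqrt (lam n * ln (real n))) \<longlonglongrightarrow> c - \<gamma> / 2"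
    by (simp add: tendsto_cong)
qed

context
  fixes C :: real and B :: "nat \<Rightarrow> real"
  assumes C: "0 < C" and B: "\<forall>\<^sub>F n in sequentially. 0 < B n \<and> tanh (B n) = sqrt (C * ln (real n) / lam n)"
begin

lemma sqrt_x0: "(\<lambda>n. sqrt (ln (real n) / lam n)) \<longlonglongrightarrow> 0"
  using tendsto_real_sqrt[OF x0] by simp

text \<open>Comparison with tanh (B n) first gives convergence to 0; the half-argument identity then
  upgrades it to the exact rate.\<close>

lemma half_tanh_limit: "(\<lambda>n. tanh (B n / 2) / sqrt (ln (real n) / lam n)) \<longlonglongrightarrow> sqrt C / 2"
  and half_tanh_zero: "(\<lambda>n. tanh (B n / 2)) \<longlonglongrightarrow> 0"
proof -
  have 1: "(\<lambda>n. sqrt C * sqrt (ln (real n) / lam n)) \<longlonglongrightarrow> 0"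
    by (intro tendsto_mult_right_zero sqrt_x0)
  have 2: "\<forall>\<^sub>F n in sequentially. tanh (B n / 2) \<le> sqrt C * sqrt (ln (real n) / lam n)"
    using B
  proof eventually_elim
    case (elim n)
    then have "tanh (B n / 2) \<le> tanh (B n)" by (subst tanh_real_le_iff) auto
    also have "\<dots> = sqrt C * sqrt (ln (real n) / lam n)"
      using elim by (simp add: real_sqrt_mult[symmetric])
    finally show ?case .
  qed
  have 3: "\<forall>\<^sub>F n in sequentially. 0 \<le> tanh (B n / 2)"
    using B by eventually_elim simp
  show z: "(\<lambda>n. tanh (B n / 2)) \<longlonglongrightarrow> 0"
    by (rule tendsto_sandwich[OF 3 2 tendsto_const 1])
  have "(\<lambda>n. sqrt C * (1 + (tanh (B n / 2))\<^sup>2) / 2) \<longlonglongrightarrow> sqrt C * (1 + 0\<^sup>2) / 2"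
    by (intro tendsto_intros z) auto
  moreover have "\<forall>\<^sub>F n in sequentially. sqrt C * (1 + (tanh (B n / 2))\<^sup>2) / 2 = tanh (B n / 2) / sqrt (ln (real n) / lam n)"
    using B xpos
  proof eventually_elim
    case (elim n)
    have "tanh (B n / 2) = sqrt C * sqrt (ln (real n) / lam n) * (1 + (tanh (B n / 2))\<^sup>2) / 2"
      using tanh_half_identity[of "B n"] elim by (simp add: real_sqrt_mult[symmetric])
    moreover have "c * w / 2 = t / z" if "t = c * z * w / 2" "0 < z" for c w t z :: real
      using that by (simp add: field_simps)
    ultimately show ?case using elim(2) by blast
  qed
  ultimately have "(\<lambda>n. tanh (B n / 2) / sqrt (ln (real n) / lam n)) \<longlonglongrightarrow> sqrt C * (1 + 0\<^sup>2) / 2"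
    by (rule Lim_transform_eventually)
  then show "(\<lambda>n. tanh (B n / 2) / sqrt (ln (real n) / lam n)) \<longlonglongrightarrow> sqrt C / 2"
    by simp
qed

text \<open>In terms of \<rho> the limit is 2 \<rho>: the second moment of a Gaussian likelihood
  ratio with shift sqrt (2 \<rho> log n) is n^(2 \<rho>).\<close>

lemma chi_limit:
  "(\<lambda>n. p0 n * (tanh (B n / 2))\<^sup>2 / (1 - p0 n) * real n / ln (real n)) \<longlonglongrightarrow> C / (8 * (1 - \<theta>))"
proof -
  have "(\<lambda>n. 1 / 2 * (tanh (B n / 2) / sqrt (ln (real n) / lam n))\<^sup>2 / (1 - p0 n)) \<longlonglongrightarrow> 1 / 2 * (sqrt C / 2)\<^sup>2 / (1 - \<theta>)"
    using theta_bounds by (intro tendsto_intros half_tanh_limit theta) auto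
  moreover have "\<forall>\<^sub>F n in sequentially. 1 / 2 * (tanh (B n / 2) / sqrt (ln (real n) / lam n))\<^sup>2 / (1 - p0 n)
    = p0 n * (tanh (B n / 2))\<^sup>2 / (1 - p0 n) * real n / ln (real n)"
    using eventually_ge_at_top[of 2]
  proof eventually_elim
    case (elim n)
    have l1: "1 \<le> lam n" using lam elim by auto
    define p where "p = p0 n"
    define q where "q = 1 - p"
    have sq: "(sqrt (ln (real n) / lam n))\<^sup>2 = ln (real n) / lam n"
      using l1 elim by simp
    have pn: "lam n / 2 = p * real n" using elim by (simp add: p_def)
    have "1 / 2 * (tanh (B n / 2) / sqrt (ln (real n) / lam n))\<^sup>2 / q
      = lam n / 2 * (tanh (B n / 2))\<^sup>2 / q / ln (real n)"
      unfolding power_divide sq by (simp add: ac_simps)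
    also have "\<dots> = p * (tanh (B n / 2))\<^sup>2 / q * real n / ln (real n)"
      unfolding pn by simp
    finally show ?case unfolding q_def p_def .
  qed
  ultimately show ?thesis
    using C by (simp add: tendsto_cong power_divide)
qed

lemma gamma_one: "(\<lambda>n. (1 + tanh (B n / 2) - 1) / sqrt (ln (real n) / lam n)) \<longlonglongrightarrow> sqrt C / 2"
  using half_tanh_limit by simp

lemma kappa_zero: "(\<lambda>n. p0 n * (tanh (B n / 2))\<^sup>2 / (1 - p0 n)) \<longlonglongrightarrow> 0"
  using tendsto_divide[OF tendsto_mult[OF theta tendsto_power[OF half_tanh_zero, of 2]] tendsto_diff[OF tendsto_const theta, of 1]]
    theta_bounds by simp

text \<open>To first order the doubly tilted probability changes by 2 tanh (B / 2), twice the change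
  under one alternative; the square and \<kappa> are of smaller order.\<close>

lemma gamma_two:
  "(\<lambda>n. ((1 + tanh (B n / 2))\<^sup>2 / (1 + p0 n * (tanh (B n / 2))\<^sup>2 / (1 - p0 n)) - 1) / sqrt (ln (real n) / lam n)) \<longlonglongrightarrow> sqrt C"
proof -
  define a where "a n = tanh (B n / 2)" for n
  define z where "z n = sqrt (ln (real n) / lam n)" for n
  define \<kappa> where "\<kappa> n = p0 n * (a n)\<^sup>2 / (1 - p0 n)" for n
  have \<kappa>: "\<kappa> \<longlonglongrightarrow> 0" unfolding \<kappa>_def a_def by (rule kappa_zero)
  have az: "(\<lambda>n. a n / z n) \<longlonglongrightarrow> sqrt C / 2" unfolding a_def z_def by (rule half_tanh_limit)
  have a0: "a \<longlonglongrightarrow> 0" unfolding a_def by (rule half_tanh_zero)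
  have "(\<lambda>n. (2 * (a n / z n) + a n * (a n / z n) - p0 n * a n * (a n / z n) / (1 - p0 n)) / (1 + \<kappa> n))
    \<longlonglongrightarrow> (2 * (sqrt C / 2) + 0 * (sqrt C / 2) - \<theta> * 0 * (sqrt C / 2) / (1 - \<theta>)) / (1 + 0)"
    using theta_bounds by (intro tendsto_intros az a0 \<kappa> theta) auto
  moreover have "\<forall>\<^sub>F n in sequentially. (2 * (a n / z n) + a n * (a n / z n) - p0 n * a n * (a n / z n) / (1 - p0 n)) / (1 + \<kappa> n)
      = ((1 + a n)\<^sup>2 / (1 + \<kappa> n) - 1) / z n"
    using eventually_ge_at_top[of 1] xpos
  proof eventually_elim
    case (elim n)
    define p where "p = p0 n"
    have "0 \<le> \<kappa> n" unfolding \<kappa>_def by (rule kappa_nonneg[OF p0[OF elim(1)]])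
    then have k: "1 + \<kappa> n > 0" by linarith
    have "(1 + a n)\<^sup>2 / (1 + \<kappa> n) - 1 = (2 * a n + a n * a n - \<kappa> n) / (1 + \<kappa> n)"
      using k by (simp add: field_simps power2_eq_square)
    moreover have "2 * (a n / z n) + a n * (a n / z n) - p0 n * a n * (a n / z n) / (1 - p0 n)
      = (2 * a n + a n * a n - \<kappa> n) / z n"
      unfolding \<kappa>_def p_def[symmetric] by (simp add: power2_eq_square add_divide_distrib diff_divide_distrib ac_simps)
    ultimately show ?case by (simp only: divide_divide_eq_left mult.commute)
  qed
  ultimately show ?thesis unfolding \<kappa>_def a_def z_def by (simp add: tendsto_cong)
qed

end

end

section \<open>Powerlessness below the threshold\<close>

context strong_regime
begin

text \<open>Inverting tanh requires a value below 1, which the square root attains only for large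
  n.\<close>

lemma signal_exists:
  assumes C: "0 < C"
  shows "\<forall>\<^sub>F n in sequentially. 0 < artanh (sqrt (C * ln (real n) / lam n))
    \<and> tanh (artanh (sqrt (C * ln (real n) / lam n))) = sqrt (C * ln (real n) / lam n)"
proof -
  have "(\<lambda>n. C * (ln (real n) / lam n)) \<longlonglongrightarrow> C * 0" by (intro tendsto_intros x0)
  then have "\<forall>\<^sub>F n in sequentially. C * (ln (real n) / lam n) < 1"
    by (rule order_tendstoD) simp
  then show ?thesis using eventually_ge_at_top[of 2]
  proof eventually_elim
    case (elim n)
    define y where "y = sqrt (C * ln (real n) / lam n)"
    have "0 < lam n" using lam elim by (auto intro: less_le_trans[OF zero_less_one])
    then have y: "0 < y" "y < 1" using elim C by (auto simp: y_def)
    then have t: "tanh (artanh y) = y" by (intro tanh_artanh_real) auto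
    then have "0 < artanh y" using y by (metis tanh_real_pos_iff)
    with t show ?case unfolding y_def by blast
  qed
qed

theorem powerless_below_threshold:
  assumes C: "0 < C" "C < C_sparse \<theta> \<alpha>"
    and A: "\<forall>\<^sub>F n in sequentially. tanh (A n) \<le> sqrt (C * ln (real n) / lam n)"
  shows "asymp_powerless lam s A T"
proof -
  define w where "w = sqrt (1 - \<theta>)"
  have w: "0 < w" "w\<^sup>2 = 1 - \<theta>" using theta_bounds by (auto simp: w_def)
  \<comment> \<open>A prior stronger than \<open>A n\<close> still lies in the alternative, so it
    suffices to treat an exact signal B at any convenient level C' \<ge> C.\<close>
  have main: ?thesis if C': "0 < C'" "C \<le> C'" and
    hyp: "\<And>B. \<forall>\<^sub>F n in sequentially. 0 < B n \<and> tanh (B n) = sqrt (C' * ln (real n) / lam n) \<Longrightarrow>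
      \<forall>\<^sub>F n in sequentially. 0 < B n \<and> A n \<le> B n \<Longrightarrow> ?thesis" for C'
  proof (rule hyp[OF signal_exists[OF C'(1)]])
    show "\<forall>\<^sub>F n in sequentially. 0 < artanh (sqrt (C' * ln (real n) / lam n))
      \<and> A n \<le> artanh (sqrt (C' * ln (real n) / lam n))"
      using signal_exists[OF C'(1)] A eventually_ge_at_top[of 1]
    proof eventually_elim
      case (elim n)
      have "0 < lam n" using lam elim by (auto intro: less_le_trans[OF zero_less_one])
      then have "tanh (A n) \<le> sqrt (C' * ln (real n) / lam n)"
        using elim C' by (intro order_trans[OF elim(2)] real_sqrt_le_mono divide_right_mono mult_right_mono) auto
      then have "tanh (A n) \<le> tanh (artanh (sqrt (C' * ln (real n) / lam n)))" using elim by simp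
      then have "A n \<le> artanh (sqrt (C' * ln (real n) / lam n))" by (simp only: tanh_real_le_iff)
      then show ?case using elim(1) by blast
    qed
  qed
  show ?thesis
  \<comment> \<open>At 3/4 both formulas for the constant agree; putting it here gives sqrt (1 -
    \<alpha>) < 1/2 strictly in the other case, so that an admissible q above 1/2 exists.\<close>
  proof (cases "\<alpha> \<le> 3 / 4")
    case True
    have "C_sparse \<theta> \<alpha> = 16 * (1 - \<theta>) * (\<alpha> - 1 / 2)"
    proof (cases "\<alpha> = 3 / 4")
      case True
      have "1 - \<alpha> = (1 / 2)\<^sup>2" using True by (simp add: power2_eq_square)
      then have sq: "sqrt (1 - \<alpha>) = 1 / 2" by simp
      show ?thesis by (simp only: C_sparse_def sq) (simp add: True power2_eq_square)
    qed (use True in \<open>simp add: C_sparse_def\<close>)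
    note eq = this
    have lt: "C / (8 * (1 - \<theta>)) < 2 * \<alpha> - 1"
    proof -
      have "0 < 8 * (1 - \<theta>)" using theta_bounds by simp
      moreover have "C < (2 * \<alpha> - 1) * (8 * (1 - \<theta>))"
        using C(2) unfolding eq by (simp add: algebra_simps)
      ultimately show ?thesis by (simp only: pos_divide_less_eq)
    qed
    obtain k where k: "C / (8 * (1 - \<theta>)) < k" "k < 2 * \<alpha> - 1" using dense[OF lt] by blast
    show ?thesis
    proof (rule main[of C])
      fix B assume B: "\<forall>\<^sub>F n in sequentially. 0 < B n \<and> tanh (B n) = sqrt (C * ln (real n) / lam n)"
        and AB: "\<forall>\<^sub>F n in sequentially. 0 < B n \<and> A n \<le> B n"
      have "\<forall>\<^sub>F n in sequentially. p0 n * (tanh (B n / 2))\<^sup>2 / (1 - p0 n) * real n / ln (real n) < k"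
        using chi_limit[OF C(1) B] k(1) by (rule order_tendstoD)
      then have "\<forall>\<^sub>F n in sequentially. p0 n * (tanh (B n / 2))\<^sup>2 / (1 - p0 n) * real n \<le> k * ln (real n)"
        using eventually_ge_at_top[of 2]
      proof eventually_elim
        case (elim n)
        then have "0 < ln (real n)" by simp
        then show ?case using elim(1) by (simp add: pos_divide_less_eq)
      qed
      then show ?thesis by (rule powerless_untruncated[OF AB _ k(2)])
    qed (use C in auto)
  next
    case False
    define h where "h = sqrt (1 - \<alpha>)"
    have h: "0 < h" "h < 1 / 2" "h\<^sup>2 = 1 - \<alpha>"
    proof -
      have "sqrt (1 - \<alpha>) < sqrt ((1 / 2)\<^sup>2)"
        using False by (intro real_sqrt_less_mono) (simp add: power2_eq_square)
      then show "h < 1 / 2" by (simp add: h_def)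
    qed (use alpha in \<open>auto simp: h_def\<close>)
    \<comment> \<open>Raised above 1/2 if necessary: only then does the doubled shift 2q pass the
      truncation level 1, so that truncating reduces the second moment. The second entry is the
      midpoint between 1/2 and 1 - h.\<close>
    define q where "q = max (sqrt C / (4 * w)) ((1 / 2 + (1 - h)) / 2)"
    define C' where "C' = (4 * w * q)\<^sup>2"
    have Cs: "C < (4 * w * (1 - h))\<^sup>2"
      using C(2) False by (simp add: C_sparse_def h_def power_mult_distrib w(2))
    have "sqrt C < 4 * w * (1 - h)"
      using Cs h w by (intro real_less_lsqrt) auto
    then have q: "1 / 2 < q" "q < 1 - h" using h w by (auto simp: q_def field_simps max_def)
    have sC': "sqrt C' = 4 * w * q" using w q by (simp add: C'_def)
    have C': "0 < C'" "C \<le> C'"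
    proof -
      show "0 < C'" using w q by (simp add: C'_def)
      have "sqrt C / (4 * w) \<le> q" by (simp add: q_def)
      then have "sqrt C \<le> 4 * w * q" using w by (simp add: field_simps)
      then show "C \<le> C'" using sC' by (metis real_sqrt_le_iff)
    qed
    \<comment> \<open>Half the slack in (1 - q)^2 > 1 - \<alpha>. The truncation error then has
      exponent -\<epsilon>, and the same inequality gives k < 2 \<alpha> - 1.\<close>
    define \<epsilon> where "\<epsilon> = ((1 - q)\<^sup>2 - (1 - \<alpha>)) / 2"
    have \<epsilon>: "0 < \<epsilon>"
    proof -
      have "h\<^sup>2 < (1 - q)\<^sup>2" using h q by (intro power_strict_mono) auto
      then show ?thesis using h by (simp add: \<epsilon>_def)
    qed
    define v where "v = (1 - \<theta>) / 2"
    have v: "0 < v" "v = w\<^sup>2 / 2" using w theta_bounds by (auto simp: v_def)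
    \<comment> \<open>Second moment exponent plus the exponent of the truncation factor; apart from
      2 \<epsilon> the sum is 1 - 2 (1 - q)^2.\<close>
    define k where "k = (2 * q\<^sup>2 + \<epsilon>) + (- (1 - 2 * q)\<^sup>2 + \<epsilon>)"
    show ?thesis
    proof (rule main[OF C'])
      fix B assume B: "\<forall>\<^sub>F n in sequentially. 0 < B n \<and> tanh (B n) = sqrt (C' * ln (real n) / lam n)"
        and AB: "\<forall>\<^sub>F n in sequentially. 0 < B n \<and> A n \<le> B n"
      \<comment> \<open>The standard deviation is about w sqrt (\<lambda> / 2), so this is a level
        of sqrt (2 log n) standard deviations.\<close>
      define T' where "T' n = w * sqrt (lam n * ln (real n))" for n
      define \<tau> where "\<tau> n = real n * p0 n + T' n" for n
      have T': "(\<lambda>n. T' n / sqrt (lam n * ln (real n))) \<longlonglongrightarrow> w"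
      proof (rule Lim_transform_eventually[OF tendsto_const])
        show "\<forall>\<^sub>F n in sequentially. w = T' n / sqrt (lam n * ln (real n))"
          using eventually_ge_at_top[of 2]
        proof eventually_elim
          case (elim n)
          then have "0 < lam n" "0 < ln (real n)" using lam by (auto intro: less_le_trans[OF zero_less_one])
          then have "sqrt (lam n * ln (real n)) \<noteq> 0" by auto
          then show ?case unfolding T'_def by (rule nonzero_mult_div_cancel_right[symmetric])
        qed
      qed
      \<comment> \<open>Distance from the mean to the truncation level in units of sqrt (\<lambda>
        log n), under one alternative for c1 and under the doubly tilted law for c2. As q > 1/2, c2
        is negative and staying below the level is a lower-tail event.\<close>
      define c1 where "c1 = w - sqrt C' / 2 / 2"
      define c2 where "c2 = w - sqrt C' / 2"
      have c: "c1 = w * (1 - q)" "c2 = w * (1 - 2 * q)"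
        unfolding c1_def c2_def sC' by (simp_all add: algebra_simps)
      have e: "- c1\<^sup>2 / (2 * v) = - (1 - q)\<^sup>2" "- c2\<^sup>2 / (2 * v) = - (1 - 2 * q)\<^sup>2"
        using w(1) by (simp_all add: c v(2) power_mult_distrib)
      have lam1: "\<forall>n\<ge>1. 1 \<le> lam n" using lam by blast
      have sn: "\<forall>\<^sub>F n in sequentially. s n \<le> n"
        using s_small by eventually_elim simp
      have s2: "(\<lambda>n. real (2 * s n) / real n * sqrt (real n)) \<longlonglongrightarrow> 0"
        using tendsto_mult_right_zero[OF s_sqrt_limit, of 2] by (simp add: mult.assoc)
      define g2 where "g2 n = (1 + tanh (B n / 2))\<^sup>2 / (1 + p0 n * (tanh (B n / 2))\<^sup>2 / (1 - p0 n))" for n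
      note D1 = degree_variance_limit[OF sn s_sqrt_limit gamma_one[OF C'(1) B] T']
        degree_mean_limit[OF sn s_sqrt_limit gamma_one[OF C'(1) B] T']
        degree_prob_bounds[OF sn s_sqrt_limit gamma_one[OF C'(1) B] T']
      note \<gamma>2 = gamma_two[OF C'(1) B, folded g2_def]
      note D2 = degree_variance_limit[OF s_small s2 \<gamma>2 T']
        degree_mean_limit[OF s_small s2 \<gamma>2 T']
        degree_prob_bounds[OF s_small s2 \<gamma>2 T']
      have up: "\<forall>\<^sub>F n in sequentially. exp (- (c1 / v * sqrt (ln (real n) / lam n)) * \<tau> n)
          * (1 - p0 n * (1 + tanh (B n / 2)) + p0 n * (1 + tanh (B n / 2)) * exp (c1 / v * sqrt (ln (real n) / lam n))) ^ (n - s n)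
        \<le> real n powr (- c1\<^sup>2 / (2 * v) + \<epsilon>)"
        unfolding c1_def
        by (rule chernoff_asymptotic[OF lam1 x0 _ v(1) D1(1)[folded v_def] D1(2)[folded \<tau>_def] \<epsilon>])
          (use D1(3) in eventually_elim, linarith)
      have low: "\<forall>\<^sub>F n in sequentially. exp (- (c2 / v * sqrt (ln (real n) / lam n)) * \<tau> n)
          * (1 - p0 n * g2 n + p0 n * g2 n * exp (c2 / v * sqrt (ln (real n) / lam n))) ^ (n - 2 * s n)
        \<le> real n powr (- c2\<^sup>2 / (2 * v) + \<epsilon>)"
        unfolding c2_def
        by (rule chernoff_asymptotic[OF lam1 x0 _ v(1) D2(1)[folded v_def] D2(2)[folded \<tau>_def] \<epsilon>])
          (use D2(3) in eventually_elim, linarith)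
      have chi: "\<forall>\<^sub>F n in sequentially. p0 n * (tanh (B n / 2))\<^sup>2 / (1 - p0 n) * real n \<le> (2 * q\<^sup>2 + \<epsilon>) * ln (real n)"
      proof -
        have "C' / (8 * (1 - \<theta>)) = 2 * q\<^sup>2"
          unfolding C'_def w(2)[symmetric] using w(1) by (simp add: power_mult_distrib)
        then have "\<forall>\<^sub>F n in sequentially. p0 n * (tanh (B n / 2))\<^sup>2 / (1 - p0 n) * real n / ln (real n) < 2 * q\<^sup>2 + \<epsilon>"
          using \<epsilon> by (intro order_tendstoD(2)[OF chi_limit[OF C'(1) B]]) simp
        then show ?thesis using eventually_ge_at_top[of 2]
        proof eventually_elim
          case (elim n)
          then have "0 < ln (real n)" by simp
          then show ?case using elim(1) by (simp add: pos_divide_less_eq)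
        qed
      qed
      define u where "u n = - (c2 / v * sqrt (ln (real n) / lam n))" for n
      define \<eta> where "\<eta> n = 2 * real n powr (1 - \<alpha> + (- (1 - q)\<^sup>2 + \<epsilon>))" for n
      show ?thesis
      proof (rule powerless_criterion[where B = B and u = u and \<tau> = \<tau> and \<eta> = \<eta> and k = k])
        show "\<forall>\<^sub>F n in sequentially. 0 < B n \<and> A n \<le> B n" by (rule AB)
        show "\<forall>\<^sub>F n in sequentially. p0 n * (tanh (B n / 2))\<^sup>2 / (1 - p0 n) * real n \<le> (2 * q\<^sup>2 + \<epsilon>) * ln (real n)" by (rule chi)
        show "k < 2 * \<alpha> - 1"
          using \<epsilon> unfolding k_def \<epsilon>_def by (simp add: power2_eq_square algebra_simps)
        have "(\<lambda>n. 2 * real n powr (1 - \<alpha> + (- (1 - q)\<^sup>2 + \<epsilon>))) \<longlonglongrightarrow> 2 * 0"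
          using \<epsilon> by (intro tendsto_intros powr_tendsto_zero) (simp add: \<epsilon>_def field_simps)
        then show "\<eta> \<longlonglongrightarrow> 0" by (simp add: \<eta>_def[abs_def])
        show "\<forall>\<^sub>F n in sequentially. 0 \<le> u n"
          using eventually_ge_at_top[of 1]
        proof eventually_elim
          case (elim n)
          have "0 < lam n" using lam elim by (auto intro: less_le_trans[OF zero_less_one])
          moreover have "c2 \<le> 0" using w q by (simp add: c mult_le_0_iff)
          ultimately have "c2 / v * sqrt (ln (real n) / lam n) \<le> 0"
            using v(1) elim by (intro mult_nonpos_nonneg divide_nonpos_pos) auto
          then show ?case by (simp only: u_def neg_0_le_iff_le)
        qed
        show "\<forall>\<^sub>F n in sequentially. exp (p0 n * (tanh (B n / 2))\<^sup>2 / (1 - p0 n) * real n) * (exp (u n * \<tau> n)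
         * (1 - p0 n * (1 + tanh (B n / 2))\<^sup>2 / (1 + p0 n * (tanh (B n / 2))\<^sup>2 / (1 - p0 n))
          + p0 n * (1 + tanh (B n / 2))\<^sup>2 / (1 + p0 n * (tanh (B n / 2))\<^sup>2 / (1 - p0 n)) * exp (- u n)) ^ (n - 2 * s n)) \<le> real n powr k"
          using chi low D2(3) eventually_ge_at_top[of 1]
        proof eventually_elim
          case (elim n)
          have p2: "p0 n * (1 + tanh (B n / 2))\<^sup>2 / (1 + p0 n * (tanh (B n / 2))\<^sup>2 / (1 - p0 n)) = p0 n * g2 n"
            by (simp add: g2_def)
          have "exp (p0 n * (tanh (B n / 2))\<^sup>2 / (1 - p0 n) * real n) \<le> exp ((2 * q\<^sup>2 + \<epsilon>) * ln (real n))"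
            using elim(1) by simp
          also have "\<dots> = real n powr (2 * q\<^sup>2 + \<epsilon>)" using elim(4) by (simp add: powr_def)
          finally have 1: "exp (p0 n * (tanh (B n / 2))\<^sup>2 / (1 - p0 n) * real n) \<le> real n powr (2 * q\<^sup>2 + \<epsilon>)" .
          have 2: "exp (u n * \<tau> n) * (1 - p0 n * g2 n + p0 n * g2 n * exp (- u n)) ^ (n - 2 * s n) \<le> real n powr (- (1 - 2 * q)\<^sup>2 + \<epsilon>)"
            using elim(2) unfolding e u_def by simp
          have 3: "0 \<le> 1 - p0 n * g2 n + p0 n * g2 n * exp (- u n)"
            using elim(3) by (intro add_nonneg_nonneg mult_nonneg_nonneg[OF _ exp_ge_zero]) linarith+
          have "real n powr k = real n powr (2 * q\<^sup>2 + \<epsilon>) * real n powr (- (1 - 2 * q)\<^sup>2 + \<epsilon>)"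
            unfolding k_def by (rule powr_add)
          moreover have "0 \<le> exp (u n * \<tau> n) * (1 - p0 n * g2 n + p0 n * g2 n * exp (- u n)) ^ (n - 2 * s n)"
            by (intro mult_nonneg_nonneg zero_le_power 3) simp
          ultimately show ?case unfolding p2 using mult_mono[OF 1 2] by simp
        qed
        show "\<forall>\<^sub>F n in sequentially. \<forall>S. S \<subseteq> {1..n} \<longrightarrow> card S = s n \<longrightarrow>
          measure_pmf.prob (bprod (edges n) (eprob n (lam n) (flat n S (B n))))
            (- {x. \<forall>i\<in>S. (\<Sum>e\<in>edge i ` ({1..n} - S). of_bool (x e)) \<le> \<tau> n}) \<le> \<eta> n"
          using up eventually_ge_at_top[of 1]
        proof eventually_elim
          case (elim n)
          have l: "0 < lam n" "lam n \<le> n" using lam elim by (auto intro: less_le_trans[OF zero_less_one])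
          define u1 where "u1 = c1 / v * sqrt (ln (real n) / lam n)"
          have u1: "0 \<le> u1" using v w q h l elim(2) by (simp add: u1_def c)
          show ?case
          proof (intro allI impI)
            fix S assume S: "S \<subseteq> {1..n}" "card S = s n"
            have "measure_pmf.prob (bprod (edges n) (eprob n (lam n) (flat n S (B n))))
                (- {x. \<forall>i\<in>S. (\<Sum>e\<in>edge i ` ({1..n} - S). of_bool (x e)) \<le> \<tau> n})
              \<le> s n * (exp (- u1 * \<tau> n) * (1 - p0 n * (1 + tanh (B n / 2)) + p0 n * (1 + tanh (B n / 2)) * exp u1) ^ (n - s n))"
              by (rule prob_truncation_le[OF l u1 S])
            also have "\<dots> \<le> s n * real n powr (- (1 - q)\<^sup>2 + \<epsilon>)"
              using elim(1) unfolding e u1_def by (intro mult_left_mono) auto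
            also have "\<dots> \<le> (2 * real n powr (1 - \<alpha>)) * real n powr (- (1 - q)\<^sup>2 + \<epsilon>)"
              using s_bounds[OF elim(2)] by (intro mult_right_mono) auto
            also have "\<dots> = \<eta> n" unfolding \<eta>_def powr_add by simp
            finally show "measure_pmf.prob (bprod (edges n) (eprob n (lam n) (flat n S (B n))))
                (- {x. \<forall>i\<in>S. (\<Sum>e\<in>edge i ` ({1..n} - S). of_bool (x e)) \<le> \<tau> n}) \<le> \<eta> n" .
          qed
        qed
      qed
    qed
  qed
qed

end

section \<open>The Higher Criticism test\<close>

text \<open>The centred coordinates are orthogonal with common squared norm P = p (1 - p). Bessel's
  inequality follows from E (P g - Y)^2 \<ge> 0, where Y / P is the projection of g.\<close>

lemma bessel_bprod:
  fixes p :: real and g :: "('e \<Rightarrow> bool) \<Rightarrow> real"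
  assumes E: "finite E" and M: "M \<subseteq> E" and p: "0 < p" "p < 1"
  shows "(\<Sum>e\<in>M. (measure_pmf.expectation (bprod E (\<lambda>_. p)) (\<lambda>x. g x * (of_bool (x e) - p)))\<^sup>2)
    \<le> p * (1 - p) * measure_pmf.expectation (bprod E (\<lambda>_. p)) (\<lambda>x. (g x)\<^sup>2)"
proof -
  let ?E = "measure_pmf.expectation (bprod E (\<lambda>_. p))"
  have fM: "finite M" using E M finite_subset by blast
  note [simp] = integrable_bprod[OF E]
  define P where "P = p * (1 - p)"
  have P: "P > 0" using p by (simp add: P_def)
  define y where "y e x = of_bool (x e) - p" for e and x :: "'e \<Rightarrow> bool"
  define c where "c e = ?E (\<lambda>x. g x * y e x)" for e
  define Y where "Y x = (\<Sum>e\<in>M. c e * y e x)" for x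
  have 1: "?E (\<lambda>x. g x * Y x) = (\<Sum>e\<in>M. (c e)\<^sup>2)"
  proof -
    have "(\<lambda>x. g x * Y x) = (\<lambda>x. \<Sum>e\<in>M. c e * (g x * y e x))"
      by (auto simp: Y_def sum_distrib_left ac_simps)
    then have "?E (\<lambda>x. g x * Y x) = (\<Sum>e\<in>M. c e * ?E (\<lambda>x. g x * y e x))"
      by (simp add: Bochner_Integration.integral_sum)
    then show ?thesis by (simp add: c_def power2_eq_square)
  qed
  have 2: "?E (\<lambda>x. (Y x)\<^sup>2) = P * (\<Sum>e\<in>M. (c e)\<^sup>2)"
  proof -
    have "(\<lambda>x. (Y x)\<^sup>2) = (\<lambda>x. \<Sum>e\<in>M. \<Sum>f\<in>M. c e * c f * (y e x * y f x))"
      by (auto simp: Y_def power2_eq_square sum_product ac_simps)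
    then have "?E (\<lambda>x. (Y x)\<^sup>2) = (\<Sum>e\<in>M. \<Sum>f\<in>M. c e * c f * ?E (\<lambda>x. y e x * y f x))"
      by (simp add: Bochner_Integration.integral_sum)
    also have "\<dots> = (\<Sum>e\<in>M. \<Sum>f\<in>M. if f = e then P * (c e)\<^sup>2 else 0)"
    proof (intro sum.cong refl)
      fix e f assume "e \<in> M" "f \<in> M"
      then have "?E (\<lambda>x. y e x * y f x) = (if e = f then P else 0)"
        unfolding y_def P_def using M p by (intro expectation_centered_mult E) auto
      then show "c e * c f * ?E (\<lambda>x. y e x * y f x) = (if f = e then P * (c e)\<^sup>2 else 0)"
        by (auto simp: power2_eq_square)
    qed
    also have "\<dots> = P * (\<Sum>e\<in>M. (c e)\<^sup>2)"
      using fM by (simp add: sum_distrib_left)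
    finally show ?thesis .
  qed
  have "0 \<le> ?E (\<lambda>x. (P * g x - Y x)\<^sup>2)" by simp
  also have "(\<lambda>x. (P * g x - Y x)\<^sup>2) = (\<lambda>x. P\<^sup>2 * (g x)\<^sup>2 - 2 * P * (g x * Y x) + (Y x)\<^sup>2)"
    by (auto simp: power2_eq_square algebra_simps)
  also have "?E \<dots> = P\<^sup>2 * ?E (\<lambda>x. (g x)\<^sup>2) - 2 * P * (\<Sum>e\<in>M. (c e)\<^sup>2) + P * (\<Sum>e\<in>M. (c e)\<^sup>2)"
    by (simp add: 1 2)
  finally have "P * (\<Sum>e\<in>M. (c e)\<^sup>2) \<le> P * (P * ?E (\<lambda>x. (g x)\<^sup>2))"
    by (simp add: power2_eq_square algebra_simps)
  then have "(\<Sum>e\<in>M. (c e)\<^sup>2) \<le> P * ?E (\<lambda>x. (g x)\<^sup>2)" using P by simp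
  then show ?thesis unfolding c_def y_def P_def .
qed

text \<open>Conditionally on the one shared coordinate \<open>e\<close> the two functions are independent.\<close>
lemma expectation_mult_shared_coord:
  fixes p :: real and f g :: "('e \<Rightarrow> bool) \<Rightarrow> real"
  assumes E: "finite E" and e: "e \<in> E" and p: "0 < p" "p < 1"
    and f: "depends_on f (insert e A)" and g: "depends_on g (insert e B)"
    and AB: "A \<inter> B = {}" "e \<notin> A" "e \<notin> B"
    and zero: "measure_pmf.expectation (bprod E (\<lambda>_. p)) f = 0" "measure_pmf.expectation (bprod E (\<lambda>_. p)) g = 0"
  shows "p * (1 - p) * measure_pmf.expectation (bprod E (\<lambda>_. p)) (\<lambda>x. f x * g x)
    = measure_pmf.expectation (bprod E (\<lambda>_. p)) (\<lambda>x. f x * (of_bool (x e) - p))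
      * measure_pmf.expectation (bprod E (\<lambda>_. p)) (\<lambda>x. g x * (of_bool (x e) - p))"
proof -
  let ?E = "measure_pmf.expectation (bprod E (\<lambda>_. p))"
  note [simp] = integrable_bprod[OF E]
  define b where "b x = (of_bool (x e) :: real)" for x :: "'e \<Rightarrow> bool"
  \<comment> \<open>Any h equals \<open>lo h + b * df h\<close>, where \<open>lo h\<close> and
    \<open>df h\<close> ignore the coordinate e. A mean of zero forces E (lo h) = - p E (df h), so
    only the means of the differences survive.\<close>
  define lo where "lo h x = h (x(e := False))" for h :: "('e \<Rightarrow> bool) \<Rightarrow> real" and x
  define df where "df h x = h (x(e := True)) - h (x(e := False))" for h :: "('e \<Rightarrow> bool) \<Rightarrow> real" and x
  have split: "h x = lo h x + b x * df h x" for h :: "('e \<Rightarrow> bool) \<Rightarrow> real" and x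
  proof (cases "x e")
    case True
    then have "x(e := True) = x" by (simp add: fun_upd_idem)
    then show ?thesis using True by (simp add: lo_def df_def b_def)
  next
    case False
    then have "x(e := False) = x" by (simp add: fun_upd_idem)
    then show ?thesis using False by (simp add: lo_def df_def b_def)
  qed
  have bb: "b x * b x = b x" for x by (simp add: b_def)
  have dep: "depends_on (lo h) A" "depends_on (df h) A" if "depends_on h (insert e A)" for h A
  proof -
    have *: "h (x(e := c)) = h (y(e := c))" if "\<forall>e\<in>A. x e = y e" for x y c
      by (rule \<open>depends_on h (insert e A)\<close>[unfolded depends_on_def, rule_format]) (use that in auto)
    show "depends_on (lo h) A"
      unfolding depends_on_def lo_def by (intro allI impI *)
    show "depends_on (df h) A"
      unfolding depends_on_def df_def by (intro allI impI arg_cong2[of _ _ _ _ "(-)"] *)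
  qed
  have db: "depends_on b {e}" by (simp add: depends_on_def b_def)
  have Eb: "?E b = p"
    unfolding b_def using expectation_bprod_coord[OF E e, of "\<lambda>_. p" of_bool] p by simp
  have mb: "?E (\<lambda>x. b x * h x) = p * ?E h" if "depends_on h C" "e \<notin> C" for h C
    using expectation_mult_depends_on[OF E db that(1), of "\<lambda>_. p"] that(2) Eb by simp
  define u v U V where "u = ?E (lo f)" and "v = ?E (df f)" and "U = ?E (lo g)" and "V = ?E (df g)"
  have E1: "?E h = ?E (lo h) + p * ?E (df h)" if "depends_on h (insert e A)" "e \<notin> A" for h A
  proof -
    have "?E h = ?E (\<lambda>x. lo h x + b x * df h x)"
      by (rule Bochner_Integration.integral_cong[OF refl split])
    then show ?thesis using mb[OF dep(2)[OF that(1)] that(2)] by simp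
  qed
  have E2: "?E (\<lambda>x. h x * (of_bool (x e) - p)) = p * (1 - p) * ?E (df h)"
    if "depends_on h (insert e A)" "e \<notin> A" "?E h = 0" for h A
  proof -
    have "?E (\<lambda>x. h x * (of_bool (x e) - p)) = ?E (\<lambda>x. b x * lo h x + b x * df h x - p * h x)"
    proof (rule Bochner_Integration.integral_cong[OF refl])
      fix x
      have "h x * b x = (lo h x + b x * df h x) * b x"
        using split[of h x] by simp
      then have "h x * b x = b x * lo h x + (b x * b x) * df h x"
        by (simp add: algebra_simps)
      then show "h x * (of_bool (x e) - p) = b x * lo h x + b x * df h x - p * h x"
        unfolding bb by (simp add: b_def algebra_simps)
    qed
    also have "\<dots> = p * ?E (lo h) + p * ?E (df h)"
      using mb[OF dep(1)[OF that(1)] that(2)] mb[OF dep(2)[OF that(1)] that(2)] that(3) by simp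
    also have "?E (lo h) = - p * ?E (df h)"
      using E1[OF that(1,2)] that(3) by simp
    finally show ?thesis by (simp add: algebra_simps)
  qed
  have dAB: "depends_on (\<lambda>x. h x * k x) (A \<union> B)" if "depends_on h A" "depends_on k B" for h k :: "('e \<Rightarrow> bool) \<Rightarrow> real"
    using that unfolding depends_on_def by (metis UnCI)
  note mult = expectation_mult_depends_on[OF E _ _ AB(1), of _ _ "\<lambda>_. p"]
  note df = dep[OF f] note dg = dep[OF g]
  have nAB: "e \<notin> A \<union> B" using AB by simp
  have "?E (\<lambda>x. f x * g x) = ?E (\<lambda>x. lo f x * lo g x + b x * (lo f x * df g x) + b x * (df f x * lo g x) + b x * (df f x * df g x))"
  proof (rule Bochner_Integration.integral_cong[OF refl])
    fix x
    have "f x * g x = (lo f x + b x * df f x) * (lo g x + b x * df g x)"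
      using split[of f x] split[of g x] by simp
    also have "\<dots> = lo f x * lo g x + b x * (lo f x * df g x) + b x * (df f x * lo g x) + (b x * b x) * (df f x * df g x)"
      by (simp add: algebra_simps)
    finally show "f x * g x = lo f x * lo g x + b x * (lo f x * df g x) + b x * (df f x * lo g x) + b x * (df f x * df g x)"
      unfolding bb .
  qed
  also have "\<dots> = u * U + p * (u * V) + p * (v * U) + p * (v * V)"
    by (simp add: mb[OF dAB[OF df(1) dg(2)] nAB] mb[OF dAB[OF df(2) dg(1)] nAB] mb[OF dAB[OF df(2) dg(2)] nAB]
        mult[OF df(1) dg(1)] mult[OF df(1) dg(2)] mult[OF df(2) dg(1)] mult[OF df(2) dg(2)] u_def v_def U_def V_def)
  finally have fg: "?E (\<lambda>x. f x * g x) = u * U + p * (u * V) + p * (v * U) + p * (v * V)" .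
  have u: "u = - p * v" "U = - p * V"
    using E1[OF f AB(2)] E1[OF g AB(3)] zero by (simp_all add: u_def v_def U_def V_def)
  have "p * (1 - p) * ?E (\<lambda>x. f x * g x) = (p * (1 - p) * v) * (p * (1 - p) * V)"
    unfolding fg u by (simp add: algebra_simps)
  then show ?thesis
    unfolding E2[OF f AB(2) zero(1)] E2[OF g AB(3) zero(2)] v_def V_def .
qed

section \<open>Variance of vertex sums under the null law\<close>

definition star :: "nat \<Rightarrow> nat \<Rightarrow> (nat \<times> nat) set" where
  "star n i = edge i ` ({1..n} - {i})"

lemma star_edges: "i \<in> {1..n} \<Longrightarrow> star n i \<subseteq> edges n"
  unfolding star_def by (intro image_subsetI edge_in_edges) auto

lemma edge_commute: "edge i j = edge j i"
  by (simp add: edge_def min.commute max.commute)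

lemma star_Int:
  assumes "i \<noteq> j" shows "(star n i - {edge i j}) \<inter> (star n j - {edge i j}) = {}"
  using assms by (auto simp: star_def edge_def min_def max_def split: if_splits)

lemma edge_in_star: "j \<in> {1..n} \<Longrightarrow> i \<noteq> j \<Longrightarrow> edge i j \<in> star n i"
  unfolding star_def by auto

text \<open>The covariance of two vertex statistics is the product of their correlations with the shared edge,
  so Bessel's inequality absorbs all covariances into the variances.\<close>
lemma variance_vertex_sum_le:
  fixes p :: real and g :: "nat \<Rightarrow> (nat \<times> nat \<Rightarrow> bool) \<Rightarrow> real"
  assumes p: "0 < p" "p < 1"
    and dep: "\<And>i. i \<in> {1..n} \<Longrightarrow> depends_on (g i) (star n i)"
    and zero: "\<And>i. i \<in> {1..n} \<Longrightarrow> measure_pmf.expectation (bprod (edges n) (\<lambda>_. p)) (g i) = 0"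
  shows "measure_pmf.expectation (bprod (edges n) (\<lambda>_. p)) (\<lambda>x. (\<Sum>i\<in>{1..n}. g i x)\<^sup>2)
    \<le> 2 * (\<Sum>i\<in>{1..n}. measure_pmf.expectation (bprod (edges n) (\<lambda>_. p)) (\<lambda>x. (g i x)\<^sup>2))"
proof -
  let ?E = "measure_pmf.expectation (bprod (edges n) (\<lambda>_. p))"
  note [simp] = integrable_bprod[OF finite_edges]
  define P where "P = p * (1 - p)"
  have P: "P > 0" using p by (simp add: P_def)
  define c where "c i j = ?E (\<lambda>x. g i x * (of_bool (x (edge i j)) - p))" for i j
  \<comment> \<open>\<open>c i j\<close> correlates the statistic of vertex i with the edge to j.
    The arithmetic-geometric mean separates the two vertices, so that for fixed i Bessel's
    inequality applies to the sum over j.\<close>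
  have cov: "P * ?E (\<lambda>x. g i x * g j x) \<le> ((c i j)\<^sup>2 + (c j i)\<^sup>2) / 2"
    if ij: "i \<in> {1..n}" "j \<in> {1..n}" "i \<noteq> j" for i j
  proof -
    let ?e = "edge i j"
    have i: "insert ?e (star n i - {?e}) = star n i" and j: "insert ?e (star n j - {?e}) = star n j"
      using edge_in_star[of j n i] edge_in_star[of i n j] ij by (auto simp: edge_commute[of j i])
    have "P * ?E (\<lambda>x. g i x * g j x) = c i j * c j i"
      unfolding P_def c_def edge_commute[of j i]
    proof (rule expectation_mult_shared_coord[where A = "star n i - {?e}" and B = "star n j - {?e}"])
      show "depends_on (g i) (insert ?e (star n i - {?e}))" unfolding i by (rule dep[OF ij(1)])
      show "depends_on (g j) (insert ?e (star n j - {?e}))" unfolding j by (rule dep[OF ij(2)])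
      show "?e \<in> edges n" by (rule edge_in_edges[OF ij])
      show "(star n i - {?e}) \<inter> (star n j - {?e}) = {}" by (rule star_Int[OF ij(3)])
    qed (use ij p zero in auto)
    also have "\<dots> \<le> ((c i j)\<^sup>2 + (c j i)\<^sup>2) / 2"
      using sum_squares_bound[of "c i j" "c j i"] by simp
    finally show ?thesis .
  qed
  have bes: "(\<Sum>j\<in>{1..n} - {i}. (c i j)\<^sup>2) \<le> P * ?E (\<lambda>x. (g i x)\<^sup>2)" if "i \<in> {1..n}" for i
  proof -
    have "(\<Sum>j\<in>{1..n} - {i}. (c i j)\<^sup>2) = (\<Sum>e\<in>star n i. (?E (\<lambda>x. g i x * (of_bool (x e) - p)))\<^sup>2)"
      unfolding star_def by (subst sum.reindex) (auto simp: inj_on_edge c_def)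
    also have "\<dots> \<le> P * ?E (\<lambda>x. (g i x)\<^sup>2)"
      unfolding P_def by (intro bessel_bprod finite_edges star_edges that p)
    finally show ?thesis .
  qed
  have off: "(\<Sum>i\<in>{1..n}. \<Sum>j\<in>{1..n} - {i}. h i j) = (\<Sum>i\<in>{1..n}. \<Sum>j\<in>{1..n} - {i}. h j i)"
    for h :: "nat \<Rightarrow> nat \<Rightarrow> real"
  proof -
    have "(\<Sum>i\<in>{1..n}. \<Sum>j\<in>{1..n} - {i}. h i j) = (\<Sum>i\<in>{1..n}. \<Sum>j\<in>{1..n}. if j \<noteq> i then h i j else 0)" for h :: "nat \<Rightarrow> nat \<Rightarrow> real"
      by (intro sum.cong refl sum.mono_neutral_cong_left) auto
    note * = this
    show ?thesis unfolding * by (subst sum.swap) (auto intro!: sum.cong)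
  qed
  have "P * ?E (\<lambda>x. (\<Sum>i\<in>{1..n}. g i x)\<^sup>2) = (\<Sum>i\<in>{1..n}. \<Sum>j\<in>{1..n}. P * ?E (\<lambda>x. g i x * g j x))"
  proof -
    have "(\<lambda>x. (\<Sum>i\<in>{1..n}. g i x)\<^sup>2) = (\<lambda>x. \<Sum>i\<in>{1..n}. \<Sum>j\<in>{1..n}. g i x * g j x)"
      by (auto simp: power2_eq_square sum_product)
    then show ?thesis by (simp add: Bochner_Integration.integral_sum sum_distrib_left)
  qed
  also have "\<dots> = (\<Sum>i\<in>{1..n}. P * ?E (\<lambda>x. (g i x)\<^sup>2) + (\<Sum>j\<in>{1..n} - {i}. P * ?E (\<lambda>x. g i x * g j x)))"
    by (intro sum.cong refl) (simp add: sum.remove power2_eq_square)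
  also have "\<dots> = (\<Sum>i\<in>{1..n}. P * ?E (\<lambda>x. (g i x)\<^sup>2)) + (\<Sum>i\<in>{1..n}. \<Sum>j\<in>{1..n} - {i}. P * ?E (\<lambda>x. g i x * g j x))"
    by (rule sum.distrib)
  also have "(\<Sum>i\<in>{1..n}. \<Sum>j\<in>{1..n} - {i}. P * ?E (\<lambda>x. g i x * g j x))
      \<le> (\<Sum>i\<in>{1..n}. \<Sum>j\<in>{1..n} - {i}. ((c i j)\<^sup>2 + (c j i)\<^sup>2) / 2)"
    by (intro sum_mono cov) auto
  also have "\<dots> = (\<Sum>i\<in>{1..n}. \<Sum>j\<in>{1..n} - {i}. (c i j)\<^sup>2)"
  proof -
    have "(\<Sum>i\<in>{1..n}. \<Sum>j\<in>{1..n} - {i}. ((c i j)\<^sup>2 + (c j i)\<^sup>2) / 2)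
      = ((\<Sum>i\<in>{1..n}. \<Sum>j\<in>{1..n} - {i}. (c i j)\<^sup>2) + (\<Sum>i\<in>{1..n}. \<Sum>j\<in>{1..n} - {i}. (c j i)\<^sup>2)) / 2"
      by (simp only: sum_divide_distrib[symmetric] sum.distrib)
    then show ?thesis using off[of "\<lambda>i j. (c j i)\<^sup>2"] by simp
  qed
  also have "\<dots> \<le> (\<Sum>i\<in>{1..n}. P * ?E (\<lambda>x. (g i x)\<^sup>2))"
    by (intro sum_mono bes)
  finally have "P * ?E (\<lambda>x. (\<Sum>i\<in>{1..n}. g i x)\<^sup>2) \<le> P * (2 * (\<Sum>i\<in>{1..n}. ?E (\<lambda>x. (g i x)\<^sup>2)))"
    by (simp add: sum_distrib_left[symmetric])
  then show ?thesis using P by simp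
qed

text \<open>Pairwise independent indicators have variance at most their mean M, and Chebyshev at
  distance M / 2 gives 4 / M.\<close>

lemma pairwise_independent_lower_tail:
  fixes P :: "'a pmf" and A :: "'i \<Rightarrow> 'a set"
  assumes P: "finite (set_pmf P)" and I: "finite I"
    and ind: "\<And>i j. i \<in> I \<Longrightarrow> j \<in> I \<Longrightarrow> i \<noteq> j \<Longrightarrow> measure_pmf.expectation P (\<lambda>x. of_bool (x \<in> A i) * of_bool (x \<in> A j))
      = measure_pmf.prob P (A i) * measure_pmf.prob P (A j)"
    and m: "m \<le> (\<Sum>i\<in>I. measure_pmf.prob P (A i))" "0 < m"
  shows "measure_pmf.prob P {x. (\<Sum>i\<in>I. of_bool (x \<in> A i)) \<le> m / 2} \<le> 4 / m"
proof -
  let ?E = "measure_pmf.expectation P"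
  have int [simp]: "integrable (measure_pmf P) f" for f :: "'a \<Rightarrow> real"
    by (rule integrable_measure_pmf_finite[OF P])
  define Z where "Z x = (\<Sum>i\<in>I. of_bool (x \<in> A i) :: real)" for x
  define q where "q i = measure_pmf.prob P (A i)" for i
  define M where "M = (\<Sum>i\<in>I. q i)"
  have M: "m \<le> M" "0 < M" using m by (auto simp: M_def q_def)
  have EZ: "?E Z = M"
    by (simp add: Z_def[abs_def] M_def q_def prob_eq_expectation Bochner_Integration.integral_sum)
  have "?E (\<lambda>x. (Z x)\<^sup>2) = (\<Sum>i\<in>I. \<Sum>j\<in>I. ?E (\<lambda>x. of_bool (x \<in> A i) * of_bool (x \<in> A j)))"
    by (simp add: Z_def power2_eq_square sum_product Bochner_Integration.integral_sum)
  also have "\<dots> \<le> (\<Sum>i\<in>I. \<Sum>j\<in>I. q i * q j + (if i = j then q i else 0))"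
  proof (intro sum_mono)
    fix i j assume ij: "i \<in> I" "j \<in> I"
    show "?E (\<lambda>x. of_bool (x \<in> A i) * of_bool (x \<in> A j)) \<le> q i * q j + (if i = j then q i else 0)"
    proof (cases "i = j")
      case True
      have "?E (\<lambda>x. of_bool (x \<in> A i) * of_bool (x \<in> A i)) = ?E (\<lambda>x. of_bool (x \<in> A i) :: real)"
        by (intro Bochner_Integration.integral_cong) auto
      then show ?thesis using True by (simp add: q_def prob_eq_expectation[symmetric])
    next
      case False
      then show ?thesis using ind[OF ij] by (simp add: q_def)
    qed
  qed
  also have "\<dots> = M\<^sup>2 + M"
    using I by (simp add: sum.distrib M_def power2_eq_square sum_product)
  finally have E2: "?E (\<lambda>x. (Z x)\<^sup>2) \<le> M\<^sup>2 + M" .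
  have "measure_pmf.prob P {x. Z x \<le> m / 2} \<le> measure_pmf.prob P {x \<in> space (measure_pmf P). M / 2 \<le> \<bar>Z x - ?E Z\<bar>}"
  proof (rule measure_pmf.finite_measure_mono)
    show "{x. Z x \<le> m / 2} \<subseteq> {x \<in> space (measure_pmf P). M / 2 \<le> \<bar>Z x - ?E Z\<bar>}"
      using M unfolding EZ by auto
  qed simp
  also have "\<dots> \<le> measure_pmf.variance P Z / (M / 2)\<^sup>2"
    using M by (intro measure_pmf.Chebyshev_inequality) auto
  also have "measure_pmf.variance P Z \<le> M"
    using E2 measure_pmf.variance_eq[of P Z] by (simp add: EZ)
  then have "measure_pmf.variance P Z / (M / 2)\<^sup>2 \<le> M / (M / 2)\<^sup>2"
    by (intro divide_right_mono) auto
  also have "\<dots> = 4 / M" using M by (simp add: power2_eq_square field_simps)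
  also have "\<dots> \<le> 4 / m" using M m by (intro divide_left_mono) auto
  finally show ?thesis unfolding Z_def .
qed

section \<open>The grid and the null law of the statistic\<close>

lemma HC_grid_subset:
  assumes n: "n \<ge> 2"
  shows "HC_grid n \<subseteq> real ` {1..nat \<lfloor>sqrt (10 * ln (real n))\<rfloor>}"
proof
  fix t assume "t \<in> HC_grid n"
  then obtain r k where r: "t = sqrt (2 * r * ln (real n))" "0 < r" "r < 5" and k: "t = real k"
    unfolding HC_grid_def by (auto elim!: Nats_cases)
  have l: "0 < ln (real n)" using n by simp
  then have "0 < t" "t \<le> sqrt (10 * ln (real n))" using r by auto
  then have "1 \<le> k" "k \<le> nat \<lfloor>sqrt (10 * ln (real n))\<rfloor>" using k by (auto simp: le_nat_floor)
  then show "t \<in> real ` {1..nat \<lfloor>sqrt (10 * ln (real n))\<rfloor>}" using k by auto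
qed

lemma finite_HC_grid: "n \<ge> 2 \<Longrightarrow> finite (HC_grid n)"
  by (rule finite_subset[OF HC_grid_subset]) auto

lemma card_HC_grid_le:
  assumes n: "n \<ge> 2" shows "real (card (HC_grid n)) \<le> sqrt (10 * ln (real n))"
proof -
  have "card (HC_grid n) \<le> card (real ` {1..nat \<lfloor>sqrt (10 * ln (real n))\<rfloor>})"
    by (intro card_mono HC_grid_subset n) auto
  also have "\<dots> \<le> nat \<lfloor>sqrt (10 * ln (real n))\<rfloor>"
    using card_image_le[of "{1..nat \<lfloor>sqrt (10 * ln (real n))\<rfloor>}" real] by simp
  finally have "real (card (HC_grid n)) \<le> real (nat \<lfloor>sqrt (10 * ln (real n))\<rfloor>)" by simp
  also have "\<dots> \<le> sqrt (10 * ln (real n))"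
    using n by (intro of_nat_floor) auto
  finally show ?thesis .
qed

lemma integrable_beta_law [simp]:
  fixes f :: "_ \<Rightarrow> real" shows "integrable (measure_pmf (beta_law n lam \<beta>)) f"
  by (rule integrable_measure_pmf_finite) (simp add: beta_law_eq finite_set_bprod)

lemma expectation_HC_at: "measure_pmf.expectation (null_law n lam) (HC_at n lam t) = 0"
proof -
  have "measure_pmf.expectation (null_law n lam) (\<lambda>Y. of_bool (std_deg n lam Y i > t))
      = measure_pmf.prob (null_law n lam) {Y. std_deg n lam Y i > t}" for i
    by (simp add: prob_eq_expectation)
  then show ?thesis
    unfolding HC_at_def by (simp add: Bochner_Integration.integral_sum)
qed

lemma null_HC_at_tail:
  assumes h: "0 < h" and v: "0 < measure_pmf.variance (null_law n lam) (HC_at n lam t)"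
  shows "measure_pmf.prob (null_law n lam)
    {Y. h * sqrt (measure_pmf.variance (null_law n lam) (HC_at n lam t)) \<le> \<bar>HC_at n lam t Y\<bar>} \<le> 1 / h\<^sup>2"
proof -
  let ?v = "measure_pmf.variance (null_law n lam) (HC_at n lam t)"
  have "measure_pmf.prob (null_law n lam) {Y \<in> space (measure_pmf (null_law n lam)).
      h * sqrt ?v \<le> \<bar>HC_at n lam t Y - measure_pmf.expectation (null_law n lam) (HC_at n lam t)\<bar>}
    \<le> ?v / (h * sqrt ?v)\<^sup>2"
    using h v by (intro measure_pmf.Chebyshev_inequality) auto
  also have "(h * sqrt ?v)\<^sup>2 = h\<^sup>2 * ?v" using v by (simp add: power_mult_distrib)
  also have "?v / (h\<^sup>2 * ?v) = 1 / h\<^sup>2"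
  proof -
    have "w / (h\<^sup>2 * w) = 1 / h\<^sup>2" if "0 < w" for w using that by simp
    then show ?thesis using v by blast
  qed
  finally show ?thesis by (simp add: expectation_HC_at)
qed

text \<open>The integer grid has only O (sqrt (log n)) points, so a union bound over Chebyshev
  estimates is affordable.\<close>

lemma null_HC_le:
  assumes n: "n \<ge> 2" and h: "0 < h" and ne: "HC_grid n \<noteq> {}"
  shows "measure_pmf.prob (null_law n lam) {Y. HC n lam Y > h} \<le> sqrt (10 * ln (real n)) / h\<^sup>2"
proof -
  let ?P = "null_law n lam"
  have "{Y. HC n lam Y > h} \<subseteq> (\<Union>t\<in>HC_grid n. {Y. GHC n lam t Y > h})"
    using less_cSUP_iff[OF ne, of "\<lambda>t. GHC n lam t _" h] finite_HC_grid[OF n]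
    unfolding HC_def by auto
  then have "measure_pmf.prob ?P {Y. HC n lam Y > h} \<le> measure_pmf.prob ?P (\<Union>t\<in>HC_grid n. {Y. GHC n lam t Y > h})"
    by (intro measure_pmf.finite_measure_mono) auto
  also have "\<dots> \<le> (\<Sum>t\<in>HC_grid n. measure_pmf.prob ?P {Y. GHC n lam t Y > h})"
    by (intro measure_pmf.finite_measure_subadditive_finite finite_HC_grid n) auto
  also have "\<dots> \<le> (\<Sum>t\<in>HC_grid n. 1 / h\<^sup>2)"
  proof (intro sum_mono)
    fix t
    let ?v = "measure_pmf.variance ?P (HC_at n lam t)"
    have v0: "0 \<le> ?v" by (rule measure_pmf.variance_positive)
    show "measure_pmf.prob ?P {Y. GHC n lam t Y > h} \<le> 1 / h\<^sup>2"
    proof (cases "?v = 0")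
      case True
      \<comment> \<open>With zero variance the quotient is a division by zero, whose value 0 is
        below h.\<close>
      then have "{Y. GHC n lam t Y > h} = {}" using h by (auto simp: GHC_def)
      then show ?thesis by simp
    next
      case False
      with v0 have v: "0 < ?v" by linarith
      have "measure_pmf.prob ?P {Y. GHC n lam t Y > h} \<le> measure_pmf.prob ?P {Y. h * sqrt ?v \<le> \<bar>HC_at n lam t Y\<bar>}"
      proof (intro measure_pmf.finite_measure_mono subsetI CollectI)
        fix Y assume "Y \<in> {Y. GHC n lam t Y > h}"
        then have "h < HC_at n lam t Y / sqrt ?v" by (simp add: GHC_def)
        then have "h * sqrt ?v < HC_at n lam t Y"
          using v by (simp only: pos_less_divide_eq real_sqrt_gt_zero)
        then show "h * sqrt ?v \<le> \<bar>HC_at n lam t Y\<bar>" by linarith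
      qed simp
      also have "\<dots> \<le> 1 / h\<^sup>2" by (rule null_HC_at_tail[OF h v])
      finally show ?thesis .
    qed
  qed
  also have "\<dots> = real (card (HC_grid n)) / h\<^sup>2" by simp
  also have "\<dots> \<le> sqrt (10 * ln (real n)) / h\<^sup>2"
    by (intro divide_right_mono card_HC_grid_le n) auto
  finally show ?thesis .
qed

section \<open>Rejection under the alternative\<close>

definition exceeds :: "nat \<Rightarrow> real \<Rightarrow> nat \<Rightarrow> (nat \<times> nat \<Rightarrow> bool) \<Rightarrow> bool" where
  "exceeds n \<tau> i x \<longleftrightarrow> \<tau> < (\<Sum>e\<in>star n i. of_bool (x e))"

lemma exceeds_mono: "exceeds n \<tau> i x \<Longrightarrow> (\<And>e. x e \<longrightarrow> y e) \<Longrightarrow> exceeds n \<tau> i y"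
  unfolding exceeds_def by (erule less_le_trans) (intro sum_mono, auto)

lemma std_deg_greater_iff:
  assumes n: "n \<ge> 2" and lam: "0 < lam" "lam \<le> n"
  shows "std_deg n lam (adj x) i > t \<longleftrightarrow>
    exceeds n (lam / (2 * real n) * (real n - 1) + t * sqrt ((real n - 1) * (lam / (2 * real n)) * (1 - lam / (2 * real n)))) i x"
proof -
  have "lam / (2 * real n) > 0" "lam / (2 * real n) < 1" using n lam by (auto simp: field_simps)
  then have "sqrt ((real n - 1) * (lam / (2 * real n)) * (1 - lam / (2 * real n))) > 0"
    using n by (intro real_sqrt_gt_zero mult_pos_pos) auto
  then show ?thesis
    unfolding std_deg_def exceeds_def star_def deg_adj[symmetric]
    by (simp only: pos_less_divide_eq less_diff_eq add.commute)
qed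

lemma eprob_ge_null:
  assumes "0 \<le> lam" "\<beta> \<in> Xi n s A" "e \<in> edges n"
  shows "lam / (2 * real n) \<le> eprob n lam \<beta> e"
proof -
  have "0 \<le> \<beta> (fst e)" "0 \<le> \<beta> (snd e)" using assms by (auto simp: Xi_def edges_def PiE_def Pi_def)
  then have "lam / (2 * real n) * 1 \<le> lam / (2 * real n) * (1 + tanh ((\<beta> (fst e) + \<beta> (snd e)) / 2))"
    using assms(1) by (intro mult_left_mono) auto
  then show ?thesis using eprob_eq_tanh[of n lam \<beta> "fst e" "snd e"] by simp
qed

lemma eprob_ge_signal:
  assumes "0 \<le> lam" "\<beta> \<in> Xi n s A" "i \<in> supp n \<beta>" "j \<in> {1..n}" "B \<le> A"
  shows "lam / (2 * real n) * (1 + tanh (B / 2)) \<le> eprob n lam \<beta> (edge i j)"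
proof -
  have ij: "B \<le> \<beta> i" "0 \<le> \<beta> j" using assms by (auto simp: Xi_def PiE_def Pi_def)
  have "eprob n lam \<beta> (edge i j) = lam / (2 * real n) * (1 + tanh ((\<beta> i + \<beta> j) / 2))"
    by (cases "i \<le> j") (simp_all add: edge_def eprob_eq_tanh min_def max_def add.commute)
  moreover have "tanh (B / 2) \<le> tanh ((\<beta> i + \<beta> j) / 2)"
    using ij by (subst tanh_real_le_iff) auto
  ultimately show ?thesis using assms(1) by (simp only: mult_left_mono add_left_mono divide_nonneg_nonneg)
qed

text \<open>At a fixed threshold the statistic splits into counts off and on the support. Here q
  bounds from below the exceedance probability of a support vertex, \<open>Pbar\<close> bounds the
  null one from above, and \<open>big\<close> says that the expected signal s q outweighs h null
  standard deviations.\<close>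

lemma nonrejection_bound:
  fixes A B lam h q Pbar t :: real and n s :: nat and \<beta> :: "nat \<Rightarrow> real"
  defines "p0 \<equiv> lam / (2 * real n)"
  defines "pB \<equiv> p0 * (1 + tanh (B / 2))"
  defines "\<tau> \<equiv> p0 * (real n - 1) + t * sqrt ((real n - 1) * p0 * (1 - p0))"
  assumes n: "n \<ge> 2" and s: "1 \<le> s" "s \<le> n" and lam: "0 < lam" "lam \<le> n" and B: "0 < B" "B \<le> A"
    and h: "0 < h" and t: "0 \<le> t"
    and Pbar: "\<And>i. i \<in> {1..n} \<Longrightarrow> measure_pmf.prob (bprod (edges n) (\<lambda>_. p0)) {x. exceeds n \<tau> i x} \<le> Pbar"
    and q0: "0 < q" and q: "\<And>M. M \<subseteq> edges n \<Longrightarrow> card M = n - s \<Longrightarrow>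
      q \<le> measure_pmf.prob (bprod M (\<lambda>_. pB)) {x. \<tau> < (\<Sum>e\<in>M. of_bool (x e))}"
    and big: "8 * h * sqrt (2 * n * Pbar) \<le> s * q"
    and \<beta>: "\<beta> \<in> Xi n s A"
  shows "measure_pmf.prob (beta_law n lam \<beta>) {Y. GHC n lam t Y \<le> h} \<le> 4 / (s * q) + (1 / h\<^sup>2 + 4 * Pbar / q)"
proof -
  let ?E = "edges n"
  let ?P0 = "bprod ?E (\<lambda>_. p0)"
  define S where "S = supp n \<beta>"
  have S: "S \<subseteq> {1..n}" "card S = s" "finite S" using \<beta> by (auto simp: S_def supp_def Xi_def)
  have p0: "0 < p0" "p0 < 1" "p0 \<le> 1 / 2" using n lam by (auto simp: p0_def field_simps)
  have tB: "0 < tanh (B / 2)" "tanh (B / 2) < 1" using B tanh_real_lt_1[of "B / 2"] by auto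
  have pB: "0 < pB" "pB < 1"
  proof -
    show "0 < pB" unfolding pB_def using p0 tB by (intro mult_pos_pos add_pos_pos) auto
    have "pB < p0 * 2" unfolding pB_def using p0 tB by (intro mult_strict_left_mono) auto
    then show "pB < 1" using p0 by simp
  qed
  have null: "null_law n lam = map_pmf adj ?P0" unfolding beta_law_eq eprob_zero p0_def ..
  have \<tau>0: "0 \<le> \<tau>" unfolding \<tau>_def using p0 n t by (intro add_nonneg_nonneg mult_nonneg_nonneg) auto
  have sd: "std_deg n lam (adj x) i > t \<longleftrightarrow> exceeds n \<tau> i x" for x i
    unfolding \<tau>_def p0_def by (rule std_deg_greater_iff[OF n lam])
  define X where "X i x = (of_bool (exceeds n \<tau> i x) :: real)" for i x
  define P where "P i = measure_pmf.prob ?P0 {x. exceeds n \<tau> i x}" for i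
  have P_eq: "measure_pmf.prob (null_law n lam) {Y. std_deg n lam Y i > t} = P i" for i
    unfolding null P_def by (simp add: vimage_def sd)
  have HC: "HC_at n lam t (adj x) = (\<Sum>i\<in>{1..n}. X i x - P i)" for x
    unfolding HC_at_def P_eq sd X_def ..
  have EX: "measure_pmf.expectation ?P0 (X i) = P i" for i
    unfolding X_def[abs_def] P_def by (simp add: prob_eq_expectation)
  have PP: "P i \<le> Pbar" if "i \<in> {1..n}" for i using Pbar[OF that] by (simp add: P_def)
  have P0: "0 \<le> P i" for i by (simp add: P_def)
  have Pbar0: "0 \<le> Pbar" using PP[of 1] P0[of 1] n by simp
  note [simp] = integrable_bprod[OF finite_edges]
  define W where "W = measure_pmf.variance (null_law n lam) (HC_at n lam t)"
  have W_eq: "W = measure_pmf.expectation ?P0 (\<lambda>x. (\<Sum>i\<in>{1..n}. X i x - P i)\<^sup>2)"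
    unfolding W_def expectation_HC_at unfolding null by (simp add: HC)
  have W_le: "W \<le> 2 * n * Pbar"
  proof -
    have "W \<le> 2 * (\<Sum>i\<in>{1..n}. measure_pmf.expectation ?P0 (\<lambda>x. (X i x - P i)\<^sup>2))"
      unfolding W_eq
    proof (rule variance_vertex_sum_le[OF p0(1,2)])
      fix i
      have "depends_on (exceeds n \<tau> i) (star n i)"
        unfolding exceeds_def[abs_def] by (rule depends_on_comp[OF depends_on_sum])
      then show "depends_on (\<lambda>x. X i x - P i) (star n i)"
        unfolding X_def by (rule depends_on_comp)
      show "measure_pmf.expectation ?P0 (\<lambda>x. X i x - P i) = 0"
        using EX[of i] by simp
    qed
    also have "\<dots> \<le> 2 * (\<Sum>i\<in>{1..n}. Pbar)"
    proof (intro mult_left_mono sum_mono)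
      fix i assume i: "i \<in> {1..n}"
      have sq: "(X i x)\<^sup>2 = X i x" for x by (simp add: X_def)
      have "measure_pmf.expectation ?P0 (\<lambda>x. (X i x - P i)\<^sup>2) = P i - (P i)\<^sup>2"
        using measure_pmf.variance_eq[of ?P0 "X i"] EX[of i] by (simp add: sq)
      then show "measure_pmf.expectation ?P0 (\<lambda>x. (X i x - P i)\<^sup>2) \<le> Pbar"
        using PP[OF i] by (smt (verit) zero_le_power2)
    qed simp
    finally show ?thesis by simp
  qed
  \<comment> \<open>The empty and the complete graph both have positive probability. In the former
    no vertex exceeds as \<tau> \<ge> 0; in the latter all do, since a positive q forces \<tau>
    below n - s. The two values differ by n, so the statistic is not constant.\<close>
  have W_pos: "0 < W"
  proof (rule ccontr)
    assume "\<not> 0 < W"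
    then have "W = 0" using measure_pmf.variance_positive[of "null_law n lam" "HC_at n lam t"] by (simp add: W_def)
    then have "AE x in ?P0. (\<Sum>i\<in>{1..n}. X i x - P i)\<^sup>2 = 0"
      unfolding W_eq by (subst (asm) integral_nonneg_eq_0_iff_AE) auto
    then have zero: "(\<Sum>i\<in>{1..n}. X i x - P i) = 0" if "x \<in> set_pmf ?P0" for x
      using that by (auto simp: AE_measure_pmf_iff)
    have supp: "x \<in> set_pmf ?P0" if "\<And>e. e \<notin> ?E \<Longrightarrow> \<not> x e" for x
    proof -
      have "pmf ?P0 x = (\<Prod>e\<in>?E. if x e then p0 else 1 - p0)"
        using p0 that by (intro pmf_bprod) auto
      also have "\<dots> > 0" using p0 by (intro prod_pos) auto
      finally show ?thesis by (simp add: set_pmf_iff)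
    qed
    have X0: "X i (\<lambda>_. False) = 0" for i using \<tau>0 by (simp add: X_def exceeds_def)
    have X1: "X i (\<lambda>e. e \<in> ?E) = 1" if "i \<in> {1..n}" for i
    proof -
      have "card (star n i) = n - 1"
        unfolding star_def using that by (simp add: card_image inj_on_edge)
      then obtain M where M: "M \<subseteq> star n i" "card M = n - s"
        using s by (metis obtain_subset_with_card_n diff_le_mono2)
      have "M \<subseteq> ?E" using M star_edges[OF that] by blast
      have "0 < measure_pmf.prob (bprod M (\<lambda>_. pB)) {x. \<tau> < (\<Sum>e\<in>M. of_bool (x e))}"
        using q[OF \<open>M \<subseteq> ?E\<close> M(2)] q0 by linarith
      then have "{x. \<tau> < (\<Sum>e\<in>M. of_bool (x e))} \<noteq> {}" by (metis less_irrefl measure_empty)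
      then obtain x where "\<tau> < (\<Sum>e\<in>M. of_bool (x e :: bool))" by blast
      also have "\<dots> \<le> (\<Sum>e\<in>M. 1)" by (intro sum_mono) auto
      also have "\<dots> \<le> real (card (star n i))"
        using card_mono[OF _ M(1)] by (simp add: star_def)
      also have "\<dots> = (\<Sum>e\<in>star n i. of_bool (e \<in> ?E))"
      proof -
        have "(\<Sum>e\<in>star n i. of_bool (e \<in> ?E)) = (\<Sum>e\<in>star n i. 1 :: real)"
          using star_edges[OF that] by (intro sum.cong) auto
        then show ?thesis by simp
      qed
      finally show ?thesis by (simp add: X_def exceeds_def)
    qed
    have "(\<Sum>i\<in>{1..n}. X i (\<lambda>_. False) - P i) = 0" by (intro zero supp) auto
    moreover have "(\<Sum>i\<in>{1..n}. X i (\<lambda>e. e \<in> ?E) - P i) = 0" by (intro zero supp) auto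
    ultimately have "(\<Sum>i\<in>{1..n}. X i (\<lambda>e. e \<in> ?E)) = (\<Sum>i\<in>{1..n}. X i (\<lambda>_. False))"
      by (simp add: sum_subtractf)
    then have "real n = 0" using X1 X0 by simp
    then show False using n by simp
  qed
  have hW: "8 * (h * sqrt W) \<le> s * q"
  proof -
    have "8 * (h * sqrt W) \<le> 8 * (h * sqrt (2 * n * Pbar))"
      using W_le h by (intro mult_left_mono real_sqrt_le_mono) auto
    then show ?thesis using big by simp
  qed
  define Ms where "Ms i = edge i ` ({1..n} - S)" for i
  have Ms: "Ms i \<subseteq> ?E" "card (Ms i) = n - s" "Ms i \<subseteq> star n i" if "i \<in> S" for i
  proof -
    have i: "i \<in> {1..n}" using that S by blast
    show "Ms i \<subseteq> ?E" unfolding Ms_def by (intro image_subsetI edge_in_edges i) (use that in auto)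
    show "card (Ms i) = n - s" unfolding Ms_def using that S by (simp add: card_image inj_on_edge card_Diff_subset)
    show "Ms i \<subseteq> star n i" unfolding Ms_def star_def using that by blast
  qed
  have Ms_disj: "Ms i \<inter> Ms j = {}" if "i \<in> S" "j \<in> S" "i \<noteq> j" for i j
    using that unfolding Ms_def by (auto simp: edge_def min_def max_def split: if_splits)
  define MS where "MS = (\<Union>i\<in>S. Ms i)"
  \<comment> \<open>A law below the alternative that keeps only the edges leaving the support, with
    the single probability pB; the disjoint edge sets then give independent counts.\<close>
  define pS where "pS e = (if e \<in> MS then pB else 0)" for e
  define \<zeta> where "\<zeta> i = {x. \<tau> < (\<Sum>e\<in>Ms i. of_bool (x e))}" for i
  define Z where "Z x = (\<Sum>i\<in>S. of_bool (x \<in> \<zeta> i) :: real)" for x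
  define N1 where "N1 x = (\<Sum>i\<in>{1..n} - S. X i x)" for x
  define N2 where "N2 x = (\<Sum>i\<in>S. X i x)" for x
  define PS where "PS = (\<Sum>i\<in>{1..n}. P i)"
  \<comment> \<open>If the support contributes more than s q / 2, nonrejection forces the remaining
    count N1 below this value.\<close>
  define c where "c = PS + h * sqrt W - s * q / 2"
  have split: "(\<Sum>i\<in>{1..n}. X i x - P i) = N1 x + N2 x - PS" for x
    using sum.subset_diff[OF S(1), of "\<lambda>i. X i x"] by (simp add: N1_def N2_def PS_def sum_subtractf)
  have \<zeta>_X: "of_bool (x \<in> \<zeta> i) \<le> X i x" if "i \<in> S" for i x
  proof -
    have "(\<Sum>e\<in>Ms i. of_bool (x e) :: real) \<le> (\<Sum>e\<in>star n i. of_bool (x e))"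
      using Ms(3)[OF that] by (intro sum_mono2) (auto simp: star_def)
    then show ?thesis by (auto simp: \<zeta>_def X_def exceeds_def of_bool_def)
  qed
  have ZN2: "Z x \<le> N2 x" for x unfolding Z_def N2_def by (intro sum_mono \<zeta>_X)
  have "measure_pmf.prob (beta_law n lam \<beta>) {Y. GHC n lam t Y \<le> h}
      = measure_pmf.prob (bprod ?E (eprob n lam \<beta>)) {x. GHC n lam t (adj x) \<le> h}"
    by (rule prob_beta_law)
  also have "\<dots> \<le> measure_pmf.prob (bprod ?E (eprob n lam \<beta>)) ({x. Z x \<le> s * q / 2} \<union> {x. N1 x \<le> c})"
  proof (intro measure_pmf.finite_measure_mono subsetI)
    fix x assume "x \<in> {x. GHC n lam t (adj x) \<le> h}"
    then have "HC_at n lam t (adj x) / sqrt W \<le> h" by (simp add: GHC_def W_def)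
    then have "N1 x + N2 x - PS \<le> h * sqrt W"
      using W_pos unfolding HC split by (simp only: pos_divide_le_eq real_sqrt_gt_zero)
    then show "x \<in> {x. Z x \<le> s * q / 2} \<union> {x. N1 x \<le> c}"
      using ZN2[of x] by (auto simp: c_def)
  qed simp
  also have "\<dots> \<le> measure_pmf.prob (bprod ?E (eprob n lam \<beta>)) {x. Z x \<le> s * q / 2}
      + measure_pmf.prob (bprod ?E (eprob n lam \<beta>)) {x. N1 x \<le> c}"
    by (intro measure_Un_le) auto
  also have "\<dots> \<le> 4 / (s * q) + (1 / h\<^sup>2 + 4 * Pbar / q)"
  proof (intro add_mono)
    have "measure_pmf.prob (bprod ?E (eprob n lam \<beta>)) {x. Z x \<le> s * q / 2}
        \<le> measure_pmf.prob (bprod ?E pS) {x. Z x \<le> s * q / 2}"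
    proof (rule prob_bprod_antimono)
      fix e assume "e \<in> ?E"
      have "pS e \<le> eprob n lam \<beta> e"
      proof (cases "e \<in> MS")
        case True
        then obtain i j where "i \<in> S" "j \<in> {1..n}" "e = edge i j" by (auto simp: MS_def Ms_def)
        then show ?thesis
          using eprob_ge_signal[OF _ \<beta> _ _ B(2), of lam i j] lam True
          by (simp add: pS_def pB_def p0_def S_def)
      qed (use eprob_bounds[of lam n \<beta> e] lam in \<open>simp add: pS_def\<close>)
      then show "0 \<le> pS e \<and> pS e \<le> eprob n lam \<beta> e \<and> eprob n lam \<beta> e \<le> 1"
        using eprob_bounds[of lam n \<beta> e] lam pB by (auto simp: pS_def)
    next
      fix x y assume y: "y \<in> {x. Z x \<le> s * q / 2}" and xy: "\<And>e. x e \<longrightarrow> y e"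
      have "Z x \<le> Z y"
        unfolding Z_def
      proof (intro sum_mono)
        fix i
        have "(\<Sum>e\<in>Ms i. of_bool (x e) :: real) \<le> (\<Sum>e\<in>Ms i. of_bool (y e))"
          using xy by (intro sum_mono) auto
        then show "of_bool (x \<in> \<zeta> i) \<le> (of_bool (y \<in> \<zeta> i) :: real)"
          by (auto simp: \<zeta>_def of_bool_def)
      qed
      then show "x \<in> {x. Z x \<le> s * q / 2}" using y by simp
    qed simp
    also have "\<dots> \<le> 4 / (s * q)"
      unfolding Z_def
    proof (rule pairwise_independent_lower_tail)
      show "finite (set_pmf (bprod ?E pS))" by (rule finite_set_bprod) simp
      show "finite S" by (rule S)
      have dep: "depends_on (\<lambda>x. of_bool (x \<in> \<zeta> i) :: real) (Ms i)" for i
        using depends_on_comp[OF depends_on_sum[of "Ms i"], where g = "\<lambda>X. of_bool (\<tau> < X) :: real"]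
        by (simp add: \<zeta>_def)
      show "measure_pmf.expectation (bprod ?E pS) (\<lambda>x. of_bool (x \<in> \<zeta> i) * of_bool (x \<in> \<zeta> j))
        = measure_pmf.prob (bprod ?E pS) (\<zeta> i) * measure_pmf.prob (bprod ?E pS) (\<zeta> j)"
        if "i \<in> S" "j \<in> S" "i \<noteq> j" for i j
        using expectation_mult_depends_on[OF finite_edges dep dep Ms_disj[OF that], where p = pS]
        by (simp add: prob_eq_expectation)
      have qi: "q \<le> measure_pmf.prob (bprod ?E pS) (\<zeta> i)" if i: "i \<in> S" for i
      proof -
        have "measure_pmf.prob (bprod ?E pS) (\<zeta> i) = measure_pmf.prob (bprod (Ms i) pS) (\<zeta> i)"
          unfolding prob_eq_expectation by (intro expectation_bprod_restrict finite_edges Ms(1) dep i)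
        also have "bprod (Ms i) pS = bprod (Ms i) (\<lambda>_. pB)"
          unfolding bprod_def using i by (intro Pi_pmf_cong) (auto simp: pS_def MS_def)
        finally show ?thesis using q[OF Ms(1)[OF i] Ms(2)[OF i]] by (simp add: \<zeta>_def)
      qed
      have "s * q = (\<Sum>i\<in>S. q)" using S by simp
      also have "\<dots> \<le> (\<Sum>i\<in>S. measure_pmf.prob (bprod ?E pS) (\<zeta> i))" by (intro sum_mono qi)
      finally show "s * q \<le> (\<Sum>i\<in>S. measure_pmf.prob (bprod ?E pS) (\<zeta> i))" .
      show "0 < s * q" using s q0 by simp
    qed
    finally show "measure_pmf.prob (bprod ?E (eprob n lam \<beta>)) {x. Z x \<le> s * q / 2} \<le> 4 / (s * q)" .
    have "measure_pmf.prob (bprod ?E (eprob n lam \<beta>)) {x. N1 x \<le> c} \<le> measure_pmf.prob ?P0 {x. N1 x \<le> c}"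
    proof (rule prob_bprod_antimono)
      fix e assume "e \<in> ?E"
      then show "0 \<le> p0 \<and> p0 \<le> eprob n lam \<beta> e \<and> eprob n lam \<beta> e \<le> 1"
        using eprob_bounds[of lam n \<beta> e] eprob_ge_null[OF _ \<beta>, of lam e] lam p0 by (auto simp: p0_def)
    next
      fix x y assume y: "y \<in> {x. N1 x \<le> c}" and xy: "\<And>e. x e \<longrightarrow> y e"
      have "N1 x \<le> N1 y"
        unfolding N1_def X_def using exceeds_mono[OF _ xy] by (intro sum_mono) (auto simp: of_bool_def)
      then show "x \<in> {x. N1 x \<le> c}" using y by simp
    qed simp
    \<comment> \<open>Under the null law the support is put back so that Chebyshev can be applied to
      the full statistic. If N2 < s q / 4, the centred sum is at most h sqrt W - s q / 4, which is
      at most - h sqrt W by the constant 8 in \<open>big\<close>.\<close>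
    also have "\<dots> \<le> measure_pmf.prob ?P0 ({x. h * sqrt W \<le> \<bar>HC_at n lam t (adj x)\<bar>} \<union> {x. s * q / 4 \<le> N2 x})"
    proof (intro measure_pmf.finite_measure_mono subsetI)
      fix x assume "x \<in> {x. N1 x \<le> c}"
      then have "HC_at n lam t (adj x) \<le> h * sqrt W - s * q / 2 + N2 x"
        unfolding HC split by (simp add: c_def)
      then show "x \<in> {x. h * sqrt W \<le> \<bar>HC_at n lam t (adj x)\<bar>} \<union> {x. s * q / 4 \<le> N2 x}"
        using hW by (auto simp: not_le)
    qed simp
    also have "\<dots> \<le> measure_pmf.prob ?P0 {x. h * sqrt W \<le> \<bar>HC_at n lam t (adj x)\<bar>} + measure_pmf.prob ?P0 {x. s * q / 4 \<le> N2 x}"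
      by (intro measure_Un_le) auto
    also have "\<dots> \<le> 1 / h\<^sup>2 + 4 * Pbar / q"
    proof (intro add_mono)
      have "measure_pmf.prob ?P0 {x. h * sqrt W \<le> \<bar>HC_at n lam t (adj x)\<bar>}
          = measure_pmf.prob (null_law n lam) {Y. h * sqrt W \<le> \<bar>HC_at n lam t Y\<bar>}"
        unfolding null by (simp add: vimage_def)
      also have "\<dots> \<le> 1 / h\<^sup>2"
        unfolding W_def by (rule null_HC_at_tail[OF h W_pos[unfolded W_def]])
      finally show "measure_pmf.prob ?P0 {x. h * sqrt W \<le> \<bar>HC_at n lam t (adj x)\<bar>} \<le> 1 / h\<^sup>2" .
      have sq: "0 < s * q / 4" using s q0 by simp
      have "measure_pmf.prob ?P0 {x \<in> space (measure_pmf ?P0). s * q / 4 \<le> N2 x} \<le> measure_pmf.expectation ?P0 N2 / (s * q / 4)"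
        using sq by (intro integral_Markov_inequality_measure[where A = UNIV]) (auto simp: N2_def X_def intro!: sum_nonneg)
      also have "measure_pmf.expectation ?P0 N2 = (\<Sum>i\<in>S. P i)"
        unfolding N2_def[abs_def] by (simp add: Bochner_Integration.integral_sum EX)
      also have "(\<Sum>i\<in>S. P i) / (s * q / 4) \<le> (\<Sum>i\<in>S. Pbar) / (s * q / 4)"
        using sq S PP by (intro divide_right_mono sum_mono) auto
      also have "\<dots> = 4 * Pbar / q" using S s q0 by (simp add: field_simps)
      finally show "measure_pmf.prob ?P0 {x. s * q / 4 \<le> N2 x} \<le> 4 * Pbar / q" by simp
    qed
    finally show "measure_pmf.prob (bprod ?E (eprob n lam \<beta>)) {x. N1 x \<le> c} \<le> 1 / h\<^sup>2 + 4 * Pbar / q" .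
  qed
  finally show ?thesis .
qed

text \<open>The supremum pays for the whole grid only under the null law; under the alternative a
  single well-chosen threshold forces rejection.\<close>

lemma HC_test_risk_bound:
  fixes A B lam h q Pbar t :: real and n s :: nat
  defines "p0 \<equiv> lam / (2 * real n)"
  defines "pB \<equiv> p0 * (1 + tanh (B / 2))"
  defines "\<tau> \<equiv> p0 * (real n - 1) + t * sqrt ((real n - 1) * p0 * (1 - p0))"
  assumes n: "n \<ge> 2" and s: "1 \<le> s" "s \<le> n" and lam: "0 < lam" "lam \<le> n" and B: "0 < B" "B \<le> A"
    and h: "0 < h" and t: "t \<in> HC_grid n"
    and Pbar: "\<And>i. i \<in> {1..n} \<Longrightarrow> measure_pmf.prob (bprod (edges n) (\<lambda>_. p0)) {x. exceeds n \<tau> i x} \<le> Pbar"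
    and q0: "0 < q" and q: "\<And>M. M \<subseteq> edges n \<Longrightarrow> card M = n - s \<Longrightarrow>
      q \<le> measure_pmf.prob (bprod M (\<lambda>_. pB)) {x. \<tau> < (\<Sum>e\<in>M. of_bool (x e))}"
    and big: "8 * h * sqrt (2 * n * Pbar) \<le> s * q"
  shows "risk n lam s A (\<lambda>Y. HC n lam Y > h) \<le> sqrt (10 * ln (real n)) / h\<^sup>2 + (4 / (s * q) + (1 / h\<^sup>2 + 4 * Pbar / q))"
proof -
  have t0: "0 \<le> t" using t HC_grid_subset[OF n] by auto
  have ne: "HC_grid n \<noteq> {}" using t by auto
  have "flat n {1..s} A \<in> Xi n s A"
    using s B by (intro flat_in_Xi) auto
  then have Xi: "Xi n s A \<noteq> {}" by auto
  have "(SUP \<beta>\<in>Xi n s A. measure_pmf.prob (beta_law n lam \<beta>) {Y. \<not> HC n lam Y > h})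
      \<le> 4 / (s * q) + (1 / h\<^sup>2 + 4 * Pbar / q)"
  proof (rule cSUP_least[OF Xi])
    fix \<beta> assume \<beta>: "\<beta> \<in> Xi n s A"
    have "measure_pmf.prob (beta_law n lam \<beta>) {Y. \<not> HC n lam Y > h} \<le> measure_pmf.prob (beta_law n lam \<beta>) {Y. GHC n lam t Y \<le> h}"
    proof (intro measure_pmf.finite_measure_mono subsetI CollectI)
      fix Y assume "Y \<in> {Y. \<not> HC n lam Y > h}"
      moreover have "GHC n lam t Y \<le> HC n lam Y"
        unfolding HC_def using finite_HC_grid[OF n] t by (intro cSUP_upper) auto
      ultimately show "GHC n lam t Y \<le> h" by simp
    qed simp
    also have "\<dots> \<le> 4 / (s * q) + (1 / h\<^sup>2 + 4 * Pbar / q)"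
      by (rule nonrejection_bound[OF n s lam B h t0 _ q0 _ big \<beta>])
        (use Pbar q in \<open>auto simp: p0_def pB_def \<tau>_def\<close>)
    finally show "measure_pmf.prob (beta_law n lam \<beta>) {Y. \<not> HC n lam Y > h} \<le> 4 / (s * q) + (1 / h\<^sup>2 + 4 * Pbar / q)" .
  qed
  then show ?thesis
    unfolding risk_def by (intro add_mono null_HC_le n h ne)
qed

lemma risk_nonneg:
  assumes "Xi n s A \<noteq> {}" shows "0 \<le> risk n lam s A T"
proof -
  obtain \<beta> where \<beta>: "\<beta> \<in> Xi n s A" using assms by blast
  have "measure_pmf.prob (beta_law n lam \<beta>) {Y. \<not> T Y}
      \<le> (SUP \<beta>\<in>Xi n s A. measure_pmf.prob (beta_law n lam \<beta>) {Y. \<not> T Y})"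
    using \<beta> by (intro cSUP_upper) (auto intro!: bdd_aboveI[of _ 1])
  then have "0 \<le> (SUP \<beta>\<in>Xi n s A. measure_pmf.prob (beta_law n lam \<beta>) {Y. \<not> T Y})"
    by (rule order_trans[OF measure_nonneg])
  then show ?thesis unfolding risk_def by simp
qed

section \<open>Choice of the threshold\<close>

context strong_regime
begin

text \<open>Here y is the threshold and q the shift, in units of sqrt (2 log n) standard deviations.
  \<open>e1\<close> makes the expected number of exceeding support vertices diverge, and
  \<open>e2\<close> makes it beat the null standard deviation. The cutoff ln n absorbs the union
  bound over the grid at the cost of a logarithm.\<close>

lemma powerful_at_level:
  fixes q y C :: real and A :: "nat \<Rightarrow> real"
  defines "w \<equiv> sqrt (1 - \<theta>)"
  assumes q: "0 < q" "q < y" "y \<le> 1" and C: "(4 * w * q)\<^sup>2 \<le> C"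
    and e1: "(y - q)\<^sup>2 < 1 - \<alpha>" and e2: "(1 - y\<^sup>2) / 2 < 1 - \<alpha> - (y - q)\<^sup>2"
    and A: "\<forall>\<^sub>F n in sequentially. sqrt (C * ln (real n) / lam n) \<le> tanh (A n)"
  shows "asymp_powerful lam s A (\<lambda>n Y. HC n (lam n) Y > ln (real n))"
proof -
  have w: "0 < w" "w\<^sup>2 = 1 - \<theta>" using theta_bounds by (auto simp: w_def)
  define C' where "C' = (4 * w * q)\<^sup>2"
  have C': "0 < C'" "C' \<le> C" "sqrt C' = 4 * w * q" using w q C by (auto simp: C'_def)
  define B where "B n = artanh (sqrt (C' * ln (real n) / lam n))" for n
  have B: "\<forall>\<^sub>F n in sequentially. 0 < B n \<and> tanh (B n) = sqrt (C' * ln (real n) / lam n)"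
    unfolding B_def by (rule signal_exists[OF C'(1)])
  have BA: "\<forall>\<^sub>F n in sequentially. 0 < B n \<and> B n \<le> A n"
    using B A eventually_ge_at_top[of 1]
  proof eventually_elim
    case (elim n)
    have "0 < lam n" using lam elim by (auto intro: less_le_trans[OF zero_less_one])
    then have "sqrt (C' * ln (real n) / lam n) \<le> sqrt (C * ln (real n) / lam n)"
      using elim C' by (intro real_sqrt_le_mono divide_right_mono mult_right_mono) auto
    then have "tanh (B n) \<le> tanh (A n)" using elim by linarith
    then have "B n \<le> A n" by (simp only: tanh_real_le_iff)
    then show ?case using elim(1) by blast
  qed
  have e3: "(y - q)\<^sup>2 < y\<^sup>2" using q by (intro power_strict_mono) auto
  obtain \<epsilon> where \<epsilon>: "0 < \<epsilon>" "\<epsilon> < 1 - \<alpha> - (y - q)\<^sup>2" "2 * \<epsilon> < y\<^sup>2 - (y - q)\<^sup>2" "2 * \<epsilon> < 1 - \<alpha> - (y - q)\<^sup>2 - (1 - y\<^sup>2) / 2"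
  proof
    define d where "d = min (1 - \<alpha> - (y - q)\<^sup>2) (min (y\<^sup>2 - (y - q)\<^sup>2) (1 - \<alpha> - (y - q)\<^sup>2 - (1 - y\<^sup>2) / 2))"
    have "0 < d" using e1 e2 e3 by (simp add: d_def)
    moreover have "d \<le> 1 - \<alpha> - (y - q)\<^sup>2" "d \<le> y\<^sup>2 - (y - q)\<^sup>2" "d \<le> 1 - \<alpha> - (y - q)\<^sup>2 - (1 - y\<^sup>2) / 2"
      by (auto simp: d_def)
    ultimately show "0 < d / 3" "d / 3 < 1 - \<alpha> - (y - q)\<^sup>2" "2 * (d / 3) < y\<^sup>2 - (y - q)\<^sup>2"
      "2 * (d / 3) < 1 - \<alpha> - (y - q)\<^sup>2 - (1 - y\<^sup>2) / 2" by - linarith+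
  qed
  define v where "v = (1 - \<theta>) / 2"
  have v: "0 < v" "v = w\<^sup>2 / 2" using w theta_bounds by (auto simp: v_def)
  have y: "0 < y" using q by simp
  have lam1: "\<forall>n\<ge>1. 1 \<le> lam n" using lam by blast
  have sn: "\<forall>\<^sub>F n in sequentially. s n \<le> n" using s_small by eventually_elim simp
  have inv_ln: "(\<lambda>n. 1 / sqrt (ln (real n))) \<longlonglongrightarrow> 0"
    by (intro tendsto_divide_0[OF tendsto_const] filterlim_at_top_imp_at_infinity
        filterlim_compose[OF sqrt_at_top filterlim_ln_real_nat])
  \<comment> \<open>The grid contains only integers; rounding down loses at most 1, negligible
    against sqrt (log n).\<close>
  define t where "t n = real (nat \<lfloor>y * sqrt (2 * ln (real n))\<rfloor>)" for n
  have t_bounds: "y * sqrt (2 * ln (real n)) - 1 \<le> t n \<and> t n \<le> y * sqrt (2 * ln (real n))" if "n \<ge> 1" for n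
  proof -
    have "0 \<le> y * sqrt (2 * ln (real n))" using y that by simp
    then show ?thesis unfolding t_def by linarith
  qed
  have t_lim: "(\<lambda>n. t n / sqrt (ln (real n))) \<longlonglongrightarrow> y * sqrt 2"
  proof (rule tendsto_sandwich)
    show "(\<lambda>n. y * sqrt 2 - 1 / sqrt (ln (real n))) \<longlonglongrightarrow> y * sqrt 2"
      using tendsto_diff[OF tendsto_const inv_ln, of "y * sqrt 2"] by simp
    show "(\<lambda>n. y * sqrt 2) \<longlonglongrightarrow> y * sqrt 2" by simp
    show "\<forall>\<^sub>F n in sequentially. y * sqrt 2 - 1 / sqrt (ln (real n)) \<le> t n / sqrt (ln (real n))"
      using eventually_ge_at_top[of 2]
    proof eventually_elim
      case (elim n)
      then have "0 < sqrt (ln (real n))" by simp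
      moreover have "Y * S - 1 / b \<le> T / b" if "Y * (S * b) - 1 \<le> T" "0 < b" for Y S T b :: real
        using that divide_right_mono[of "Y * (S * b) - 1" T b] by (simp add: diff_divide_distrib)
      ultimately show ?case using t_bounds[of n] elim by (simp only: real_sqrt_mult)
    qed
    show "\<forall>\<^sub>F n in sequentially. t n / sqrt (ln (real n)) \<le> y * sqrt 2"
      using eventually_ge_at_top[of 2]
    proof eventually_elim
      case (elim n)
      then have "0 < sqrt (ln (real n))" by simp
      moreover have "T / b \<le> Y * S" if "T \<le> Y * (S * b)" "0 < b" for Y S T b :: real
        using that by (simp add: field_simps)
      ultimately show ?case using t_bounds[of n] elim by (simp only: real_sqrt_mult)
    qed
  qed
  have t_grid: "\<forall>\<^sub>F n in sequentially. t n \<in> HC_grid n"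
  proof -
    have "\<forall>\<^sub>F n in sequentially. 0 < t n / sqrt (ln (real n))"
      using t_lim by (rule order_tendstoD) (use y in simp)
    then show ?thesis using eventually_ge_at_top[of 2]
    proof eventually_elim
      case (elim n)
      have l: "0 < ln (real n)" using elim by simp
      have tp: "0 < t n" using elim l by (simp add: zero_less_divide_iff)
      have "(t n)\<^sup>2 \<le> (y * sqrt (2 * ln (real n)))\<^sup>2"
        using t_bounds[of n] elim tp by (intro power_mono) auto
      also have "\<dots> = y\<^sup>2 * (2 * ln (real n))" using l by (simp add: power_mult_distrib)
      also have "\<dots> \<le> 1 * (2 * ln (real n))"
        using l q y by (intro mult_right_mono) (auto simp: power_le_one)
      also have "\<dots> < 5 * (2 * ln (real n))" using l by simp
      finally have "(t n)\<^sup>2 / (2 * ln (real n)) < 5" using l by (simp add: pos_divide_less_eq)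
      moreover have "t n = sqrt (2 * ((t n)\<^sup>2 / (2 * ln (real n))) * ln (real n))"
        using l tp by simp
      moreover have "0 < (t n)\<^sup>2 / (2 * ln (real n))" using l tp by simp
      moreover have "t n \<in> \<nat>" by (simp add: t_def)
      ultimately show ?case unfolding HC_grid_def by blast
    qed
  qed
  define \<tau> where "\<tau> n = p0 n * (real n - 1) + t n * sqrt ((real n - 1) * p0 n * (1 - p0 n))" for n
  \<comment> \<open>The statistic is centred at (n - 1) p0 whereas the degree asymptotics use n p0;
    the term - p0 makes up the difference.\<close>
  define T' where "T' n = - p0 n + t n * sqrt ((real n - 1) * p0 n * (1 - p0 n))" for n
  have \<tau>_T': "real n * p0 n + T' n = \<tau> n" for n
  proof -
    have *: "m * P + (- P + X) = P * (m - 1) + X" for m P X :: real by (simp add: algebra_simps)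
    show ?thesis unfolding \<tau>_def T'_def by (rule *)
  qed
  have T': "(\<lambda>n. T' n / sqrt (lam n * ln (real n))) \<longlonglongrightarrow> y * w"
  proof -
    have inv_lam: "(\<lambda>n. sqrt (ln (real n) / lam n) * (1 / sqrt (ln (real n)))\<^sup>2) \<longlonglongrightarrow> sqrt 0 * 0\<^sup>2"
      by (intro tendsto_intros x0 inv_ln)
    have "(\<lambda>n. t n / sqrt (ln (real n)) * sqrt (1 / 2 * (1 - 1 / real n) * (1 - p0 n))
        - p0 n * (sqrt (ln (real n) / lam n) * (1 / sqrt (ln (real n)))\<^sup>2))
      \<longlonglongrightarrow> y * sqrt 2 * sqrt (1 / 2 * (1 - 0) * (1 - \<theta>)) - \<theta> * (sqrt 0 * 0\<^sup>2)"
      by (intro tendsto_intros t_lim theta inv_lam lim_inverse_n')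
    also have "y * sqrt 2 * sqrt (1 / 2 * (1 - 0) * (1 - \<theta>)) - \<theta> * (sqrt 0 * 0\<^sup>2) = y * w"
      by (simp add: w_def real_sqrt_mult[symmetric])
    finally have "(\<lambda>n. t n / sqrt (ln (real n)) * sqrt (1 / 2 * (1 - 1 / real n) * (1 - p0 n))
        - p0 n * (sqrt (ln (real n) / lam n) * (1 / sqrt (ln (real n)))\<^sup>2)) \<longlonglongrightarrow> y * w" .
    then show ?thesis
    proof (rule Lim_transform_eventually)
      show "\<forall>\<^sub>F n in sequentially. t n / sqrt (ln (real n)) * sqrt (1 / 2 * (1 - 1 / real n) * (1 - p0 n))
        - p0 n * (sqrt (ln (real n) / lam n) * (1 / sqrt (ln (real n)))\<^sup>2) = T' n / sqrt (lam n * ln (real n))"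
        using eventually_ge_at_top[of 2]
      proof eventually_elim
        case (elim n)
        have l1: "1 \<le> lam n" using lam elim by auto
        define a where "a = sqrt (lam n)"
        define b where "b = sqrt (ln (real n))"
        have ab: "a > 0" "b > 0" using l1 elim by (auto simp: a_def b_def)
        have r: "sqrt (lam n * ln (real n)) = a * b" "sqrt (ln (real n) / lam n) = b / a"
          by (simp_all add: a_def b_def real_sqrt_mult real_sqrt_divide)
        have "(real n - 1) * p0 n * (1 - p0 n) = lam n * (1 / 2 * (1 - 1 / real n) * (1 - p0 n))"
          using elim by (simp add: field_simps)
        then have "sqrt ((real n - 1) * p0 n * (1 - p0 n)) = a * sqrt (1 / 2 * (1 - 1 / real n) * (1 - p0 n))"
          by (simp only: real_sqrt_mult a_def)
        moreover have "t / b * S - P * (b / a * (1 / b)\<^sup>2) = (- P + t * (a * S)) / (a * b)" for t S P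
          using ab by (simp add: field_simps power2_eq_square)
        ultimately show ?case unfolding T'_def r b_def[symmetric] by (simp only:)
      qed
    qed
  qed
  \<comment> \<open>Null degrees have relative change 0 and drop one vertex, the vertex itself;
    support vertices have the change tanh (B / 2) and drop s vertices.\<close>
  define c0 where "c0 = y * w - 0 / 2"
  define c1 where "c1 = y * w - sqrt C' / 2 / 2"
  have c: "c0 = w * y" "c1 = w * (y - q)" unfolding c0_def c1_def C'(3) by (simp_all add: algebra_simps)
  have ee: "- c0\<^sup>2 / (2 * v) = - y\<^sup>2" "- c1\<^sup>2 / (2 * v) = - (y - q)\<^sup>2"
    using w(1) by (simp_all add: c v(2) power_mult_distrib)
  have one_n: "\<forall>\<^sub>F n in sequentially. 1 \<le> n" by (rule eventually_ge_at_top)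
  have k1: "(\<lambda>n. real 1 / real n * sqrt (real n)) \<longlonglongrightarrow> 0"
  proof -
    have "(\<lambda>n. 1 / sqrt (real n)) \<longlonglongrightarrow> 0"
      by (intro tendsto_divide_0[OF tendsto_const] filterlim_at_top_imp_at_infinity
          filterlim_compose[OF sqrt_at_top filterlim_real_sequentially])
    then show ?thesis
    proof (rule Lim_transform_eventually)
      show "\<forall>\<^sub>F n in sequentially. 1 / sqrt (real n) = real 1 / real n * sqrt (real n)"
        using eventually_ge_at_top[of 1]
        by eventually_elim (simp add: real_div_sqrt field_simps)
    qed
  qed
  have g1: "(\<lambda>n. (1 - 1) / sqrt (ln (real n) / lam n)) \<longlonglongrightarrow> 0" by simp
  note D0 = degree_variance_limit[where g = "\<lambda>_. 1", OF one_n k1 g1 T']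
    degree_mean_limit[where g = "\<lambda>_. 1", OF one_n k1 g1 T']
    degree_prob_bounds[where g = "\<lambda>_. 1", OF one_n k1 g1 T']
  note D1 = degree_variance_limit[OF sn s_sqrt_limit gamma_one[OF C'(1) B] T']
    degree_mean_limit[OF sn s_sqrt_limit gamma_one[OF C'(1) B] T']
    degree_prob_bounds[OF sn s_sqrt_limit gamma_one[OF C'(1) B] T']
  have up: "\<forall>\<^sub>F n in sequentially. exp (- (c0 / v * sqrt (ln (real n) / lam n)) * \<tau> n)
      * (1 - p0 n * 1 + p0 n * 1 * exp (c0 / v * sqrt (ln (real n) / lam n))) ^ (n - 1)
    \<le> real n powr (- c0\<^sup>2 / (2 * v) + \<epsilon>)"
    unfolding c0_def
    by (rule chernoff_asymptotic[OF lam1 x0 _ v(1) D0(1)[folded v_def] D0(2)[unfolded \<tau>_T'] \<epsilon>(1)])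
      (use D0(3) in eventually_elim, linarith)
  have low: "\<forall>\<^sub>F n in sequentially. \<forall>(E :: (nat \<times> nat) set) M. finite E \<longrightarrow> M \<subseteq> E \<longrightarrow> card M = n - s n \<longrightarrow>
    real n powr (- c1\<^sup>2 / (2 * v) - \<epsilon>)
      \<le> measure_pmf.prob (bprod E (\<lambda>_. p0 n * (1 + tanh (B n / 2)))) {x. \<tau> n < (\<Sum>e\<in>M. of_bool (x e))}"
    using w q unfolding c1_def
    by (intro prob_bprod_lower_asymptotic[OF lam1 x0 D1(3) v(1) D1(1)[folded v_def] D1(2)[unfolded \<tau>_T'] _ \<epsilon>(1)])
      (simp add: C'(3))
  define Q where "Q n = real n powr (- (y - q)\<^sup>2 - \<epsilon>)" for n
  define Pbar where "Pbar n = real n powr (- y\<^sup>2 + \<epsilon>)" for n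
  \<comment> \<open>The summands bound, in this order, the null rejection probability, the lower
    tail of the support count, the null fluctuation off the support, and null exceedances on
    it.\<close>
  define b where "b n = sqrt 10 * (1 / sqrt (ln (real n))) ^ 3 + (8 * real n powr (- (1 - \<alpha> - (y - q)\<^sup>2 - \<epsilon>))
      + ((1 / sqrt (ln (real n))) ^ 4 + 4 * real n powr (- (y\<^sup>2 - (y - q)\<^sup>2 - 2 * \<epsilon>))))" for n
  have "b \<longlonglongrightarrow> sqrt 10 * 0 ^ 3 + (8 * 0 + (0 ^ 4 + 4 * 0))"
    unfolding b_def using \<epsilon> by (intro tendsto_intros inv_ln powr_tendsto_zero) auto
  then have b: "b \<longlonglongrightarrow> 0" by simp
  \<comment> \<open>The constant turns 8 sqrt 2 into 1/2, matching the lower bound n^(1 - \<alpha>)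
    / 2 for s.\<close>
  have bigev: "\<forall>\<^sub>F n in sequentially. ln (real n) * real n powr ((1 - y\<^sup>2) / 2 + 2 * \<epsilon> - (1 - \<alpha> - (y - q)\<^sup>2)) < 1 / (16 * sqrt 2)"
    by (rule order_tendstoD(2)[OF ln_powr_tendsto_zero]) (use \<epsilon> in auto)
  have upper: "\<forall>\<^sub>F n in sequentially. risk n (lam n) (s n) (A n) (\<lambda>Y. HC n (lam n) Y > ln (real n)) \<le> b n \<and>
      0 \<le> risk n (lam n) (s n) (A n) (\<lambda>Y. HC n (lam n) Y > ln (real n))"
    using BA t_grid up low bigev sn eventually_ge_at_top[of 2]
  proof eventually_elim
    case (elim n)
    have n2: "2 \<le> n" and n1: "1 \<le> n" using elim(7) by auto
    have l: "0 < lam n" "lam n \<le> n" using lam n1 by (auto intro: less_le_trans[OF zero_less_one])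
    have ln_pos: "0 < ln (real n)" using n2 by simp
    note p = p0[OF n1]
    have Qpos: "0 < Q n" using n1 by (simp add: Q_def)
    define u where "u = c0 / v * sqrt (ln (real n) / lam n)"
    have u: "0 \<le> u" using v(1) w y l n1 by (simp add: u_def c)
    have Pb: "measure_pmf.prob (bprod (edges n) (\<lambda>_. p0 n)) {x. exceeds n (\<tau> n) i x} \<le> Pbar n" if i: "i \<in> {1..n}" for i
    proof -
      have "measure_pmf.prob (bprod (edges n) (\<lambda>_. p0 n)) {x. exceeds n (\<tau> n) i x}
        \<le> exp (- u * \<tau> n) * (\<Prod>e\<in>star n i. 1 - p0 n + p0 n * exp u)"
        unfolding exceeds_def using p u by (intro prob_bprod_chernoff star_edges i) auto
      also have "(\<Prod>e\<in>star n i. 1 - p0 n + p0 n * exp u) = (1 - p0 n * 1 + p0 n * 1 * exp u) ^ (n - 1)"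
        using i by (simp add: star_def card_image inj_on_edge)
      also have "exp (- u * \<tau> n) * (1 - p0 n * 1 + p0 n * 1 * exp u) ^ (n - 1) \<le> Pbar n"
        using elim(3) unfolding u_def Pbar_def ee .
      finally show ?thesis .
    qed
    have Ql: "Q n \<le> measure_pmf.prob (bprod M (\<lambda>_. p0 n * (1 + tanh (B n / 2)))) {x. \<tau> n < (\<Sum>e\<in>M. of_bool (x e))}"
      if "M \<subseteq> edges n" "card M = n - s n" for M
      using elim(4) that finite_subset[OF that(1) finite_edges] unfolding Q_def ee by blast
    have sQ: "real n powr (1 - \<alpha> - (y - q)\<^sup>2 - \<epsilon>) / 2 \<le> s n * Q n"
    proof -
      have "real n powr (1 - \<alpha>) / 2 * Q n \<le> s n * Q n"
        using s_bounds[OF n1] Qpos by (intro mult_right_mono) auto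
      moreover have "real n powr (1 - \<alpha>) / 2 * Q n = real n powr (1 - \<alpha> + (- (y - q)\<^sup>2 - \<epsilon>)) / 2"
        by (simp add: Q_def powr_add)
      ultimately show ?thesis by (simp add: algebra_simps)
    qed
    have big: "8 * ln (real n) * sqrt (2 * n * Pbar n) \<le> s n * Q n"
    proof -
      have "sqrt (2 * n * Pbar n) = sqrt 2 * sqrt (real n powr (1 + (- y\<^sup>2 + \<epsilon>)))"
        using n1 by (simp add: Pbar_def powr_add real_sqrt_mult)
      also have "sqrt (real n powr (1 + (- y\<^sup>2 + \<epsilon>))) = real n powr ((1 + (- y\<^sup>2 + \<epsilon>)) / 2)"
        using n1 by (simp add: powr_half_sqrt[symmetric] powr_powr)
      also have "\<dots> \<le> real n powr ((1 - y\<^sup>2) / 2 + \<epsilon>)"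
        using n1 \<epsilon> by (intro powr_mono) (auto simp: field_simps)
      finally have "8 * ln (real n) * sqrt (2 * n * Pbar n) \<le> 8 * ln (real n) * (sqrt 2 * real n powr ((1 - y\<^sup>2) / 2 + \<epsilon>))"
        using ln_pos by (intro mult_left_mono) auto
      also have "real n powr ((1 - y\<^sup>2) / 2 + \<epsilon>) = real n powr ((1 - y\<^sup>2) / 2 + 2 * \<epsilon> - (1 - \<alpha> - (y - q)\<^sup>2)) * real n powr (1 - \<alpha> - (y - q)\<^sup>2 - \<epsilon>)"
        unfolding powr_add[symmetric] by (simp add: algebra_simps)
      also have "8 * ln (real n) * (sqrt 2 * (real n powr ((1 - y\<^sup>2) / 2 + 2 * \<epsilon> - (1 - \<alpha> - (y - q)\<^sup>2)) * real n powr (1 - \<alpha> - (y - q)\<^sup>2 - \<epsilon>)))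
        = 8 * sqrt 2 * (ln (real n) * real n powr ((1 - y\<^sup>2) / 2 + 2 * \<epsilon> - (1 - \<alpha> - (y - q)\<^sup>2))) * real n powr (1 - \<alpha> - (y - q)\<^sup>2 - \<epsilon>)"
        by (simp only: ac_simps)
      also have "\<dots> \<le> 8 * sqrt 2 * (1 / (16 * sqrt 2)) * real n powr (1 - \<alpha> - (y - q)\<^sup>2 - \<epsilon>)"
        using elim(5) by (intro mult_right_mono mult_left_mono) auto
      also have "\<dots> = real n powr (1 - \<alpha> - (y - q)\<^sup>2 - \<epsilon>) / 2" by simp
      also have "\<dots> \<le> s n * Q n" by (rule sQ)
      finally show ?thesis .
    qed
    have "risk n (lam n) (s n) (A n) (\<lambda>Y. HC n (lam n) Y > ln (real n))
      \<le> sqrt (10 * ln (real n)) / (ln (real n))\<^sup>2 + (4 / (s n * Q n) + (1 / (ln (real n))\<^sup>2 + 4 * Pbar n / Q n))"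
      by (rule HC_test_risk_bound[OF n2 s_bounds(1)[OF n1] elim(6) l conjunct1[OF elim(1)] conjunct2[OF elim(1)]
            ln_pos elim(2) Pb[unfolded \<tau>_def] Qpos Ql[unfolded \<tau>_def] big])
    also have "\<dots> \<le> b n"
      unfolding b_def
    proof (intro add_mono)
      define z where "z = sqrt (ln (real n))"
      have z: "z > 0" "ln (real n) = z\<^sup>2" using ln_pos by (auto simp: z_def)
      have "sqrt (10 * ln (real n)) = sqrt 10 * z" by (simp add: real_sqrt_mult z_def)
      then show "sqrt (10 * ln (real n)) / (ln (real n))\<^sup>2 \<le> sqrt 10 * (1 / sqrt (ln (real n))) ^ 3"
        unfolding z_def[symmetric] z(2) using z(1) by (simp add: field_simps power2_eq_square power3_eq_cube)
      show "1 / (ln (real n))\<^sup>2 \<le> (1 / sqrt (ln (real n))) ^ 4"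
        unfolding z_def[symmetric] z(2) using z(1) by (simp add: power_divide flip: power_mult)
      have "4 / (s n * Q n) \<le> 4 / (real n powr (1 - \<alpha> - (y - q)\<^sup>2 - \<epsilon>) / 2)"
        using sQ n1 Qpos s_bounds(1)[OF n1] by (intro divide_left_mono mult_pos_pos) auto
      also have "\<dots> = 8 * real n powr (- (1 - \<alpha> - (y - q)\<^sup>2 - \<epsilon>))"
      proof -
        have "4 / (X / 2) = 8 * inverse X" for X :: real by (simp add: field_simps)
        then show ?thesis unfolding powr_minus by blast
      qed
      finally show "4 / (s n * Q n) \<le> 8 * real n powr (- (1 - \<alpha> - (y - q)\<^sup>2 - \<epsilon>))" .
      have "Pbar n / Q n = real n powr (- (y\<^sup>2 - (y - q)\<^sup>2 - 2 * \<epsilon>))"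
        unfolding Pbar_def Q_def powr_diff[symmetric] by (simp add: algebra_simps)
      then show "4 * Pbar n / Q n \<le> 4 * real n powr (- (y\<^sup>2 - (y - q)\<^sup>2 - 2 * \<epsilon>))" by simp
    qed
    finally have "risk n (lam n) (s n) (A n) (\<lambda>Y. HC n (lam n) Y > ln (real n)) \<le> b n" .
    moreover have "flat n {1..s n} (A n) \<in> Xi n (s n) (A n)"
      using elim(1,6) by (intro flat_in_Xi) auto
    then have "0 \<le> risk n (lam n) (s n) (A n) (\<lambda>Y. HC n (lam n) Y > ln (real n))"
      by (intro risk_nonneg) auto
    ultimately show ?case by blast
  qed
  have "(\<lambda>n. risk n (lam n) (s n) (A n) (\<lambda>Y. HC n (lam n) Y > ln (real n))) \<longlonglongrightarrow> 0"
    by (rule tendsto_sandwich[OF _ _ tendsto_const b]) (use upper in \<open>auto elim: eventually_mono\<close>)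
  then show ?thesis
    unfolding asymp_powerful_def zero_ereal_def by (intro lim_imp_Limsup) auto
qed

text \<open>The margin 1 - \<alpha> - (y - q)^2 - (1 - y^2) / 2 is maximal at y = 2q, where it is
  positive iff q^2 > \<alpha> - 1/2. When 2q passes 1, the choice y = 1 leaves the condition (1 -
  q)^2 < 1 - \<alpha>.\<close>

theorem powerful_above_threshold:
  assumes C: "C_sparse \<theta> \<alpha> < C" 
    and A: "\<forall>\<^sub>F n in sequentially. sqrt (C * ln (real n) / lam n) \<le> tanh (A n)"
  shows "asymp_powerful lam s A (\<lambda>n Y. HC n (lam n) Y > ln (real n))"
proof -
  define w where "w = sqrt (1 - \<theta>)"
  have w: "0 < w" "w\<^sup>2 = 1 - \<theta>" using theta_bounds by (auto simp: w_def)
  show ?thesis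
  proof (cases "\<alpha> < 3 / 4")
    case True
    \<comment> \<open>Lowered below 1/4 if necessary so that y = 2 sqrt \<rho> stays below 1; a test
      that detects a weaker signal also detects the given one. The second entry is the midpoint
      between \<alpha> - 1/2 and 1/4.\<close>
    define \<rho> where "\<rho> = min (C / (16 * w\<^sup>2)) ((\<alpha> - 1 / 2 + 1 / 4) / 2)"
    have "(\<alpha> - 1 / 2) * (16 * w\<^sup>2) < C" using C True by (simp add: C_sparse_def w(2) mult.commute)
    then have "\<alpha> - 1 / 2 < C / (16 * w\<^sup>2)" using w(1) by (simp add: pos_less_divide_eq)
    then have "\<alpha> - 1 / 2 < \<rho>" using True by (simp add: \<rho>_def)
    moreover have "\<rho> \<le> (\<alpha> - 1 / 2 + 1 / 4) / 2" unfolding \<rho>_def by (rule min.cobounded2)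
    then have "\<rho> < 1 / 4" using True by simp
    ultimately have \<rho>: "\<alpha> - 1 / 2 < \<rho>" "\<rho> < 1 / 4" by blast+
    have \<rho>0: "0 < \<rho>" using \<rho> alpha by simp
    have "sqrt \<rho> < sqrt ((1 / 2)\<^sup>2)" using \<rho> by (intro real_sqrt_less_mono) (simp add: power2_eq_square)
    then have half: "sqrt \<rho> < 1 / 2" by simp
    have sq: "(sqrt \<rho>)\<^sup>2 = \<rho>" using \<rho>0 by simp
    have "16 * w\<^sup>2 * \<rho> \<le> 16 * w\<^sup>2 * (C / (16 * w\<^sup>2))" by (intro mult_left_mono) (auto simp: \<rho>_def)
    then have "(4 * w * sqrt \<rho>)\<^sup>2 \<le> C" using w(1) \<rho>0 by (simp add: power_mult_distrib)
    then show ?thesis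
    proof (intro powerful_at_level[where q = "sqrt \<rho>" and y = "2 * sqrt \<rho>", OF _ _ _ _ _ _ A])
      show "(2 * sqrt \<rho> - sqrt \<rho>)\<^sup>2 < 1 - \<alpha>" using \<rho> True sq by simp
      show "(1 - (2 * sqrt \<rho>)\<^sup>2) / 2 < 1 - \<alpha> - (2 * sqrt \<rho> - sqrt \<rho>)\<^sup>2"
        using \<rho> sq by (simp add: power_mult_distrib)
    qed (use \<rho>0 half in \<open>auto simp: w_def\<close>)
  next
    case False
    define h where "h = sqrt (1 - \<alpha>)"
    have h: "0 < h" "h\<^sup>2 = 1 - \<alpha>" "h < 1" using alpha by (auto simp: h_def)
    \<comment> \<open>Lowered below 1 if necessary, because the level y = 1 must lie above the
      shift; the second entry is the midpoint between 1 - h and 1.\<close>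
    define q where "q = min (sqrt C / (4 * w)) ((1 - h + 1) / 2)"
    have Cs: "(4 * w * (1 - h))\<^sup>2 < C"
      using C False by (simp add: C_sparse_def h_def power_mult_distrib w(2))
    then have "4 * w * (1 - h) < sqrt C" by (rule real_less_rsqrt)
    then have "1 - h < sqrt C / (4 * w)" using w(1) by (simp add: pos_less_divide_eq mult.commute)
    then have q: "1 - h < q" "q < 1" using h by (auto simp: q_def min_less_iff_disj)
    have q0: "0 < q" using q h by simp
    have "q \<le> sqrt C / (4 * w)" by (simp add: q_def)
    then have "4 * w * q \<le> sqrt C" using w(1) by (simp add: pos_le_divide_eq mult.commute)
    then have "(4 * w * q)\<^sup>2 \<le> (sqrt C)\<^sup>2" using w q0 by (intro power_mono) auto
    moreover have "0 \<le> C" using Cs by (smt (verit) zero_le_power2)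
    ultimately have Cq: "(4 * w * q)\<^sup>2 \<le> C" by simp
    have lt: "(1 - q)\<^sup>2 < 1 - \<alpha>" unfolding h(2)[symmetric] using q by (intro power_strict_mono) auto
    show ?thesis
      by (rule powerful_at_level[where q = q and y = 1, OF _ _ _ _ _ _ A])
        (use q0 q Cq lt in \<open>auto simp: w_def\<close>)
  qed
qed

end

theorem theorem3p2:
  fixes \<alpha> \<theta> :: real and s :: "nat \<Rightarrow> nat" and lam A :: "nat \<Rightarrow> real"
  assumes alpha: "1/2 < \<alpha>" "\<alpha> < 1"
    and s: "\<forall>n\<ge>1. s n = nat \<lfloor>real n powr (1 - \<alpha>)\<rfloor> \<or> s n = nat \<lceil>real n powr (1 - \<alpha>)\<rceil>"
    and lam: "\<forall>n\<ge>1. 1 \<le> lam n \<and> lam n \<le> real n"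
    and theta: "(\<lambda>n. lam n / (2 * real n)) \<longlonglongrightarrow> \<theta>"
    and A: "\<forall>n\<ge>1. 0 < A n"
  shows
    "((\<lambda>n. lam n / ln (real n)) \<longlonglongrightarrow> 0 \<longrightarrow> (\<forall>T. asymp_powerless lam s A T))
     \<and> ((\<lambda>n. ln (real n) / lam n) \<longlonglongrightarrow> 0 \<longrightarrow>
         (\<forall>C>0.
            (C_sparse \<theta> \<alpha> < C
              \<and> (\<forall>\<^sub>F n in sequentially. tanh (A n) \<ge> sqrt (C * ln (real n) / lam n))
              \<longrightarrow> (\<exists>h. asymp_powerful lam s A (\<lambda>n Y. HC n (lam n) Y > h n)))
          \<and> (C < C_sparse \<theta> \<alpha>
              \<and> (\<forall>\<^sub>F n in sequentially. tanh (A n) \<le> sqrt (C * ln (real n) / lam n))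
              \<longrightarrow> (\<forall>T. asymp_powerless lam s A T))))"
proof -
  interpret sparse_model \<alpha> \<theta> s lam by unfold_locales fact+
  show ?thesis
  proof (intro conjI impI allI)
    fix T assume "(\<lambda>n. lam n / ln (real n)) \<longlonglongrightarrow> 0"
    then show "asymp_powerless lam s A T" using A by (rule powerless_small_lam)
  next
    fix C :: real
    assume "(\<lambda>n. ln (real n) / lam n) \<longlonglongrightarrow> 0" and "0 < C"
    then interpret strong_regime \<alpha> \<theta> s lam by unfold_locales
    assume "C_sparse \<theta> \<alpha> < C \<and> (\<forall>\<^sub>F n in sequentially. tanh (A n) \<ge> sqrt (C * ln (real n) / lam n))"
    then show "\<exists>h. asymp_powerful lam s A (\<lambda>n Y. HC n (lam n) Y > h n)"
      using powerful_above_threshold[of C A] by (intro exI[of _ "\<lambda>n. ln (real n)"]) blast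
  next
    fix C :: real and T
    assume "(\<lambda>n. ln (real n) / lam n) \<longlonglongrightarrow> 0" and C: "0 < C"
    then interpret strong_regime \<alpha> \<theta> s lam by unfold_locales
    assume "C < C_sparse \<theta> \<alpha> \<and> (\<forall>\<^sub>F n in sequentially. tanh (A n) \<le> sqrt (C * ln (real n) / lam n))"
    then show "asymp_powerless lam s A T"
      using powerless_below_threshold[OF C] by blast
  qed
qed

end
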